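(* Let $D$ be a strictly convex domain of $\mathbb{C}^2$, let $f_1$ and $f_2$ be two holomorphic functions defined on a neighborhood of $\overline D$ and set $X_l=\{z:\ f_l(z)=0\}$, $l=1,2$. Suppose that $X_1\cap bD$ and $X_2\cap bD$ are transverse, and that $X_1\cap X_2$ is a complete intersection. Let $g$ be a function holomorphic on $D$ and assume that there exists $\kappa>0$ such that for all $z\in D$ there exist two functions $\hat g_1$ and $\hat g_2$, depending on $z$, $C^\infty$-smooth on $\mathcal{P}_{\kappa|\rho(z)|}(z)$, such that (a) $g=\hat g_1f_1+\hat g_2f_2$ on $\mathcal{P}_{\kappa|\rho(z)|}(z)$; (b) for all non-negative integers $\alpha,\beta,\overline\alpha,\overline\beta$ there exists $c>0$, not depending on $z$, such that for $l=1$ and $l=2$ $$\sup_{\zeta\in\mathcal{P}_{\kappa|\rho(z)|}(z)}\left|\frac{\partial^{\alpha+\overline\alpha+\beta+\overline\beta}\hat g_l}{\partial{\zeta_1^*}^{\alpha}\,\partial{\zeta_2^*}^{\beta}\,\partial\overline{\zeta_1^*}^{\,\overline\alpha}\,\partial\overline{\zeta_2^*}^{\,\overline\beta}}(\zeta)\right|\,|\rho(z)|^{\alpha+\overline\alpha+\frac{\beta+\overline\beta}{2}}\leq c,$$ where $(\zeta_1^*,\zeta_2^* )$ are the Koranyi coordinates at $z$. Then there exist two smooth functions $\tilde g_1$ and $\tilde g_2$ on $D$ such that (i) $g=\tilde g_1f_1+\tilde g_2f_2$ on $D$; (ii) there exists $N\in\mathbb{N}$ such that $|\rho|^N\tilde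 g_1$ and $|\rho|^N\tilde g_2$ vanish to order $k_2$ on $bD$; (iii) for $l=1,2$, the function $\zeta\mapsto\left|\frac{\partial^{\alpha+\beta}\tilde g_l}{\partial\overline{\eta_\zeta}^{\alpha}\,\partial\overline{v_\zeta}^{\beta}}(\zeta)\right|\,|\rho(\zeta)|^{\alpha+\frac{\beta}{2}}$ belongs to $L^\infty(D)$ for all non-negative integers $\alpha,\beta$ with $\alpha+\beta\leq k_1$.
   Context: The (bounded) strictly convex domain is written $D=\{z\in\mathbb{C}^2:\ \rho(z)<0\}$, where $\rho$ is a smooth strictly convex function on $\mathbb{C}^2$ whose gradient does not vanish in a neighborhood $\mathcal U$ of $bD$; $D_r=\{\rho<r\}$. For $\zeta\in\mathcal U$, $\eta_\zeta$ is the outer unit normal to $bD_{\rho(\zeta)}$ at $\zeta$, and $v_\zeta$ is a smooth unitary complex vector field (complex) tangent at $\zeta$ to $bD_{\rho(\zeta)}$. The Koranyi coordinates at $z$ are the coordinates $(\zeta_1^*,\zeta_2^* )$ in the system centered at $z$ with basis $\eta_z,v_z$: $\zeta=z+\zeta_1^*\eta_z+\zeta_2^*v_z$. The Koranyi ball centered at $z$ of radius $r$ is $\mathcal{P}_r(z)=\{z+\lambda\eta_z+\mu v_z:\ |\lambda|<r,\ |\mu|<r^{1/2}\}$. (For $z\in D\setminus\mathcal U$ one uses any orthonormal basis in place of $\eta_z,v_z$.) The derivative $\frac{\partial^{\alpha+\beta}h}{\partial\overline{\eta_\zeta}^\alpha\partial\overline{v_\zeta}^\beta}(\zeta)$ is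 the value at $\lambda=\mu=0$ of $\frac{\partial^{\alpha+\beta}}{\partial\overline\lambda^\alpha\partial\overline\mu^\beta}h(\zeta+\lambda\eta_\zeta+\mu v_\zeta)$, considered for $\zeta\in D\cap\mathcal U$. "$X_l\cap bD$ is transverse" means transverse in the sense of tangent cones: at each point of $X_l\cap bD$ no complex line of the tangent cone of $X_l$ is contained in the tangent space of $bD$. "$X_1\cap X_2$ is a complete intersection" means that it has codimension $2$ (or is empty). The integers $k_1,k_2\geq1$ depend only on $f_1,f_2$ and are those having the following division property: whenever $g$ is holomorphic on $D$, belongs to the ideal generated by $f_1,f_2$, and admits smooth $\tilde g_1,\tilde g_2$ on $D$ with $g=\tilde g_1f_1+\tilde g_2f_2$, with $|\rho|^N\tilde g_l$ vanishing to order $k_2$ on $bD$ for some $N\in\mathbb N$ ($l=1,2$), and with $\left|\frac{\partial^{\alpha+\beta}\tilde g_l}{\partial\overline{\eta_\zeta}^{\alpha}\partial\overline{v_\zeta}^{\beta}}\right||\rho|^{\alpha+\beta/2}\in L^q(D)$ for $l=1,2$ and all $\alpha+\beta\le k_1$, for some $q\in[1,+\infty]$, there are holomorphic $g_1,g_2$ on $D$, in $L^q(D)$ if $q<\infty$ and in $BMO(D)$ if $q=\infty$, with $g=g_1f_1+g_2f_2$. *)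

theory Defs
  imports "HOL-Analysis.Analysis"
begin

section \<open>Smooth and holomorphic functions\<close>

fun C_k_on :: "nat \<Rightarrow> ('a::real_normed_vector \<Rightarrow> 'b::real_normed_vector) \<Rightarrow> 'a set \<Rightarrow> bool" where
  "C_k_on 0 f S \<longleftrightarrow> continuous_on S f"
| "C_k_on (Suc k) f S \<longleftrightarrow>
     (\<forall>x\<in>S. f differentiable (at x)) \<and> (\<forall>u. C_k_on k (\<lambda>x. frechet_derivative f (at x) u) S)"

text \<open>Meant for open sets only, since \<open>C_k_on\<close> uses two-sided derivatives.\<close>

definition smooth_on :: "('a::real_normed_vector \<Rightarrow> 'b::real_normed_vector) \<Rightarrow> 'a set \<Rightarrow> bool" where
  "smooth_on f S \<longleftrightarrow> (\<forall>k. C_k_on k f S)"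

definition holomorphic2_on :: "(complex^2 \<Rightarrow> complex) \<Rightarrow> (complex^2) set \<Rightarrow> bool" where
  "holomorphic2_on f S \<longleftrightarrow>
     (\<forall>z\<in>S. \<exists>L. (f has_derivative L) (at z) \<and> (\<forall>c h. L (c *s h) = c * L h))"

definition strictly_convex :: "('a::real_vector \<Rightarrow> real) \<Rightarrow> bool" where
  "strictly_convex \<rho> \<longleftrightarrow>
     (\<forall>x y t. x \<noteq> y \<and> 0 < t \<and> t < 1 \<longrightarrow>
        \<rho> ((1 - t) *\<^sub>R x + t *\<^sub>R y) < (1 - t) * \<rho> x + t * \<rho> y)"

section \<open>The domain and its normal and tangential frame\<close>

definition grad :: "('a::euclidean_space \<Rightarrow> real) \<Rightarrow> 'a \<Rightarrow> 'a" where
  "grad \<rho> z = (\<Sum>b\<in>Basis. frechet_derivative \<rho> (at z) b *\<^sub>R b)"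

definition strictly_convex_domain ::
  "(complex^2 \<Rightarrow> real) \<Rightarrow> (complex^2) set \<Rightarrow> (complex^2) set \<Rightarrow> bool" where
  "strictly_convex_domain \<rho> U D \<longleftrightarrow>
     smooth_on \<rho> UNIV \<and> strictly_convex \<rho> \<and> D = {z. \<rho> z < 0} \<and> D \<noteq> {} \<and> bounded D \<and>
     open U \<and> frontier D \<subseteq> U \<and> (\<forall>z\<in>U. grad \<rho> z \<noteq> 0)"

text \<open>The (real) tangent space at \<open>z\<close> of the level set of \<open>\<rho>\<close> through \<open>z\<close>.\<close>

definition tangent_space :: "(complex^2 \<Rightarrow> real) \<Rightarrow> complex^2 \<Rightarrow> (complex^2) set" where
  "tangent_space \<rho> z = {h. frechet_derivative \<rho> (at z) h = 0}"

definition outer_unit_normal :: "(complex^2 \<Rightarrow> real) \<Rightarrow> complex^2 \<Rightarrow> complex^2" where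
  "outer_unit_normal \<rho> z = grad \<rho> z /\<^sub>R norm (grad \<rho> z)"

definition herm :: "complex^2 \<Rightarrow> complex^2 \<Rightarrow> complex" where
  "herm x y = (\<Sum>i\<in>UNIV. x $ i * cnj (y $ i))"

text \<open>On \<open>D - U\<close>, where the gradient of \<open>\<rho>\<close> may vanish, \<open>\<eta> z, v z\<close> is an
  arbitrary orthonormal basis (with no regularity in \<open>z\<close>).\<close>

definition koranyi_frame ::
  "(complex^2 \<Rightarrow> real) \<Rightarrow> (complex^2) set \<Rightarrow> (complex^2) set \<Rightarrow>
   (complex^2 \<Rightarrow> complex^2) \<Rightarrow> (complex^2 \<Rightarrow> complex^2) \<Rightarrow> bool" where
  "koranyi_frame \<rho> U D \<eta> v \<longleftrightarrow>
     (\<forall>z\<in>U. \<eta> z = outer_unit_normal \<rho> z) \<and>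
     smooth_on v U \<and> (\<forall>z\<in>U. norm (v z) = 1 \<and> (\<forall>c. c *s v z \<in> tangent_space \<rho> z)) \<and>
     (\<forall>z\<in>D - U. norm (\<eta> z) = 1 \<and> norm (v z) = 1 \<and> herm (\<eta> z) (v z) = 0)"

section \<open>Koranyi coordinates and balls\<close>

text \<open>The point with Koranyi coordinates \<open>w\<close> at \<open>z\<close>.\<close>

definition koranyi_point ::
  "(complex^2 \<Rightarrow> complex^2) \<Rightarrow> (complex^2 \<Rightarrow> complex^2) \<Rightarrow> complex^2 \<Rightarrow> complex^2 \<Rightarrow> complex^2" where
  "koranyi_point \<eta> v z w = z + (w $ 1) *s \<eta> z + (w $ 2) *s v z"

definition koranyi_bidisc :: "real \<Rightarrow> (complex^2) set" where
  "koranyi_bidisc r = {w. norm (w $ 1) < r \<and> norm (w $ 2) < sqrt r}"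

definition koranyi_ball ::
  "(complex^2 \<Rightarrow> complex^2) \<Rightarrow> (complex^2 \<Rightarrow> complex^2) \<Rightarrow> complex^2 \<Rightarrow> real \<Rightarrow> (complex^2) set" where
  "koranyi_ball \<eta> v z r = koranyi_point \<eta> v z ` koranyi_bidisc r"

definition wirtinger :: "2 \<Rightarrow> (complex^2 \<Rightarrow> complex) \<Rightarrow> complex^2 \<Rightarrow> complex" where
  "wirtinger j F w =
     (frechet_derivative F (at w) (axis j 1) - \<i> * frechet_derivative F (at w) (axis j \<i>)) / 2"

definition wirtinger_bar :: "2 \<Rightarrow> (complex^2 \<Rightarrow> complex) \<Rightarrow> complex^2 \<Rightarrow> complex" where
  "wirtinger_bar j F w =
     (frechet_derivative F (at w) (axis j 1) + \<i> * frechet_derivative F (at w) (axis j \<i>)) / 2"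

text \<open>Derivative of \<open>h\<close> of order \<open>\<alpha>, \<beta>\<close> in the Koranyi coordinates at \<open>z\<close> and of order
  \<open>\<alpha>', \<beta>'\<close> in their conjugates, taken at the point with coordinates \<open>w\<close>.\<close>

definition koranyi_deriv ::
  "(complex^2 \<Rightarrow> complex^2) \<Rightarrow> (complex^2 \<Rightarrow> complex^2) \<Rightarrow> nat \<Rightarrow> nat \<Rightarrow> nat \<Rightarrow> nat \<Rightarrow>
   (complex^2 \<Rightarrow> complex) \<Rightarrow> complex^2 \<Rightarrow> complex^2 \<Rightarrow> complex" where
  "koranyi_deriv \<eta> v \<alpha> \<beta> \<alpha>' \<beta>' h z w =
     ((wirtinger 1 ^^ \<alpha>) ((wirtinger 2 ^^ \<beta>)
       ((wirtinger_bar 1 ^^ \<alpha>') ((wirtinger_bar 2 ^^ \<beta>') (\<lambda>x. h (koranyi_point \<eta> v z x)))))) w"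

text \<open>The weighted \<open>\<partial>\<close>-bar derivative in the moving frame.\<close>

definition weighted_dbar ::
  "(complex^2 \<Rightarrow> real) \<Rightarrow> (complex^2 \<Rightarrow> complex^2) \<Rightarrow> (complex^2 \<Rightarrow> complex^2) \<Rightarrow> nat \<Rightarrow> nat \<Rightarrow>
   (complex^2 \<Rightarrow> complex) \<Rightarrow> complex^2 \<Rightarrow> real" where
  "weighted_dbar \<rho> \<eta> v \<alpha> \<beta> h \<zeta> =
     norm (koranyi_deriv \<eta> v 0 0 \<alpha> \<beta> h \<zeta> 0) * \<bar>\<rho> \<zeta>\<bar> powr (real \<alpha> + real \<beta> / 2)"

section \<open>Analytic sets: tangent cone, transversality, codimension\<close>

definition zero_set :: "(complex^2 \<Rightarrow> complex) \<Rightarrow> (complex^2) set \<Rightarrow> (complex^2) set" where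
  "zero_set f W = {z\<in>W. f z = 0}"

definition tangent_cone :: "('a::real_normed_vector) set \<Rightarrow> 'a \<Rightarrow> 'a set" where
  "tangent_cone X p =
     {u. \<exists>(x :: nat \<Rightarrow> 'a) (t :: nat \<Rightarrow> real).
           (\<forall>n. x n \<in> X) \<and> x \<longlonglongrightarrow> p \<and> (\<forall>n. 0 < t n) \<and> (\<lambda>n. t n *\<^sub>R (x n - p)) \<longlonglongrightarrow> u}"

definition complex_line :: "complex^2 \<Rightarrow> (complex^2) set" where
  "complex_line u = range (\<lambda>c. c *s u)"

definition transverse_to_boundary ::
  "(complex^2 \<Rightarrow> real) \<Rightarrow> (complex^2) set \<Rightarrow> (complex^2) set \<Rightarrow> bool" where
  "transverse_to_boundary \<rho> D X \<longleftrightarrow>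
     (\<forall>p \<in> X \<inter> frontier D. \<forall>u. u \<noteq> 0 \<longrightarrow>
        complex_line u \<subseteq> tangent_cone X p \<longrightarrow> \<not> complex_line u \<subseteq> tangent_space \<rho> p)"

text \<open>Near \<open>p\<close>, the set \<open>A\<close> is a complex submanifold of dimension \<open>d\<close>: some
  biholomorphic \<open>\<Phi>\<close>, with inverse \<open>\<Psi>\<close>, maps it onto an open piece of a \<open>d\<close>-dimensional
  complex linear subspace.\<close>

definition regular_point :: "(complex^2) set \<Rightarrow> nat \<Rightarrow> complex^2 \<Rightarrow> bool" where
  "regular_point A d p \<longleftrightarrow>
     p \<in> A \<and>
     (\<exists>V (\<Phi> :: complex^2 \<Rightarrow> complex^2) (\<Psi> :: complex^2 \<Rightarrow> complex^2) L.
        open V \<and> p \<in> V \<and> open (\<Phi> ` V) \<and>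
        (\<forall>i. holomorphic2_on (\<lambda>x. \<Phi> x $ i) V) \<and> (\<forall>i. holomorphic2_on (\<lambda>y. \<Psi> y $ i) (\<Phi> ` V)) \<and>
        (\<forall>x\<in>V. \<Psi> (\<Phi> x) = x) \<and>
        vec.subspace L \<and> vec.dim L = d \<and> \<Phi> ` (A \<inter> V) = \<Phi> ` V \<inter> L)"

text \<open>For a nonempty analytic set; these always have regular points.\<close>

definition analytic_codim :: "(complex^2) set \<Rightarrow> nat" where
  "analytic_codim A = 2 - Max {d. \<exists>p. regular_point A d p}"

definition complete_intersection :: "(complex^2) set \<Rightarrow> (complex^2) set \<Rightarrow> bool" where
  "complete_intersection X1 X2 \<longleftrightarrow> X1 \<inter> X2 = {} \<or> analytic_codim (X1 \<inter> X2) = 2"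

section \<open>Boundary vanishing, \<open>L\<^sup>q\<close> and BMO\<close>

text \<open>All partial derivatives of order at most \<open>k\<close> tend to \<open>0\<close> at the boundary.\<close>

definition vanishes_to_order :: "nat \<Rightarrow> (complex^2 \<Rightarrow> complex) \<Rightarrow> (complex^2) set \<Rightarrow> bool" where
  "vanishes_to_order k h D \<longleftrightarrow>
     (\<forall>us :: (complex^2) list. length us \<le> k \<longrightarrow>
       (\<forall>p\<in>frontier D.
         ((foldr (\<lambda>u F x. frechet_derivative F (at x) u) us h) \<longlongrightarrow> 0) (at p within D)))"

definition in_Lq :: "'a measure \<Rightarrow> ennreal \<Rightarrow> ('a \<Rightarrow> 'b::real_normed_vector) \<Rightarrow> bool" where
  "in_Lq M q h \<longleftrightarrow>
     h \<in> borel_measurable M \<and>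
     (if q = \<infinity> then \<exists>C. AE x in M. norm (h x) \<le> C
      else (\<integral>\<^sup>+x. ennreal (norm (h x) powr enn2real q) \<partial>M) < \<infinity>)"

definition set_average :: "(complex^2) set \<Rightarrow> (complex^2 \<Rightarrow> complex) \<Rightarrow> complex" where
  "set_average B h = (LINT x:B|lebesgue. h x) /\<^sub>R measure lebesgue B"

text \<open>Bounded mean oscillation over Koranyi balls. Integrability over all of \<open>D\<close> is no extra
  condition, since \<open>D\<close> is bounded and so is itself \<open>D\<close> intersected with a large Koranyi ball.\<close>

definition in_BMO ::
  "(complex^2 \<Rightarrow> complex^2) \<Rightarrow> (complex^2 \<Rightarrow> complex^2) \<Rightarrow> (complex^2) set \<Rightarrow> (complex^2 \<Rightarrow> complex) \<Rightarrow> bool" where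
  "in_BMO \<eta> v D h \<longleftrightarrow>
     set_integrable lebesgue D h \<and>
     (\<exists>C. \<forall>z\<in>D. \<forall>r>0.
        (let B = koranyi_ball \<eta> v z r \<inter> D in
          (LINT x:B|lebesgue. norm (h x - set_average B h)) / measure lebesgue B \<le> C))"

section \<open>The division property\<close>

text \<open>The moving frame is only smooth on \<open>U\<close>, so the weighted derivatives are considered
  on \<open>D \<inter> U\<close>; the rest of \<open>D\<close> is compact.\<close>

definition division_property ::
  "(complex^2 \<Rightarrow> real) \<Rightarrow> (complex^2) set \<Rightarrow> (complex^2) set \<Rightarrow>
   (complex^2 \<Rightarrow> complex^2) \<Rightarrow> (complex^2 \<Rightarrow> complex^2) \<Rightarrow>
   (complex^2 \<Rightarrow> complex) \<Rightarrow> (complex^2 \<Rightarrow> complex) \<Rightarrow> nat \<Rightarrow> nat \<Rightarrow> bool" where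
  "division_property \<rho> U D \<eta> v f1 f2 k1 k2 \<longleftrightarrow>
     (\<forall>g (q :: ennreal) gt1 gt2.
        holomorphic2_on g D \<and>
        (\<exists>h1 h2. holomorphic2_on h1 D \<and> holomorphic2_on h2 D \<and>
                 (\<forall>z\<in>D. g z = h1 z * f1 z + h2 z * f2 z)) \<and>
        smooth_on gt1 D \<and> smooth_on gt2 D \<and>
        (\<forall>z\<in>D. g z = gt1 z * f1 z + gt2 z * f2 z) \<and>
        (\<exists>N::nat. vanishes_to_order k2 (\<lambda>z. \<bar>\<rho> z\<bar> ^ N *\<^sub>R gt1 z) D \<and>
                  vanishes_to_order k2 (\<lambda>z. \<bar>\<rho> z\<bar> ^ N *\<^sub>R gt2 z) D) \<and>
        1 \<le> q \<and>
        (\<forall>\<alpha> \<beta>. \<alpha> + \<beta> \<le> k1 \<longrightarrow>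
           in_Lq (lebesgue_on (D \<inter> U)) q (weighted_dbar \<rho> \<eta> v \<alpha> \<beta> gt1) \<and>
           in_Lq (lebesgue_on (D \<inter> U)) q (weighted_dbar \<rho> \<eta> v \<alpha> \<beta> gt2))
        \<longrightarrow>
        (\<exists>g1 g2. holomorphic2_on g1 D \<and> holomorphic2_on g2 D \<and>
           (\<forall>z\<in>D. g z = g1 z * f1 z + g2 z * f2 z) \<and>
           (if q = \<infinity> then in_BMO \<eta> v D g1 \<and> in_BMO \<eta> v D g2
            else in_Lq (lebesgue_on D) q g1 \<and> in_Lq (lebesgue_on D) q g2)))"

end

theory Submission
  imports Defs
begin

text \<open>
  At \<open>z \<in> D\<close> let \<open>L z\<close> send the unit bidisc to the Koranyi ball of radius \<open>\<bar>\<rho> z\<bar>\<close>: it stretches by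
  \<open>\<bar>\<rho> z\<bar>\<close> along \<open>\<eta> z\<close> and by \<open>sqrt \<bar>\<rho> z\<bar>\<close> along \<open>v z\<close>.  In the chart \<open>w \<mapsto> z + L z w\<close>
  hypothesis (b) says that the local solutions have all derivatives bounded uniformly in \<open>z\<close>.
  Since \<open>v z\<close> is tangent to the level set of \<open>\<rho>\<close> and \<open>v\<close> is Lipschitz near the boundary, \<open>\<rho>\<close> is
  comparable to \<open>\<rho> z\<close> on a small Koranyi ball at \<open>z\<close> and the changes between overlapping charts have
  bounded linear parts.  The frames thus form a slowly varying metric in the sense of Hormander, which
  has a partition of unity whose derivatives in the charts are uniformly bounded, and gluing the
  local solutions with it gives functions with uniformly bounded derivatives in every chart.  Scaling
  back at the centre of the chart gives (iii), and shows that the derivatives of order \<open>k\<close> are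
  \<open>O(\<bar>\<rho>\<bar> powr - k)\<close>, hence (ii).
\<close>

section \<open>Uniform bounds on derivatives\<close>

text \<open>The frame is controlled near the boundary only: on \<open>D - U\<close> it is an
  arbitrary orthonormal basis, not even continuous in its centre. Apart from the Lipschitz bound for
  \<open>v\<close>, its variation therefore must not enter the estimates. A chart freezes the frame
  at its centre, and changes of charts are affine, with derivatives governed by their linear parts.
  The local solutions likewise depend on the centre without any regularity, so boundedness is a
  property of a whole family of functions, indexed by centres or pairs of centres, with the empty
  set as domain for inadmissible indices.

  The same freezing occurs in (iii): the derivative is taken in the frame fixed at
  \<open>\<zeta>\<close>, hence it is a derivative in the chart at \<open>\<zeta>\<close>, evaluated
  at the origin. How the frame moves with \<open>\<zeta>\<close> matters there only for
  measurability, for which continuity of \<open>\<eta>\<close> and \<open>v\<close> on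
  \<open>U\<close> is enough.

  Hypothesis (b) controls Wirtinger derivatives in one fixed order, whereas products, quotients and
  changes of charts call for all real directional derivatives. The symmetry of second derivatives
  bridges the two.\<close>

abbreviation dir_deriv ::
  "'a::real_normed_vector \<Rightarrow> ('a \<Rightarrow> 'b::real_normed_vector) \<Rightarrow> 'a \<Rightarrow> 'b" where
  "dir_deriv u f \<equiv> (\<lambda>x. frechet_derivative f (at x) u)"

lemma dir_derivI: "(f has_derivative f') (at x) \<Longrightarrow> dir_deriv u f x = f' u"
  using frechet_derivative_at by metis

lemma has_derivative_dir_deriv:
  "f differentiable (at x) \<Longrightarrow> (f has_derivative (\<lambda>u. dir_deriv u f x)) (at x)"
  by (simp add: frechet_derivative_works)

lemma dir_deriv_cong_open:
  assumes "open S" "x \<in> S" "\<And>y. y \<in> S \<Longrightarrow> f y = g y"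
  shows "dir_deriv u f x = dir_deriv u g x"
proof -
  have "(f has_derivative f') (at x) \<longleftrightarrow> (g has_derivative f') (at x)" for f'
    using has_derivative_transform_within_open[of _ _ x UNIV S] assms by metis
  then show ?thesis
    by (simp add: frechet_derivative_def)
qed

lemma differentiable_cong_open:
  assumes "open S" "x \<in> S" "\<And>y. y \<in> S \<Longrightarrow> f y = g y" "f differentiable (at x)"
  shows "g differentiable (at x)"
  using assms has_derivative_transform_within_open[of f _ x UNIV S g]
  unfolding differentiable_def by metis

lemma dir_deriv_basis:
  fixes f :: "'a::euclidean_space \<Rightarrow> 'b::real_normed_vector"
  assumes "f differentiable (at x)"
  shows "dir_deriv u f x = (\<Sum>b\<in>Basis. (u \<bullet> b) *\<^sub>R dir_deriv b f x)"
proof -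
  have l: "linear (frechet_derivative f (at x))"
    using assms by (rule linear_frechet_derivative)
  have "frechet_derivative f (at x) u = frechet_derivative f (at x) (\<Sum>b\<in>Basis. (u \<bullet> b) *\<^sub>R b)"
    by (simp add: euclidean_representation)
  also have "\<dots> = (\<Sum>b\<in>Basis. (u \<bullet> b) *\<^sub>R dir_deriv b f x)"
    using l by (simp add: linear_sum linear_scale)
  finally show ?thesis .
qed

text \<open>Every derivative costs one factor of the weight \<open>\<omega>\<close>.\<close>

fun Ck_bdd :: "('a::real_normed_vector \<Rightarrow> real) \<Rightarrow> ('i \<Rightarrow> 'a set) \<Rightarrow> nat \<Rightarrow> nat \<Rightarrow>
    ('i \<Rightarrow> 'a \<Rightarrow> 'b::real_normed_vector) \<Rightarrow> bool" where
  "Ck_bdd \<omega> S 0 m f \<longleftrightarrow> (\<exists>C. \<forall>i. \<forall>x\<in>S i. norm (f i x) * \<omega> x ^ m \<le> C)"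
| "Ck_bdd \<omega> S (Suc k) m f \<longleftrightarrow> (\<exists>C. \<forall>i. \<forall>x\<in>S i. norm (f i x) * \<omega> x ^ m \<le> C) \<and>
     (\<forall>i. \<forall>x\<in>S i. f i differentiable (at x)) \<and> (\<forall>u. Ck_bdd \<omega> S k (Suc m) (\<lambda>i. dir_deriv u (f i)))"

lemma Ck_bdd_bound:
  assumes "Ck_bdd \<omega> S k m f"
  shows "\<exists>C>0. \<forall>i. \<forall>x\<in>S i. norm (f i x) * \<omega> x ^ m \<le> C"
proof -
  obtain C where C: "\<And>i x. x \<in> S i \<Longrightarrow> norm (f i x) * \<omega> x ^ m \<le> C"
    using assms by (cases k) auto
  show ?thesis
    by (rule exI[of _ "max C 1"]) (use C in \<open>auto simp: le_max_iff_disj\<close>)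
qed

lemma Ck_bddE:
  assumes "Ck_bdd \<omega> S k m f"
  obtains C where "0 < C" "\<And>i x. x \<in> S i \<Longrightarrow> norm (f i x) * \<omega> x ^ m \<le> C"
  using Ck_bdd_bound[OF assms] by blast

lemma Ck_bdd_Suc:
  "Ck_bdd \<omega> S (Suc k) m f \<longleftrightarrow> Ck_bdd \<omega> S 0 m f \<and>
     (\<forall>i. \<forall>x\<in>S i. f i differentiable (at x)) \<and> (\<forall>u. Ck_bdd \<omega> S k (Suc m) (\<lambda>i. dir_deriv u (f i)))"
  by simp

declare Ck_bdd.simps(2) [simp del]

lemma Ck_bdd_SucD: "Ck_bdd \<omega> S (Suc k) m f \<Longrightarrow> Ck_bdd \<omega> S k m f"
  by (induction k arbitrary: m f) (auto simp: Ck_bdd_Suc)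

lemma Ck_bdd_cong:
  assumes "Ck_bdd \<omega> S k m f" "\<And>i. open (S i)" "\<And>i x. x \<in> S i \<Longrightarrow> f i x = g i x"
  shows "Ck_bdd \<omega> S k m g"
  using assms(1,3)
proof (induction k arbitrary: m f g)
  case (Suc k)
  have "Ck_bdd \<omega> S k (Suc m) (\<lambda>i. dir_deriv u (g i))" for u
  proof (rule Suc.IH)
    show "Ck_bdd \<omega> S k (Suc m) (\<lambda>i. dir_deriv u (f i))"
      using Suc.prems by (simp add: Ck_bdd_Suc)
    show "dir_deriv u (f i) x = dir_deriv u (g i) x" if "x \<in> S i" for i x
      using dir_deriv_cong_open[of "S i" x "f i" "g i"] that assms(2) Suc.prems by auto
  qed
  moreover have "g i differentiable (at x)" if "x \<in> S i" for i x
    using differentiable_cong_open[of "S i" x "f i" "g i"] that assms(2) Suc.prems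
    by (auto simp: Ck_bdd_Suc)
  ultimately show ?case
    using Suc.prems by (auto simp: Ck_bdd_Suc)
qed auto

lemma Ck_bdd_add:
  assumes "Ck_bdd \<omega> S k m f" "Ck_bdd \<omega> S k m g" "\<And>i. open (S i)" "\<And>x. 0 \<le> \<omega> x"
  shows "Ck_bdd \<omega> S k m (\<lambda>i x. f i x + g i x)"
  using assms(1,2)
proof (induction k arbitrary: m f g)
  case 0
  obtain C where C: "\<And>i x. x \<in> S i \<Longrightarrow> norm (f i x) * \<omega> x ^ m \<le> C"
    using Ck_bdd_bound[OF 0(1)] by metis
  obtain C' where C': "\<And>i x. x \<in> S i \<Longrightarrow> norm (g i x) * \<omega> x ^ m \<le> C'"
    using Ck_bdd_bound[OF 0(2)] by metis
  have "norm (f i x + g i x) * \<omega> x ^ m \<le> C + C'" if "x \<in> S i" for i x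
  proof -
    have "norm (f i x + g i x) * \<omega> x ^ m \<le> (norm (f i x) + norm (g i x)) * \<omega> x ^ m"
      by (intro mult_right_mono norm_triangle_ineq) (use assms(4) in auto)
    then show ?thesis
      using C[OF that] C'[OF that] by (simp add: algebra_simps)
  qed
  then show ?case by auto
next
  case (Suc k)
  have d: "f i differentiable (at x)" "g i differentiable (at x)" if "x \<in> S i" for i x
    using Suc.prems that by (auto simp: Ck_bdd_Suc)
  have "Ck_bdd \<omega> S k (Suc m) (\<lambda>i. dir_deriv u (\<lambda>x. f i x + g i x))" for u
  proof (rule Ck_bdd_cong[OF Suc.IH assms(3)])
    show "Ck_bdd \<omega> S k (Suc m) (\<lambda>i. dir_deriv u (f i))" "Ck_bdd \<omega> S k (Suc m) (\<lambda>i. dir_deriv u (g i))"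
      using Suc.prems by (auto simp: Ck_bdd_Suc)
    show "dir_deriv u (f i) x + dir_deriv u (g i) x = dir_deriv u (\<lambda>x. f i x + g i x) x"
      if "x \<in> S i" for i x
      by (rule dir_derivI[symmetric])
        (use d[OF that] in \<open>auto intro!: derivative_eq_intros has_derivative_dir_deriv\<close>)
  qed
  moreover have "Ck_bdd \<omega> S k m (\<lambda>i x. f i x + g i x)"
    using Suc.IH Suc.prems Ck_bdd_SucD by blast
  then have "Ck_bdd \<omega> S 0 m (\<lambda>i x. f i x + g i x)"
    by (cases k) (auto simp: Ck_bdd_Suc)
  ultimately show ?case
    using d by (auto simp: Ck_bdd_Suc)
qed

lemma Ck_bdd_0: "Ck_bdd \<omega> S k m f \<Longrightarrow> Ck_bdd \<omega> S 0 m f"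
  by (cases k) (auto simp: Ck_bdd_Suc)

text \<open>Leibniz rule: differentiating either factor raises its own exponent by one, so both
  terms of the derivative carry the total exponent \<open>m + n + 1\<close>.\<close>

lemma Ck_bdd_mult:
  fixes f g :: "'i \<Rightarrow> 'a::real_normed_vector \<Rightarrow> 'b::real_normed_algebra"
  assumes "Ck_bdd \<omega> S k m f" "Ck_bdd \<omega> S k n g" "\<And>i. open (S i)" "\<And>x. 0 \<le> \<omega> x"
  shows "Ck_bdd \<omega> S k (m + n) (\<lambda>i x. f i x * g i x)"
  using assms(1,2)
proof (induction k arbitrary: m n f g)
  case 0
  obtain C where C: "0 < C" "\<And>i x. x \<in> S i \<Longrightarrow> norm (f i x) * \<omega> x ^ m \<le> C"
    using Ck_bdd_bound[OF 0(1)] by metis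
  obtain C' where C': "0 < C'" "\<And>i x. x \<in> S i \<Longrightarrow> norm (g i x) * \<omega> x ^ n \<le> C'"
    using Ck_bdd_bound[OF 0(2)] by metis
  have "norm (f i x * g i x) * \<omega> x ^ (m + n) \<le> C * C'" if "x \<in> S i" for i x
  proof -
    have "norm (f i x * g i x) * \<omega> x ^ (m + n) \<le> (norm (f i x) * norm (g i x)) * \<omega> x ^ (m + n)"
      by (intro mult_right_mono norm_mult_ineq) (use assms(4) in auto)
    also have "\<dots> = (norm (f i x) * \<omega> x ^ m) * (norm (g i x) * \<omega> x ^ n)"
      by (simp add: power_add)
    also have "\<dots> \<le> C * C'"
      by (intro mult_mono C C' that) (use C(1) assms(4) in auto)
    finally show ?thesis .
  qed
  then show ?case by auto
next
  case (Suc k)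
  have d: "f i differentiable (at x)" "g i differentiable (at x)" if "x \<in> S i" for i x
    using Suc.prems that by (auto simp: Ck_bdd_Suc)
  have "Ck_bdd \<omega> S k (Suc (m + n)) (\<lambda>i. dir_deriv u (\<lambda>x. f i x * g i x))" for u
  proof (rule Ck_bdd_cong[OF Ck_bdd_add[OF _ _ assms(3,4)] assms(3)])
    have "Ck_bdd \<omega> S k (Suc m) (\<lambda>i. dir_deriv u (f i))" "Ck_bdd \<omega> S k (Suc n) (\<lambda>i. dir_deriv u (g i))"
      using Suc.prems by (auto simp: Ck_bdd_Suc)
    from Suc.IH[OF Ck_bdd_SucD[OF Suc.prems(1)] this(2)] Suc.IH[OF this(1) Ck_bdd_SucD[OF Suc.prems(2)]]
    show "Ck_bdd \<omega> S k (Suc (m + n)) (\<lambda>i x. f i x * dir_deriv u (g i) x)"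
      "Ck_bdd \<omega> S k (Suc (m + n)) (\<lambda>i x. dir_deriv u (f i) x * g i x)"
      by simp_all
    show "f i x * dir_deriv u (g i) x + dir_deriv u (f i) x * g i x = dir_deriv u (\<lambda>x. f i x * g i x) x"
      if "x \<in> S i" for i x
      by (rule dir_derivI[symmetric])
        (use d[OF that] in \<open>auto intro!: derivative_eq_intros has_derivative_dir_deriv\<close>)
  qed
  moreover have "Ck_bdd \<omega> S 0 (m + n) (\<lambda>i x. f i x * g i x)"
    using Suc.IH Suc.prems Ck_bdd_SucD Ck_bdd_0 by blast
  ultimately show ?case
    using d by (auto simp: Ck_bdd_Suc differentiable_mult)
qed

section \<open>Families with uniform bounds, without weight\<close>

abbreviation unif_Ck :: "('i \<Rightarrow> 'a::real_normed_vector set) \<Rightarrow> nat \<Rightarrow>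
    ('i \<Rightarrow> 'a \<Rightarrow> 'b::real_normed_vector) \<Rightarrow> bool" where
  "unif_Ck S k f \<equiv> Ck_bdd (\<lambda>_. 1) S k 0 f"

text \<open>With weight 1 the exponent is inert. The recursion for \<open>unif_Ck\<close> can thus
  stay at exponent 0 instead of climbing with each derivative.\<close>

lemma Ck_bdd_one: "Ck_bdd (\<lambda>_. 1) S k m f \<longleftrightarrow> unif_Ck S k f"
proof -
  have "Ck_bdd (\<lambda>_. 1) S k m f \<Longrightarrow> Ck_bdd (\<lambda>_. 1) S k n f" for m n
  proof (induction k arbitrary: m n f)
    case (Suc k)
    then have "Ck_bdd (\<lambda>_. 1) S k (Suc n) (\<lambda>i. dir_deriv u (f i))" for u
      unfolding Ck_bdd_Suc by blast
    then show ?case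
      using Suc.prems by (simp add: Ck_bdd_Suc)
  qed simp
  then show ?thesis by blast
qed

lemma unif_Ck_bound: "unif_Ck S k f \<Longrightarrow> \<exists>C>0. \<forall>i. \<forall>x\<in>S i. norm (f i x) \<le> C"
  using Ck_bdd_bound[of "\<lambda>_. 1" S k 0 f] by simp

lemma unif_CkE:
  assumes "unif_Ck S k f"
  obtains C where "0 < C" "\<And>i x. x \<in> S i \<Longrightarrow> norm (f i x) \<le> C"
  using unif_Ck_bound[OF assms] by blast

lemma unif_Ck_Suc:
  "unif_Ck S (Suc k) f \<longleftrightarrow> (\<exists>C. \<forall>i. \<forall>x\<in>S i. norm (f i x) \<le> C) \<and>
     (\<forall>i. \<forall>x\<in>S i. f i differentiable (at x)) \<and> (\<forall>u. unif_Ck S k (\<lambda>i. dir_deriv u (f i)))"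
  by (simp add: Ck_bdd_Suc Ck_bdd_one[of S _ "Suc 0"])

text \<open>The guard \<open>S i \<noteq> {}\<close> matters: inadmissible indices, such as centres
  outside \<open>D\<close>, carry the empty set, and nothing is known about their constants.\<close>

lemma unif_Ck_const:
  assumes "\<And>i. S i \<noteq> {} \<Longrightarrow> norm (c i) \<le> C"
  shows "unif_Ck S k (\<lambda>i x. c i)"
proof -
  have z: "unif_Ck S k (\<lambda>i x. 0::'c::real_normed_vector)" for k
    by (induction k) (auto simp: unif_Ck_Suc)
  have "\<exists>C. \<forall>i. \<forall>x\<in>S i. norm (c i) \<le> C"
    using assms by (metis empty_iff)
  then show ?thesis
    by (cases k) (auto simp: unif_Ck_Suc z)
qed

lemma unif_Ck_add:
  assumes "unif_Ck S k f" "unif_Ck S k g" "\<And>i. open (S i)"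
  shows "unif_Ck S k (\<lambda>i x. f i x + g i x)"
  using Ck_bdd_add[OF assms] by simp

lemma unif_Ck_mult:
  fixes f g :: "'i \<Rightarrow> 'a::real_normed_vector \<Rightarrow> 'b::real_normed_algebra"
  assumes "unif_Ck S k f" "unif_Ck S k g" "\<And>i. open (S i)"
  shows "unif_Ck S k (\<lambda>i x. f i x * g i x)"
  using Ck_bdd_mult[OF assms] by simp

lemma unif_Ck_scaleR:
  assumes "unif_Ck S k f" "\<And>i. S i \<noteq> {} \<Longrightarrow> \<bar>c i\<bar> \<le> C" "\<And>i. open (S i)"
  shows "unif_Ck S k (\<lambda>i x. c i *\<^sub>R f i x)"
  using assms(1)
proof (induction k arbitrary: f)
  case 0
  obtain B where B: "0 < B" "\<And>i x. x \<in> S i \<Longrightarrow> norm (f i x) \<le> B"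
    using unif_CkE[OF 0] by blast
  have "norm (c i *\<^sub>R f i x) \<le> C * B" if "x \<in> S i" for i x
  proof -
    have "\<bar>c i\<bar> \<le> C" using assms(2)[of i] that by blast
    then show ?thesis using mult_mono[OF _ B(2)[OF that], of "\<bar>c i\<bar>" C] by simp
  qed
  then show ?case by auto
next
  case (Suc k)
  have d: "f i differentiable (at x)" if "x \<in> S i" for i x
    using Suc.prems that by (auto simp: unif_Ck_Suc)
  have "unif_Ck S k (\<lambda>i. dir_deriv u (\<lambda>x. c i *\<^sub>R f i x))" for u
  proof (rule Ck_bdd_cong[OF Suc.IH assms(3)])
    show "unif_Ck S k (\<lambda>i. dir_deriv u (f i))"
      using Suc.prems by (auto simp: unif_Ck_Suc)
    show "c i *\<^sub>R dir_deriv u (f i) x = dir_deriv u (\<lambda>x. c i *\<^sub>R f i x) x"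
      if "x \<in> S i" for i x
      by (rule dir_derivI[symmetric])
        (use d[OF that] in \<open>auto intro!: derivative_eq_intros has_derivative_dir_deriv\<close>)
  qed
  moreover have "Ck_bdd (\<lambda>_. 1) S 0 0 (\<lambda>i x. c i *\<^sub>R f i x)"
    using Suc.IH Suc.prems Ck_bdd_SucD Ck_bdd_0 by blast
  ultimately show ?case
    using d by (auto simp: unif_Ck_Suc)
qed

lemma unif_Ck_sum:
  assumes "finite A" "\<And>a. a \<in> A \<Longrightarrow> unif_Ck S k (f a)" "\<And>i. open (S i)"
  shows "unif_Ck S k (\<lambda>i x. \<Sum>a\<in>A. f a i x)"
  using assms(1,2)
proof (induction A)
  case empty
  show ?case using unif_Ck_const[of S "\<lambda>_. 0" 0] by simp
next
  case (insert a A)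
  then show ?case
    using unif_Ck_add[of S k "f a" "\<lambda>i x. \<Sum>a\<in>A. f a i x"] assms(3) by simp
qed

text \<open>The index set of the sum depends on \<open>i\<close>, so the terms form one family over
  pairs, and a pair with \<open>j \<notin> J i\<close> gets the empty set. The sum is controlled
  through the number \<open>N\<close> of terms, which is what the bounded overlap of a partition of
  unity supplies.\<close>

lemma unif_Ck_sum_bounded_card:
  fixes f :: "'i \<Rightarrow> 'j \<Rightarrow> 'a::real_normed_vector \<Rightarrow> 'b::real_normed_vector"
  assumes "unif_Ck (\<lambda>(i, j). if j \<in> J i then S i else {}) k (\<lambda>(i, j). f i j)"
    "\<And>i. finite (J i)" "\<And>i. card (J i) \<le> N" "\<And>i. open (S i)"
  shows "unif_Ck S k (\<lambda>i x. \<Sum>j\<in>J i. f i j x)"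
  using assms(1)
proof (induction k arbitrary: f)
  case 0
  obtain C where C: "0 < C" "\<And>i j x. j \<in> J i \<Longrightarrow> x \<in> S i \<Longrightarrow> norm (f i j x) \<le> C"
    using unif_Ck_bound[OF 0] by fastforce
  have "norm (\<Sum>j\<in>J i. f i j x) \<le> real N * C" if "x \<in> S i" for i x
  proof -
    have "norm (\<Sum>j\<in>J i. f i j x) \<le> real (card (J i)) * C"
      using sum_norm_bound[of "J i" "\<lambda>j. f i j x" C] C that by simp
    also have "\<dots> \<le> real N * C"
      using assms(3)[of i] C(1) by simp
    finally show ?thesis .
  qed
  then show ?case by auto
next
  case (Suc k)
  have d: "f i j differentiable (at x)" if "x \<in> S i" "j \<in> J i" for i j x
    using Suc.prems that unfolding unif_Ck_Suc by fastforce
  have "unif_Ck S k (\<lambda>i. dir_deriv u (\<lambda>x. \<Sum>j\<in>J i. f i j x))" for u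
  proof (rule Ck_bdd_cong[OF Suc.IH assms(4)])
    show "unif_Ck (\<lambda>(i, j). if j \<in> J i then S i else {}) k (\<lambda>(i, j). dir_deriv u (f i j))"
      using Suc.prems by (auto simp: unif_Ck_Suc case_prod_unfold)
    show "(\<Sum>j\<in>J i. dir_deriv u (f i j) x) = dir_deriv u (\<lambda>x. \<Sum>j\<in>J i. f i j x) x"
      if "x \<in> S i" for i x
      by (rule dir_derivI[symmetric])
        (use d[OF that] in \<open>auto intro!: has_derivative_sum has_derivative_dir_deriv\<close>)
  qed
  moreover have "Ck_bdd (\<lambda>_. 1) S 0 0 (\<lambda>i x. \<Sum>j\<in>J i. f i j x)"
    using Suc.IH Suc.prems Ck_bdd_SucD Ck_bdd_0 by blast
  ultimately show ?case
    using d assms(2) by (auto simp: unif_Ck_Suc)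
qed

text \<open>By the quotient rule the derivative is again a quotient, with denominator
  \<open>h * h\<close>. A lower bound of exactly 1 survives the squaring, so the induction
  hypothesis applies unchanged.\<close>

lemma unif_Ck_divide:
  fixes f h :: "'i \<Rightarrow> 'a::real_normed_vector \<Rightarrow> 'b::real_normed_field"
  assumes "unif_Ck S k f" "unif_Ck S k h" "\<And>i. open (S i)" "\<And>i x. x \<in> S i \<Longrightarrow> 1 \<le> norm (h i x)"
  shows "unif_Ck S k (\<lambda>i x. f i x / h i x)"
  using assms(1,2,4)
proof (induction k arbitrary: f h)
  case 0
  obtain C where C: "0 < C" "\<And>i x. x \<in> S i \<Longrightarrow> norm (f i x) \<le> C"
    using unif_CkE[OF 0(1)] by blast
  have "norm (f i x / h i x) \<le> C" if "x \<in> S i" for i x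
  proof -
    have "norm (f i x) / norm (h i x) \<le> C / 1"
      by (intro frac_le C) (use that 0 C in auto)
    then show ?thesis by (simp add: norm_divide)
  qed
  then show ?case by auto
next
  case (Suc k)
  have d: "f i differentiable (at x)" "h i differentiable (at x)" "h i x \<noteq> 0"
    if "x \<in> S i" for i x
    using Suc.prems that unfolding unif_Ck_Suc by fastforce+
  have "unif_Ck S k (\<lambda>i. dir_deriv u (\<lambda>x. f i x / h i x))" for u
  proof (rule Ck_bdd_cong[OF Suc.IH assms(3)])
    have "unif_Ck S k (\<lambda>i. dir_deriv u (f i))" "unif_Ck S k (\<lambda>i. dir_deriv u (h i))"
      using Suc.prems by (auto simp: unif_Ck_Suc)
    then have "unif_Ck S k (\<lambda>i x. dir_deriv u (f i) x * h i x)"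
      "unif_Ck S k (\<lambda>i x. (-1) *\<^sub>R (f i x * dir_deriv u (h i) x))"
      by (intro unif_Ck_mult unif_Ck_scaleR[where C=1] Ck_bdd_SucD[OF Suc.prems(1)]
          Ck_bdd_SucD[OF Suc.prems(2)] assms(3); simp)+
    from unif_Ck_add[OF this assms(3)]
    show "unif_Ck S k (\<lambda>i x. dir_deriv u (f i) x * h i x - f i x * dir_deriv u (h i) x)"
      by simp
    show "unif_Ck S k (\<lambda>i x. h i x * h i x)"
      by (intro unif_Ck_mult Ck_bdd_SucD[OF Suc.prems(2)] assms(3))
    show "1 \<le> norm (h i x * h i x)" if "x \<in> S i" for i x
      using mult_mono[OF Suc.prems(3)[OF that] Suc.prems(3)[OF that]] by (simp add: norm_mult)
    show "(dir_deriv u (f i) x * h i x - f i x * dir_deriv u (h i) x) / (h i x * h i x) =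
        dir_deriv u (\<lambda>x. f i x / h i x) x" if "x \<in> S i" for i x
      by (rule dir_derivI[symmetric])
        (use d[OF that] in \<open>auto intro!: derivative_eq_intros has_derivative_dir_deriv simp: field_simps\<close>)
  qed
  moreover have "Ck_bdd (\<lambda>_. 1) S 0 0 (\<lambda>i x. f i x / h i x)"
    using Suc.IH[OF Ck_bdd_SucD[OF Suc.prems(1)] Ck_bdd_SucD[OF Suc.prems(2)]] Suc.prems(3) Ck_bdd_0 by blast
  ultimately show ?case
    using d by (auto simp: unif_Ck_Suc)
qed

text \<open>Made for changes of charts. Each differentiation produces the coefficients
  \<open>M j u \<bullet> b\<close>, bounded by \<open>C * norm u\<close>; the translation
  \<open>a j\<close> only has to keep the image inside \<open>S (s j)\<close>.\<close>

lemma unif_Ck_affine: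
  fixes f :: "'i \<Rightarrow> 'a::euclidean_space \<Rightarrow> 'b::real_normed_vector"
    and M :: "'j \<Rightarrow> 'c::euclidean_space \<Rightarrow> 'a"
  assumes "unif_Ck S k f" "\<And>i. open (S i)" "\<And>j. open (T j)"
    "\<And>j x. x \<in> T j \<Longrightarrow> a j + M j x \<in> S (s j)"
    "\<And>j. T j \<noteq> {} \<Longrightarrow> linear (M j)" "\<And>j x. T j \<noteq> {} \<Longrightarrow> norm (M j x) \<le> C * norm x"
  shows "unif_Ck T k (\<lambda>j x. f (s j) (a j + M j x))"
  using assms(1)
proof (induction k arbitrary: f)
  case 0
  obtain B where B: "0 < B" "\<And>i x. x \<in> S i \<Longrightarrow> norm (f i x) \<le> B"
    using unif_CkE[OF 0] by blast
  have "norm (f (s j) (a j + M j x)) \<le> B" if "x \<in> T j" for j x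
    by (rule B(2)[OF assms(4)[OF that]])
  then show ?case by auto
next
  case (Suc k)
  have d: "f i differentiable (at x)" if "x \<in> S i" for i x
    using Suc.prems that unfolding unif_Ck_Suc by fastforce
  have D: "((\<lambda>x. f (s j) (a j + M j x)) has_derivative (\<lambda>u. dir_deriv (M j u) (f (s j)) (a j + M j x))) (at x)"
    if "x \<in> T j" for j x
  proof -
    have "bounded_linear (M j)"
      using assms(5)[of j] that linear_conv_bounded_linear by blast
    then have "((\<lambda>x. a j + M j x) has_derivative M j) (at x)"
      by (auto intro!: derivative_eq_intros dest: bounded_linear_imp_has_derivative)
    from diff_chain_at[OF this has_derivative_dir_deriv[OF d[OF assms(4)[OF that]]]]
    show ?thesis by (simp add: o_def)
  qed
  have "unif_Ck T k (\<lambda>j. dir_deriv u (\<lambda>x. f (s j) (a j + M j x)))" for u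
  proof (rule Ck_bdd_cong[OF unif_Ck_sum[OF finite_Basis] assms(3)])
    fix b :: 'a assume b: "b \<in> Basis"
    have "unif_Ck S k (\<lambda>i. dir_deriv b (f i))"
      using Suc.prems by (auto simp: unif_Ck_Suc)
    from Suc.IH[OF this]
    show "unif_Ck T k (\<lambda>j x. (M j u \<bullet> b) *\<^sub>R dir_deriv b (f (s j)) (a j + M j x))"
    proof (rule unif_Ck_scaleR)
      show "\<bar>M j u \<bullet> b\<bar> \<le> C * norm u" if "T j \<noteq> {}" for j
        using Basis_le_norm[OF b, of "M j u"] assms(6)[OF that, of u] by linarith
    qed (rule assms(3))
  next
    fix j x assume x: "x \<in> T j"
    show "(\<Sum>b\<in>Basis. (M j u \<bullet> b) *\<^sub>R dir_deriv b (f (s j)) (a j + M j x)) =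
        dir_deriv u (\<lambda>x. f (s j) (a j + M j x)) x"
      by (simp only: dir_derivI[OF D[OF x]] dir_deriv_basis[OF d[OF assms(4)[OF x]], of "M j u"])
  qed (rule assms(3))
  moreover have "Ck_bdd (\<lambda>_. 1) T 0 0 (\<lambda>j x. f (s j) (a j + M j x))"
    using Suc.IH Suc.prems Ck_bdd_SucD Ck_bdd_0 by blast
  ultimately show ?case
    using D by (auto simp: unif_Ck_Suc differentiable_def)
qed

section \<open>Smooth functions on open sets\<close>

lemma smooth_onD:
  assumes "smooth_on f S"
  shows "continuous_on S f" "\<And>x. x \<in> S \<Longrightarrow> f differentiable (at x)" "smooth_on (dir_deriv u f) S"
proof -
  show "continuous_on S f" using assms unfolding smooth_on_def by (metis C_k_on.simps(1))
  show "f differentiable (at x)" if "x \<in> S" for x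
    using assms that unfolding smooth_on_def by (metis C_k_on.simps(2))
  show "smooth_on (dir_deriv u f) S"
    using assms unfolding smooth_on_def by (metis C_k_on.simps(2))
qed

lemma unif_Ck_compact:
  fixes f :: "'a::real_normed_vector \<Rightarrow> 'b::real_normed_vector"
  assumes "smooth_on f W" "compact K" "K \<subseteq> W" "\<And>i. S i \<subseteq> K"
  shows "unif_Ck S k (\<lambda>i. f)"
  using assms(1)
proof (induction k arbitrary: f)
  case 0
  have "compact (f ` K)"
    using smooth_onD(1)[OF 0] assms by (metis compact_continuous_image continuous_on_subset)
  then obtain C where "\<forall>y\<in>f ` K. norm y \<le> C"
    using compact_imp_bounded bounded_iff by metis
  then have "norm (f x) \<le> C" if "x \<in> S i" for i x
    using that assms by blast
  then show ?case by auto
next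
  case (Suc k)
  have "unif_Ck S 0 (\<lambda>i. f)"
    using Suc Ck_bdd_0 by blast
  then show ?case
    using Suc.IH[OF smooth_onD(3)[OF Suc.prems]] smooth_onD(2)[OF Suc.prems] assms
    by (auto simp: unif_Ck_Suc subset_iff)
qed

text \<open>One order is lost: at order 0, \<open>Ck_bdd\<close> contains a bound and no continuity,
  which comes from differentiability one order higher.\<close>

lemma Ck_bdd_imp_C_k_on: "Ck_bdd \<omega> S (Suc k) m f \<Longrightarrow> C_k_on k (f i) (S i)"
proof (induction k arbitrary: m f)
  case 0
  then show ?case
    by (auto simp: Ck_bdd_Suc intro!: continuous_at_imp_continuous_on differentiable_imp_continuous_within)
next
  case (Suc k)
  have "C_k_on k (dir_deriv u (f i)) (S i)" for u
    using Suc.IH[of "Suc m" "\<lambda>i. dir_deriv u (f i)"] Suc.prems by (simp add: Ck_bdd_Suc)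
  then show ?case
    using Suc.prems by (auto simp: Ck_bdd_Suc)
qed

lemma Ck_bdd_imp_smooth_on: "(\<And>k. Ck_bdd \<omega> S k m f) \<Longrightarrow> smooth_on (f i) (S i)"
  unfolding smooth_on_def by (blast intro: Ck_bdd_imp_C_k_on)

lemma smooth_on_cover:
  assumes "\<And>x. x \<in> S \<Longrightarrow> \<exists>T. open T \<and> x \<in> T \<and> smooth_on f T"
  shows "smooth_on f S"
proof -
  have "C_k_on k f S" if "\<And>x. x \<in> S \<Longrightarrow> \<exists>T. open T \<and> x \<in> T \<and> C_k_on k f T" for k and f :: "'a \<Rightarrow> 'b"
    using that
  proof (induction k arbitrary: f)
    case 0
    then show ?case
      by (metis C_k_on.simps(1) continuous_at_imp_continuous_on continuous_on_eq_continuous_at)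
  next
    case (Suc k)
    have "C_k_on k (dir_deriv u f) S" for u
      by (rule Suc.IH) (use Suc.prems in \<open>metis C_k_on.simps(2)\<close>)
    then show ?case
      using Suc.prems by (metis C_k_on.simps(2))
  qed
  then show ?thesis
    using assms unfolding smooth_on_def by metis
qed

lemma smooth_on_subset: "smooth_on f S \<Longrightarrow> T \<subseteq> S \<Longrightarrow> smooth_on f T"
proof -
  have "C_k_on k f S \<Longrightarrow> T \<subseteq> S \<Longrightarrow> C_k_on k f T" for k and f :: "'a \<Rightarrow> 'b"
    by (induction k arbitrary: f) (auto intro: continuous_on_subset)
  then show "smooth_on f S \<Longrightarrow> T \<subseteq> S \<Longrightarrow> smooth_on f T"
    unfolding smooth_on_def by blast
qed

lemma C_k_on_cong:
  assumes "C_k_on k f S" "open S" "\<And>x. x \<in> S \<Longrightarrow> f x = g x"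
  shows "C_k_on k g S"
  using assms(1,3)
proof (induction k arbitrary: f g)
  case 0
  then show ?case using continuous_on_cong[of S S f g] by simp
next
  case (Suc k)
  have "g differentiable (at x)" if "x \<in> S" for x
    using Suc.prems that differentiable_cong_open[OF assms(2) that, of f g] by auto
  moreover have "C_k_on k (dir_deriv u g) S" for u
  proof (rule Suc.IH)
    show "C_k_on k (dir_deriv u f) S" using Suc.prems by simp
    show "dir_deriv u f x = dir_deriv u g x" if "x \<in> S" for x
      by (rule dir_deriv_cong_open[OF assms(2) that Suc.prems(2)])
  qed
  ultimately show ?case by simp
qed

lemma smooth_on_cong:
  "smooth_on f S \<Longrightarrow> open S \<Longrightarrow> (\<And>x. x \<in> S \<Longrightarrow> f x = g x) \<Longrightarrow> smooth_on g S"
  unfolding smooth_on_def by (blast intro: C_k_on_cong)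

lemma smooth_on_bounded_linear:
  assumes "bounded_linear L" "smooth_on f S" "open S"
  shows "smooth_on (\<lambda>x. L (f x)) S"
proof -
  have "C_k_on k (\<lambda>x. L (f x)) S" if "C_k_on k f S" for k and f :: "'c \<Rightarrow> 'a"
    using that
  proof (induction k arbitrary: f)
    case 0
    then show ?case
      using bounded_linear.continuous_on[OF assms(1)] by simp
  next
    case (Suc k)
    have d: "((\<lambda>x. L (f x)) has_derivative (\<lambda>u. L (dir_deriv u f x))) (at x)" if "x \<in> S" for x
      using bounded_linear.has_derivative[OF assms(1) has_derivative_dir_deriv[of f x]] Suc.prems that
      by simp
    have "C_k_on k (dir_deriv u (\<lambda>x. L (f x))) S" for u
    proof (rule C_k_on_cong[OF Suc.IH assms(3)])
      show "C_k_on k (dir_deriv u f) S" using Suc.prems by simp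
      show "L (dir_deriv u f x) = dir_deriv u (\<lambda>x. L (f x)) x" if "x \<in> S" for x
        using dir_derivI[OF d[OF that]] by metis
    qed
    then show ?case
      using d by (auto simp: differentiable_def)
  qed
  then show ?thesis
    using assms(2) by (simp add: smooth_on_def)
qed

lemma smooth_on_add:
  assumes "smooth_on f S" "smooth_on g S" "open S"
  shows "smooth_on (\<lambda>x. f x + g x) S"
proof -
  have "C_k_on k (\<lambda>x. f x + g x) S" if "C_k_on k f S" "C_k_on k g S" for k and f g :: "'a \<Rightarrow> 'b"
    using that
  proof (induction k arbitrary: f g)
    case 0
    then show ?case by (simp add: continuous_on_add)
  next
    case (Suc k)
    have d: "((\<lambda>x. f x + g x) has_derivative (\<lambda>u. dir_deriv u f x + dir_deriv u g x)) (at x)"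
      if "x \<in> S" for x
      using Suc.prems that by (intro has_derivative_add has_derivative_dir_deriv) auto
    have "C_k_on k (dir_deriv u (\<lambda>x. f x + g x)) S" for u
    proof (rule C_k_on_cong[OF Suc.IH assms(3)])
      show "C_k_on k (dir_deriv u f) S" "C_k_on k (dir_deriv u g) S" using Suc.prems by simp_all
      show "dir_deriv u f x + dir_deriv u g x = dir_deriv u (\<lambda>x. f x + g x) x" if "x \<in> S" for x
        using dir_derivI[OF d[OF that]] by metis
    qed
    then show ?case
      using d by (auto simp: differentiable_def)
  qed
  then show ?thesis
    using assms(1,2) by (simp add: smooth_on_def)
qed

lemma smooth_on_affine:
  fixes M :: "'a::euclidean_space \<Rightarrow> 'b::real_normed_vector"
  assumes "smooth_on f S" "linear M" "open S"
  shows "smooth_on (\<lambda>x. f (a + M x)) {x. a + M x \<in> S}"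
proof -
  have M: "bounded_linear M"
    using assms(2) linear_conv_bounded_linear by blast
  have cont: "continuous_on UNIV (\<lambda>x. a + M x)"
    using linear_continuous_on[OF M] by (intro continuous_intros)
  have op: "open {x. a + M x \<in> S}"
    using open_vimage[OF assms(3) cont] by (simp add: vimage_def)
  have "C_k_on k (\<lambda>x. f (a + M x)) {x. a + M x \<in> S}" if "C_k_on k f S" for k and f :: "'b \<Rightarrow> 'c"
    using that
  proof (induction k arbitrary: f)
    case 0
    then show ?case
      using continuous_on_compose2[of S f "{x. a + M x \<in> S}" "\<lambda>x. a + M x"] continuous_on_subset[OF cont]
      by auto
  next
    case (Suc k)
    have d: "((\<lambda>x. f (a + M x)) has_derivative (\<lambda>u. dir_deriv (M u) f (a + M x))) (at x)"
      if "a + M x \<in> S" for x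
    proof -
      have "((\<lambda>x. a + M x) has_derivative M) (at x)"
        using M by (auto intro!: derivative_eq_intros dest: bounded_linear_imp_has_derivative)
      from diff_chain_at[OF this has_derivative_dir_deriv[of f]]
      show ?thesis using Suc.prems that by (simp add: o_def)
    qed
    have "C_k_on k (dir_deriv u (\<lambda>x. f (a + M x))) {x. a + M x \<in> S}" for u
    proof (rule C_k_on_cong[OF Suc.IH op])
      show "C_k_on k (dir_deriv (M u) f) S" using Suc.prems by simp
      show "dir_deriv (M u) f (a + M x) = dir_deriv u (\<lambda>x. f (a + M x)) x"
        if "x \<in> {x. a + M x \<in> S}" for x
        using dir_derivI[OF d, of x] that by simp
    qed
    then show ?case
      using d by (auto simp: differentiable_def)
  qed
  then show ?thesis
    using assms(1) by (simp add: smooth_on_def)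
qed

section \<open>Symmetry of second derivatives\<close>

text \<open>The mean value theorem is applied twice to the second difference, along \<open>u\<close>
  and then along \<open>v\<close>. The second difference is symmetric in \<open>u\<close> and
  \<open>v\<close>, so exchanging them expresses the same number through the other mixed
  derivative.\<close>

lemma second_difference_mvt:
  fixes f :: "'a::real_normed_vector \<Rightarrow> real"
  assumes "smooth_on f S" "0 < s"
    "\<And>a b. 0 \<le> a \<Longrightarrow> a \<le> s \<Longrightarrow> 0 \<le> b \<Longrightarrow> b \<le> s \<Longrightarrow> x + a *\<^sub>R u + b *\<^sub>R v \<in> S"
  shows "\<exists>a b. 0 < a \<and> a < s \<and> 0 < b \<and> b < s \<and>
    f (x + s *\<^sub>R u + s *\<^sub>R v) - f (x + s *\<^sub>R u) - f (x + s *\<^sub>R v) + f x =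
    s\<^sup>2 * dir_deriv v (dir_deriv u f) (x + a *\<^sub>R u + b *\<^sub>R v)"
proof -
  have d1: "((\<lambda>a. f (x + a *\<^sub>R u + b *\<^sub>R v)) has_real_derivative dir_deriv u f (x + a *\<^sub>R u + b *\<^sub>R v)) (at a)"
    if "0 \<le> a" "a \<le> s" "0 \<le> b" "b \<le> s" for a b
  proof -
    have l: "((\<lambda>a. x + a *\<^sub>R u + b *\<^sub>R v) has_derivative (\<lambda>h. h *\<^sub>R u)) (at a)"
      by (auto intro!: derivative_eq_intros)
    have df: "f differentiable (at (x + a *\<^sub>R u + b *\<^sub>R v))"
      using smooth_onD(2)[OF assms(1) assms(3)] that by blast
    from diff_chain_at[OF l has_derivative_dir_deriv[OF df]]
    have "((\<lambda>a. f (x + a *\<^sub>R u + b *\<^sub>R v)) has_derivative (\<lambda>h. dir_deriv (h *\<^sub>R u) f (x + a *\<^sub>R u + b *\<^sub>R v))) (at a)"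
      by (simp add: o_def)
    then show ?thesis
      using linear_frechet_derivative[OF df]
      by (simp add: has_field_derivative_def linear_scale mult.commute[of _ "dir_deriv u f _"])
  qed
  have d2: "((\<lambda>b. dir_deriv u f (x + a *\<^sub>R u + b *\<^sub>R v)) has_real_derivative
      dir_deriv v (dir_deriv u f) (x + a *\<^sub>R u + b *\<^sub>R v)) (at b)"
    if "0 \<le> a" "a \<le> s" "0 \<le> b" "b \<le> s" for a b
  proof -
    let ?F = "dir_deriv u f"
    have l: "((\<lambda>b. x + a *\<^sub>R u + b *\<^sub>R v) has_derivative (\<lambda>h. h *\<^sub>R v)) (at b)"
      by (auto intro!: derivative_eq_intros)
    have df: "?F differentiable (at (x + a *\<^sub>R u + b *\<^sub>R v))"
      using smooth_onD(2)[OF smooth_onD(3)[OF assms(1)] assms(3)] that by blast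
    from diff_chain_at[OF l has_derivative_dir_deriv[OF df]]
    have "((\<lambda>b. ?F (x + a *\<^sub>R u + b *\<^sub>R v)) has_derivative (\<lambda>h. dir_deriv (h *\<^sub>R v) ?F (x + a *\<^sub>R u + b *\<^sub>R v))) (at b)"
      by (simp add: o_def)
    then show ?thesis
      using linear_frechet_derivative[OF df]
      by (simp add: has_field_derivative_def linear_scale mult.commute[of _ "dir_deriv v ?F _"])
  qed
  have "\<exists>a>0. a < s \<and> (f (x + s *\<^sub>R u + s *\<^sub>R v) - f (x + s *\<^sub>R u + 0 *\<^sub>R v)) -
      (f (x + 0 *\<^sub>R u + s *\<^sub>R v) - f (x + 0 *\<^sub>R u + 0 *\<^sub>R v)) =
      (s - 0) * (dir_deriv u f (x + a *\<^sub>R u + s *\<^sub>R v) - dir_deriv u f (x + a *\<^sub>R u + 0 *\<^sub>R v))"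
    by (rule MVT2[where f = "\<lambda>a. f (x + a *\<^sub>R u + s *\<^sub>R v) - f (x + a *\<^sub>R u + 0 *\<^sub>R v)"])
      (use assms(2) in \<open>auto intro!: DERIV_diff d1[of _ 0, simplified] d1\<close>)
  then obtain a where a: "0 < a" "a < s" and eq1: "f (x + s *\<^sub>R u + s *\<^sub>R v) - f (x + s *\<^sub>R u) - f (x + s *\<^sub>R v) + f x =
      s * (dir_deriv u f (x + a *\<^sub>R u + s *\<^sub>R v) - dir_deriv u f (x + a *\<^sub>R u + 0 *\<^sub>R v))"
    by auto
  have "\<exists>b>0. b < s \<and> dir_deriv u f (x + a *\<^sub>R u + s *\<^sub>R v) - dir_deriv u f (x + a *\<^sub>R u + 0 *\<^sub>R v) =
      (s - 0) * dir_deriv v (dir_deriv u f) (x + a *\<^sub>R u + b *\<^sub>R v)"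
    by (rule MVT2[where f = "\<lambda>b. dir_deriv u f (x + a *\<^sub>R u + b *\<^sub>R v)"])
      (use assms(2) a in \<open>auto intro!: d2\<close>)
  then show ?thesis
    using a eq1 by (auto simp: power2_eq_square)
qed

lemma dir_deriv_commute_real:
  fixes f :: "'a::real_normed_vector \<Rightarrow> real"
  assumes "smooth_on f S" "open S" "x \<in> S"
  shows "dir_deriv u (dir_deriv v f) x = dir_deriv v (dir_deriv u f) x"
proof (rule ccontr)
  let ?F = "dir_deriv u (dir_deriv v f)" and ?G = "dir_deriv v (dir_deriv u f)"
  assume "?F x \<noteq> ?G x"
  \<comment> \<open>Half the gap between the two values, so that no number lies strictly within
    \<open>e\<close> of both.\<close>
  define e where "e = dist (?F x) (?G x) / 2"
  have e: "0 < e" using \<open>?F x \<noteq> ?G x\<close> by (simp add: e_def)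
  have "isCont ?F x" "isCont ?G x"
    using smooth_onD(1)[OF smooth_onD(3)[OF smooth_onD(3)[OF assms(1)]]] assms
    by (auto simp: continuous_on_eq_continuous_at)
  then obtain d1 d2 where d1: "0 < d1" "\<And>y. dist y x < d1 \<Longrightarrow> dist (?F y) (?F x) < e"
    and d2: "0 < d2" "\<And>y. dist y x < d2 \<Longrightarrow> dist (?G y) (?G x) < e"
    using e unfolding continuous_at_eps_delta by metis
  obtain d3 where d3: "0 < d3" "ball x d3 \<subseteq> S"
    using assms openE by blast
  define d where "d = min d1 (min d2 d3)"
  \<comment> \<open>Small enough for the parallelogram spanned by \<open>s *\<^sub>R u\<close> and
    \<open>s *\<^sub>R v\<close> to stay within \<open>d\<close> of \<open>x\<close>; the summand 1
    covers \<open>u = v = 0\<close>.\<close>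
  define s where "s = d / (2 * (norm u + norm v + 1))"
  have pos: "0 < norm u + norm v + 1"
    by (smt (verit) norm_ge_zero)
  have "0 < d"
    using d1 d2 d3 by (simp add: d_def)
  then have s: "0 < s"
    using pos by (simp add: s_def)
  have near: "dist (x + (a *\<^sub>R u' + b *\<^sub>R v')) x < d"
    if "0 \<le> a" "a \<le> s" "0 \<le> b" "b \<le> s" "(u', v') = (u, v) \<or> (u', v') = (v, u)" for a b u' v'
  proof -
    have "norm (a *\<^sub>R u' + b *\<^sub>R v') \<le> a * norm u' + b * norm v'"
      using norm_triangle_ineq[of "a *\<^sub>R u'" "b *\<^sub>R v'"] that by simp
    also have "\<dots> \<le> s * norm u' + s * norm v'"
      using that by (intro add_mono mult_right_mono) auto
    also have "\<dots> = s * (norm u + norm v)"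
      using that(5) by (auto simp: algebra_simps)
    also have "\<dots> < s * (2 * (norm u + norm v + 1))"
      using s by (simp add: add_nonneg_pos)
    also have "\<dots> = d"
      using pos by (simp add: s_def)
    finally show ?thesis by (simp add: dist_norm)
  qed
  have "x + a *\<^sub>R u + b *\<^sub>R v \<in> S" "x + a *\<^sub>R v + b *\<^sub>R u \<in> S"
    if "0 \<le> a" "a \<le> s" "0 \<le> b" "b \<le> s" for a b
    using near[OF that, of u v] near[OF that, of v u] d3(2)
    by (auto simp: d_def dist_commute add.assoc subset_iff)
  from second_difference_mvt[OF assms(1) s this(1)] second_difference_mvt[OF assms(1) s this(2)]
  obtain a b a' b' where ab: "0 < a" "a < s" "0 < b" "b < s" "0 < a'" "a' < s" "0 < b'" "b' < s"
    and "s\<^sup>2 * ?G (x + a *\<^sub>R u + b *\<^sub>R v) = s\<^sup>2 * ?F (x + a' *\<^sub>R v + b' *\<^sub>R u)"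
    by (auto simp: algebra_simps)
  then have eq: "?G (x + (a *\<^sub>R u + b *\<^sub>R v)) = ?F (x + (a' *\<^sub>R v + b' *\<^sub>R u))"
    using s by (simp add: add.assoc)
  have "dist (?G (x + (a *\<^sub>R u + b *\<^sub>R v))) (?G x) < e"
    by (rule d2(2)) (use near[of a b u v] ab in \<open>simp add: d_def\<close>)
  moreover have "dist (?F (x + (a' *\<^sub>R v + b' *\<^sub>R u))) (?F x) < e"
    by (rule d1(2)) (use near[of a' b' v u] ab in \<open>simp add: d_def\<close>)
  ultimately show False
    using dist_triangle3[of "?F x" "?G x" "?F (x + (a' *\<^sub>R v + b' *\<^sub>R u))"]
    unfolding eq e_def by linarith
qed

lemma dir_deriv_bounded_linear:
  assumes "bounded_linear L" "f differentiable (at x)"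
  shows "dir_deriv u (\<lambda>x. L (f x)) x = L (dir_deriv u f x)"
  by (rule dir_derivI) (rule bounded_linear.has_derivative[OF assms(1) has_derivative_dir_deriv[OF assms(2)]])

text \<open>Reduced to the real case through real and imaginary part, since the mean value theorem
  fails for complex values.\<close>

lemma dir_deriv_commute:
  fixes f :: "'a::real_normed_vector \<Rightarrow> complex"
  assumes "smooth_on f S" "open S" "x \<in> S"
  shows "dir_deriv u (dir_deriv v f) x = dir_deriv v (dir_deriv u f) x"
proof -
  have "L (dir_deriv u (dir_deriv v f) x) = L (dir_deriv v (dir_deriv u f) x)"
    if L: "bounded_linear L" for L :: "complex \<Rightarrow> real"
  proof -
    have *: "dir_deriv a (dir_deriv b (\<lambda>x. L (f x))) x = L (dir_deriv a (dir_deriv b f) x)" for a b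
    proof -
      have "dir_deriv a (dir_deriv b (\<lambda>x. L (f x))) x = dir_deriv a (\<lambda>x. L (dir_deriv b f x)) x"
        by (rule dir_deriv_cong_open[OF assms(2,3)])
          (rule dir_deriv_bounded_linear[OF L smooth_onD(2)[OF assms(1)]])
      also have "\<dots> = L (dir_deriv a (dir_deriv b f) x)"
        by (rule dir_deriv_bounded_linear[OF L smooth_onD(2)[OF smooth_onD(3)[OF assms(1)] assms(3)]])
      finally show ?thesis .
    qed
    show ?thesis
      using dir_deriv_commute_real[OF smooth_on_bounded_linear[OF L assms(1,2)] assms(2,3), of u v]
      by (simp only: *)
  qed
  from this[OF bounded_linear_Re] this[OF bounded_linear_Im] show ?thesis
    by (simp add: complex_eq_iff)
qed

section \<open>A smooth cutoff function\<close>

text \<open>The powers of \<open>t\<close> in the denominator close the family under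
  differentiation: the derivative of member \<open>n\<close> combines members \<open>n + 1\<close>
  and \<open>n + 2\<close>. Member 0 is the classical flat function.\<close>

definition flat_exp :: "nat \<Rightarrow> real \<Rightarrow> real" where
  "flat_exp n t = (if t \<le> 0 then 0 else exp (- (1 / t)) / t ^ n)"

lemma exp_ge_power_div_fact: "0 \<le> (x::real) \<Longrightarrow> x ^ n / fact n \<le> exp x"
proof -
  assume x: "0 \<le> x"
  have s: "(\<lambda>n. x ^ n / fact n) sums exp x"
    using exp_converges[of x] by (simp add: scaleR_conv_of_real divide_inverse mult.commute)
  have "(\<Sum>i\<in>{n}. x ^ i / fact i) \<le> (\<Sum>n. x ^ n / fact n)"
    by (rule sum_le_suminf) (use s x in \<open>auto simp: sums_iff\<close>)
  then show ?thesis using s by (simp add: sums_iff)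
qed

text \<open>One term of the series of \<open>exp (1 / t)\<close>, that of degree
  \<open>n + 2\<close>, beats the pole. A bound quadratic in \<open>t\<close> is what makes the
  difference quotient at 0 tend to 0.\<close>

lemma flat_exp_bound: "\<bar>flat_exp n t\<bar> \<le> fact (n + 2) * t\<^sup>2"
proof (cases "t \<le> 0")
  case False
  then have t: "0 < t" by simp
  define F :: real where "F = fact (n + 2)"
  have F: "0 < F" by (simp add: F_def)
  have "(1 / t) ^ (n + 2) / F \<le> exp (1 / t)"
    unfolding F_def by (rule exp_ge_power_div_fact) (use t in simp)
  then have "1 \<le> exp (1 / t) * (F * t ^ (n + 2))"
    using t F by (simp add: field_simps power_one_over del: power_add power_add_numeral power_add_numeral2)
  then have "exp (- (1 / t)) \<le> F * t ^ (n + 2)"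
    by (simp add: exp_minus field_simps)
  then have "exp (- (1 / t)) / t ^ n \<le> F * t\<^sup>2"
    using t by (simp add: pos_divide_le_eq power_add power2_eq_square mult_ac)
  then show ?thesis
    using t by (simp add: flat_exp_def F_def)
qed (simp add: flat_exp_def)

lemma flat_exp_deriv:
  "(flat_exp n has_real_derivative - real n * flat_exp (n + 1) t + flat_exp (n + 2) t) (at t)"
proof (cases t "0::real" rule: linorder_cases)
  case less
  have "((\<lambda>_. 0) has_real_derivative 0) (at t)" by simp
  then have "(flat_exp n has_real_derivative 0) (at t)"
    by (rule has_field_derivative_transform_within_open[where S = "{..<0}"])
      (use less in \<open>auto simp: flat_exp_def\<close>)
  then show ?thesis using less by (simp add: flat_exp_def)
next
  case greater
  have "((\<lambda>t. exp (- (1 / t)) / t ^ n) has_real_derivative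
      (exp (- (1 / t)) * (1 / t\<^sup>2) * t ^ n - exp (- (1 / t)) * (real n * t ^ (n - 1))) / (t ^ n * t ^ n)) (at t)"
    using greater by (auto intro!: derivative_eq_intros simp: power2_eq_square)
  also have "(exp (- (1 / t)) * (1 / t\<^sup>2) * t ^ n - exp (- (1 / t)) * (real n * t ^ (n - 1))) / (t ^ n * t ^ n) =
      - real n * flat_exp (n + 1) t + flat_exp (n + 2) t"
    using greater by (cases n) (simp_all add: flat_exp_def field_simps power2_eq_square)
  finally show ?thesis
    by (rule has_field_derivative_transform_within_open[where S = "{0<..}"])
      (use greater in \<open>auto simp: flat_exp_def\<close>)
next
  case equal
  have "((\<lambda>h. (flat_exp n (0 + h) - flat_exp n 0) / h) \<longlongrightarrow> 0) (at 0)"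
  proof (rule tendsto_0_le[where K = "fact (n + 2)"])
    show "((\<lambda>h::real. h) \<longlongrightarrow> 0) (at 0)" by (rule tendsto_ident_at)
    have "norm ((flat_exp n (0 + h) - flat_exp n 0) / h) \<le> norm h * fact (n + 2)" if "h \<noteq> 0" for h
    proof -
      define F :: real where "F = fact (n + 2)"
      have "\<bar>flat_exp n h\<bar> \<le> (\<bar>h\<bar> * F) * \<bar>h\<bar>"
        using flat_exp_bound[of n h, folded F_def] by (simp add: power2_eq_square mult_ac flip: abs_mult)
      then have "\<bar>flat_exp n h\<bar> / \<bar>h\<bar> \<le> \<bar>h\<bar> * F"
        using that by (simp add: pos_divide_le_eq)
      then show ?thesis
        by (simp add: flat_exp_def[of n 0] F_def del: fact_Suc)
    qed
    then show "\<forall>\<^sub>F h in at 0. norm ((flat_exp n (0 + h) - flat_exp n 0) / h) \<le> norm h * fact (n + 2)"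
      by (auto simp: eventually_at_filter)
  qed
  then show ?thesis
    using equal by (simp add: DERIV_def flat_exp_def)
qed

lemma unif_Ck_bounded_linear:
  fixes L :: "'a::real_normed_vector \<Rightarrow> 'b::real_normed_vector"
  assumes "bounded_linear L" "\<And>i. S i \<subseteq> ball 0 B"
  shows "unif_Ck S k (\<lambda>i. L)"
proof -
  obtain C where C: "0 \<le> C" "\<And>x. norm (L x) \<le> norm x * C"
    using bounded_linear.nonneg_bounded[OF assms(1)] by blast
  have "norm (L x) \<le> B * C" if "x \<in> S i" for i x
  proof -
    have "norm x * C \<le> B * C"
      by (rule mult_right_mono[OF _ C(1)]) (use assms(2)[of i] that in \<open>auto simp: subset_iff dist_norm less_imp_le\<close>)
    then show ?thesis using C(2)[of x] by linarith
  qed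
  moreover have "dir_deriv u L = (\<lambda>x. L u)" for u
    using bounded_linear_imp_has_derivative[OF assms(1)] dir_derivI by blast
  ultimately show ?thesis
    using bounded_linear_imp_differentiable[OF assms(1)]
    by (cases k) (auto simp: unif_Ck_Suc intro!: unif_Ck_const)
qed

text \<open>Composing with the squared norm, a polynomial, avoids the singularity of
  \<open>norm\<close> at the origin. The induction runs over all \<open>n\<close> together, because
  the chain rule yields higher members of the family times a linear function of \<open>x\<close>;
  the latter is bounded on balls only, hence the covering by balls.\<close>

lemma smooth_flat_exp_quadratic:
  "smooth_on (\<lambda>x::'a::euclidean_space. flat_exp n (c - x \<bullet> x)) UNIV"
proof (rule smooth_on_cover)
  fix x :: 'a
  define S where "S = (\<lambda>_::unit. ball 0 (norm x + 1) :: 'a set)"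
  have contf: "continuous_on UNIV (flat_exp n)" for n
    using flat_exp_deriv by (meson DERIV_isCont continuous_at_imp_continuous_on)
  have d: "((\<lambda>x. flat_exp n (c - x \<bullet> x)) has_derivative
      (\<lambda>u. (- real n * flat_exp (n + 1) (c - x \<bullet> x) + flat_exp (n + 2) (c - x \<bullet> x)) * (-2 * (x \<bullet> u)))) (at x)"
    for n and x :: 'a
  proof -
    have "((\<lambda>x. c - x \<bullet> x) has_derivative (\<lambda>u. -2 * (x \<bullet> u))) (at x)"
      by (auto intro!: derivative_eq_intros simp: inner_commute)
    from has_derivative_compose[OF this flat_exp_deriv[of n "c - x \<bullet> x", unfolded has_field_derivative_def]]
    show ?thesis by (simp add: o_def)
  qed
  have S: "open (S i)" for i by (simp add: S_def)
  have "unif_Ck S k (\<lambda>_ x. flat_exp n (c - x \<bullet> x))" for k n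
  proof (induction k arbitrary: n)
    case 0
    have "compact ((\<lambda>x::'a. flat_exp n (c - x \<bullet> x)) ` cball 0 (norm x + 1))"
      by (intro compact_continuous_image continuous_on_compose2[OF contf] continuous_intros) auto
    then obtain C where "\<forall>y\<in>(\<lambda>x::'a. flat_exp n (c - x \<bullet> x)) ` cball 0 (norm x + 1). norm y \<le> C"
      using compact_imp_bounded bounded_iff by metis
    then show ?case by (simp add: S_def) (meson ball_subset_cball subsetD)
  next
    case (Suc k)
    have "unif_Ck S k (\<lambda>i. dir_deriv u (\<lambda>x. flat_exp n (c - x \<bullet> x)))" for u
    proof (rule Ck_bdd_cong[OF unif_Ck_mult S])
      show "unif_Ck S k (\<lambda>i x. - real n *\<^sub>R flat_exp (n + 1) (c - x \<bullet> x) + flat_exp (n + 2) (c - x \<bullet> x))"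
        by (intro unif_Ck_add unif_Ck_scaleR[where C = "real n"] Suc.IH S) simp
      show "unif_Ck S k (\<lambda>i x. -2 * (x \<bullet> u))"
        by (rule unif_Ck_bounded_linear[of _ _ "norm x + 1",
              OF bounded_linear_compose[OF bounded_linear_mult_right bounded_linear_inner_left]])
          (simp add: S_def)
      show "(- real n *\<^sub>R flat_exp (n + 1) (c - x \<bullet> x) + flat_exp (n + 2) (c - x \<bullet> x)) * (-2 * (x \<bullet> u)) =
          dir_deriv u (\<lambda>x. flat_exp n (c - x \<bullet> x)) x" if "x \<in> S i" for i x
        using dir_derivI[OF d[of n x], of u] by simp
    qed (rule S)
    then show ?case
      using Suc.IH[of n, THEN Ck_bdd_0] d by (auto simp: unif_Ck_Suc differentiable_def)
  qed
  then have "smooth_on (\<lambda>x::'a. flat_exp n (c - x \<bullet> x)) (S ())"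
    using Ck_bdd_imp_smooth_on[where f = "\<lambda>_ x. flat_exp n (c - x \<bullet> x)" and S = S] by blast
  then show "\<exists>T. open T \<and> x \<in> T \<and> smooth_on (\<lambda>x. flat_exp n (c - x \<bullet> x)) T"
    by (intro exI[of _ "S ()"]) (auto simp: S_def)
qed

text \<open>Normalised by the value on the sphere of radius \<open>r\<close>. Inside,
  \<open>1 \<le> \<phi> x\<close> is enough, because the weights built from \<open>\<phi>\<close>
  are later divided by their sum.\<close>

lemma smooth_cutoff_exists:
  assumes "0 \<le> r" "r < R"
  obtains \<phi> :: "'a::euclidean_space \<Rightarrow> real" where "smooth_on \<phi> UNIV" "\<And>x. 0 \<le> \<phi> x"
    "\<And>x. R \<le> norm x \<Longrightarrow> \<phi> x = 0" "\<And>x. norm x \<le> r \<Longrightarrow> 1 \<le> \<phi> x"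
proof
  define M where "M = flat_exp 0 (R\<^sup>2 - r\<^sup>2)"
  define \<phi> where "\<phi> = (\<lambda>x::'a. inverse M * flat_exp 0 (R\<^sup>2 - x \<bullet> x))"
  have "0 < R\<^sup>2 - r\<^sup>2"
    using assms by (simp add: power2_strict_mono)
  then have M: "0 < M" by (simp add: M_def flat_exp_def)
  show "smooth_on \<phi> UNIV"
    unfolding \<phi>_def by (rule smooth_on_bounded_linear[OF bounded_linear_mult_right smooth_flat_exp_quadratic]) simp
  show "0 \<le> \<phi> x" for x using M by (simp add: \<phi>_def flat_exp_def)
  show "\<phi> x = 0" if "R \<le> norm x" for x
    using power_mono[OF that, of 2] assms by (simp add: \<phi>_def flat_exp_def power2_norm_eq_inner)
  show "1 \<le> \<phi> x" if "norm x \<le> r" for x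
  proof -
    have x: "x \<bullet> x \<le> r\<^sup>2"
      using power_mono[OF that, of 2] by (simp add: power2_norm_eq_inner)
    then have "M \<le> flat_exp 0 (R\<^sup>2 - x \<bullet> x)"
      using \<open>0 < R\<^sup>2 - r\<^sup>2\<close> by (auto simp: M_def flat_exp_def intro!: frac_le)
    then show ?thesis using M by (simp add: \<phi>_def field_simps)
  qed
qed

section \<open>Wirtinger derivatives\<close>

text \<open>The parameter \<open>c\<close> is \<open>- \<i>\<close> for the holomorphic derivative
  and \<open>\<i>\<close> for the conjugate one, so that both kinds are treated at once.\<close>

definition wirt :: "complex \<Rightarrow> 2 \<Rightarrow> (complex^2 \<Rightarrow> complex) \<Rightarrow> complex^2 \<Rightarrow> complex" where
  "wirt c j F w = (dir_deriv (axis j 1) F w + c * dir_deriv (axis j \<i>) F w) / 2"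

lemma wirtinger_eq_wirt: "wirtinger j = wirt (- \<i>) j" "wirtinger_bar j = wirt \<i> j"
  by (simp_all add: fun_eq_iff wirtinger_def wirtinger_bar_def wirt_def)

lemma wirt_cong_open:
  assumes "open S" "x \<in> S" "\<And>y. y \<in> S \<Longrightarrow> F y = G y"
  shows "wirt c j F x = wirt c j G x"
  using dir_deriv_cong_open[OF assms(1,2), of F G] assms(3) by (simp add: wirt_def)

lemma wirt_funpow_cong_open:
  assumes "open S" "x \<in> S" "\<And>y. y \<in> S \<Longrightarrow> F y = G y"
  shows "(wirt c j ^^ n) F x = (wirt c j ^^ n) G x"
  using assms(2)
proof (induction n arbitrary: x)
  case (Suc n)
  then show ?case using wirt_cong_open[OF assms(1) Suc.prems, of "(wirt c j ^^ n) F"] by simp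
qed (use assms(3) in simp)

lemma smooth_on_wirt:
  assumes "smooth_on F S" "open S"
  shows "smooth_on (wirt c j F) S"
proof -
  have "smooth_on (\<lambda>x. (1/2) * (dir_deriv (axis j 1) F x + c * dir_deriv (axis j \<i>) F x)) S"
    by (rule smooth_on_bounded_linear[OF bounded_linear_mult_right smooth_on_add[OF _
          smooth_on_bounded_linear[OF bounded_linear_mult_right]]]; fact assms smooth_onD(3)[OF assms(1)])
  then show ?thesis
    by (rule smooth_on_cong[OF _ assms(2)]) (simp add: wirt_def)
qed

lemma smooth_on_wirt_funpow:
  "smooth_on F S \<Longrightarrow> open S \<Longrightarrow> smooth_on ((wirt c j ^^ n) F) S"
  by (induction n) (auto intro: smooth_on_wirt)

lemma dir_deriv_wirt:
  assumes "smooth_on F S" "open S" "x \<in> S"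
  shows "dir_deriv u (wirt c j F) x =
    (dir_deriv u (dir_deriv (axis j 1) F) x + c * dir_deriv u (dir_deriv (axis j \<i>) F) x) / 2"
proof (rule dir_derivI)
  have "dir_deriv a F differentiable (at x)" for a
    by (rule smooth_onD(2)[OF smooth_onD(3)[OF assms(1)] assms(3)])
  note [derivative_intros] = has_derivative_dir_deriv[OF this]
  show "(wirt c j F has_derivative (\<lambda>u. (dir_deriv u (dir_deriv (axis j 1) F) x +
      c * dir_deriv u (dir_deriv (axis j \<i>) F) x) / 2)) (at x)"
    unfolding wirt_def[abs_def] by (auto intro!: derivative_eq_intros)
qed

lemma wirt_commute:
  assumes "smooth_on F S" "open S" "x \<in> S"
  shows "wirt c j (wirt d l F) x = wirt d l (wirt c j F) x"
  using dir_deriv_commute[OF assms, of "axis j _"]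
  by (simp add: wirt_def[of _ _ "wirt _ _ _"] dir_deriv_wirt[OF assms] algebra_simps add_divide_distrib)

lemma wirt_funpow_commute:
  assumes "smooth_on F S" "open S" "x \<in> S"
  shows "wirt c j ((wirt d l ^^ n) F) x = (wirt d l ^^ n) (wirt c j F) x"
  using assms(3)
proof (induction n arbitrary: x)
  case (Suc n)
  have "wirt c j ((wirt d l ^^ Suc n) F) x = wirt d l (wirt c j ((wirt d l ^^ n) F)) x"
    using wirt_commute[OF smooth_on_wirt_funpow[OF assms(1,2)] assms(2) Suc.prems] by simp
  also have "\<dots> = wirt d l ((wirt d l ^^ n) (wirt c j F)) x"
    by (rule wirt_cong_open[OF assms(2) Suc.prems Suc.IH])
  finally show ?case by simp
qed simp

definition wirt_multi :: "nat \<Rightarrow> nat \<Rightarrow> nat \<Rightarrow> nat \<Rightarrow> (complex^2 \<Rightarrow> complex) \<Rightarrow> complex^2 \<Rightarrow> complex" where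
  "wirt_multi a b a' b' F =
    (wirt (- \<i>) 1 ^^ a) ((wirt (- \<i>) 2 ^^ b) ((wirt \<i> 1 ^^ a') ((wirt \<i> 2 ^^ b') F)))"

lemma koranyi_deriv_eq_wirt_multi:
  "koranyi_deriv \<eta> v a b a' b' h z w = wirt_multi a b a' b' (\<lambda>x. h (koranyi_point \<eta> v z x)) w"
  by (simp add: koranyi_deriv_def wirt_multi_def wirtinger_eq_wirt)

lemma smooth_on_wirt_multi:
  "smooth_on F S \<Longrightarrow> open S \<Longrightarrow> smooth_on (wirt_multi a b a' b' F) S"
  by (simp add: wirt_multi_def smooth_on_wirt_funpow)

text \<open>A further Wirtinger derivative acts from outside and is moved into its own block by the
  symmetry of second derivatives. So the family \<open>wirt_multi\<close>, which differentiates in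
  the order used by hypothesis (b), is closed under differentiation.\<close>

lemma wirt_wirt_multi:
  assumes F: "smooth_on F S" and S: "open S" and x: "x \<in> S"
  shows "wirt (- \<i>) 1 (wirt_multi a b a' b' F) x = wirt_multi (Suc a) b a' b' F x"
    "wirt (- \<i>) 2 (wirt_multi a b a' b' F) x = wirt_multi a (Suc b) a' b' F x"
    "wirt \<i> 1 (wirt_multi a b a' b' F) x = wirt_multi a b (Suc a') b' F x"
    "wirt \<i> 2 (wirt_multi a b a' b' F) x = wirt_multi a b a' (Suc b') F x"
proof -
  let ?b' = "(wirt \<i> 2 ^^ b') F"
  let ?a' = "(wirt \<i> 1 ^^ a') ?b'"
  let ?b = "(wirt (- \<i>) 2 ^^ b) ?a'"
  note sm = smooth_on_wirt_funpow[OF _ S]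
  have sb': "smooth_on ?b' S" and sa': "smooth_on ?a' S" and sb: "smooth_on ?b S"
    by (intro sm F)+
  note C = wirt_funpow_commute[OF _ S] and cong = wirt_funpow_cong_open[OF S]
  show "wirt (- \<i>) 1 (wirt_multi a b a' b' F) x = wirt_multi (Suc a) b a' b' F x"
    by (simp add: wirt_multi_def)
  show "wirt (- \<i>) 2 (wirt_multi a b a' b' F) x = wirt_multi a (Suc b) a' b' F x"
    by (simp add: wirt_multi_def C[OF sb x])
  show "wirt \<i> 1 (wirt_multi a b a' b' F) x = wirt_multi a b (Suc a') b' F x"
  proof -
    have "wirt \<i> 1 ?b y = (wirt (- \<i>) 2 ^^ b) (wirt \<i> 1 ?a') y" if "y \<in> S" for y
      by (rule C[OF sa' that])
    from cong[OF x this] show ?thesis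
      by (simp add: wirt_multi_def C[OF sb x])
  qed
  show "wirt \<i> 2 (wirt_multi a b a' b' F) x = wirt_multi a b a' (Suc b') F x"
  proof -
    have "wirt \<i> 2 ?a' y = (wirt \<i> 1 ^^ a') (wirt \<i> 2 ?b') y" if "y \<in> S" for y
      by (rule C[OF sb' that])
    from cong[OF _ this]
    have "wirt \<i> 2 ?b y = (wirt (- \<i>) 2 ^^ b) ((wirt \<i> 1 ^^ a') (wirt \<i> 2 ?b')) y" if "y \<in> S" for y
      using C[OF sa' that] that by simp
    from cong[OF x this] show ?thesis
      by (simp add: wirt_multi_def C[OF sb x])
  qed
qed

text \<open>The differential splits into a complex-linear and a conjugate-linear part, so four
  Wirtinger derivatives control every directional derivative.\<close>

lemma dir_deriv_eq_wirt:
  assumes "F differentiable (at x)"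
  shows "dir_deriv u F x = u $ 1 * wirt (- \<i>) 1 F x + cnj (u $ 1) * wirt \<i> 1 F x +
    u $ 2 * wirt (- \<i>) 2 F x + cnj (u $ 2) * wirt \<i> 2 F x"
proof -
  have l: "linear (frechet_derivative F (at x))"
    using assms by (rule linear_frechet_derivative)
  have u: "u = Re (u $ 1) *\<^sub>R axis 1 1 + Im (u $ 1) *\<^sub>R axis 1 \<i> + Re (u $ 2) *\<^sub>R axis 2 1 + Im (u $ 2) *\<^sub>R axis 2 \<i>"
    by (simp add: vec_eq_iff axis_def forall_2 complex_eq_iff)
  have "frechet_derivative F (at x) u = Re (u $ 1) *\<^sub>R dir_deriv (axis 1 1) F x + Im (u $ 1) *\<^sub>R dir_deriv (axis 1 \<i>) F x +
      Re (u $ 2) *\<^sub>R dir_deriv (axis 2 1) F x + Im (u $ 2) *\<^sub>R dir_deriv (axis 2 \<i>) F x"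
    by (subst u) (simp only: linear_add[OF l] linear_scale[OF l])
  then show ?thesis
    by (simp add: wirt_def complex_eq_iff algebra_simps add_divide_distrib diff_divide_distrib)
qed

lemma unif_Ck_cmult:
  fixes f :: "'i \<Rightarrow> 'a::real_normed_vector \<Rightarrow> complex"
  assumes "unif_Ck S k f" "\<And>i. open (S i)"
  shows "unif_Ck S k (\<lambda>i x. c * f i x)"
  by (rule unif_Ck_mult[OF unif_Ck_const[of S "\<lambda>_. c" "norm c"] assms]) simp

lemma unif_Ck_wirt:
  assumes "unif_Ck S (Suc k) F" "\<And>i. open (S i)"
  shows "unif_Ck S k (\<lambda>i. wirt c j (F i))"
proof -
  have "unif_Ck S k (\<lambda>i x. (1/2) * (dir_deriv (axis j 1) (F i) x + c * dir_deriv (axis j \<i>) (F i) x))"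
    by (intro unif_Ck_cmult unif_Ck_add assms(2)) (use assms(1) in \<open>auto simp: unif_Ck_Suc\<close>)
  then show ?thesis by (simp add: wirt_def[abs_def])
qed

lemma unif_Ck_wirt_funpow:
  assumes "\<And>k. unif_Ck S k F" "\<And>i. open (S i)"
  shows "unif_Ck S k (\<lambda>i. (wirt c j ^^ n) (F i))"
proof (induction n arbitrary: k)
  case (Suc n)
  then show ?case using unif_Ck_wirt[OF Suc assms(2)] by simp
qed (use assms(1) in simp)

lemma unif_Ck_wirt_multi:
  assumes "\<And>k. unif_Ck S k F" "\<And>i. open (S i)"
  shows "unif_Ck S k (\<lambda>i. wirt_multi a b a' b' (F i))"
  unfolding wirt_multi_def by (intro unif_Ck_wirt_funpow assms)

text \<open>The induction treats all exponents at once: a directional derivative of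
  \<open>wirt_multi\<close> is a combination of four others with one exponent raised.
  \<open>F\<close> itself is the case of exponents 0.\<close>

lemma unif_Ck_from_wirt_multi:
  assumes sm: "\<And>i. smooth_on (F i) (S i)" and op: "\<And>i. open (S i)"
    and bd: "\<And>a b a' b'. \<exists>C. \<forall>i. \<forall>x\<in>S i. norm (wirt_multi a b a' b' (F i) x) \<le> C"
  shows "unif_Ck S k F"
proof -
  have "unif_Ck S k (\<lambda>i. wirt_multi a b a' b' (F i))" for a b a' b'
  proof (induction k arbitrary: a b a' b')
    case 0
    then show ?case using bd by simp
  next
    case (Suc k)
    have d: "wirt_multi a b a' b' (F i) differentiable (at x)" if "x \<in> S i" for i x
      by (rule smooth_onD(2)[OF smooth_on_wirt_multi[OF sm op] that])
    have "unif_Ck S k (\<lambda>i. dir_deriv u (wirt_multi a b a' b' (F i)))" for u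
    proof (rule Ck_bdd_cong[OF _ op])
      show "unif_Ck S k (\<lambda>i x. u $ 1 * wirt_multi (Suc a) b a' b' (F i) x + cnj (u $ 1) * wirt_multi a b (Suc a') b' (F i) x +
          u $ 2 * wirt_multi a (Suc b) a' b' (F i) x + cnj (u $ 2) * wirt_multi a b a' (Suc b') (F i) x)"
        by (intro unif_Ck_add unif_Ck_cmult Suc.IH op)
      show "u $ 1 * wirt_multi (Suc a) b a' b' (F i) x + cnj (u $ 1) * wirt_multi a b (Suc a') b' (F i) x +
          u $ 2 * wirt_multi a (Suc b) a' b' (F i) x + cnj (u $ 2) * wirt_multi a b a' (Suc b') (F i) x =
          dir_deriv u (wirt_multi a b a' b' (F i)) x" if "x \<in> S i" for i x
        by (simp only: dir_deriv_eq_wirt[OF d[OF that]] wirt_wirt_multi[OF sm op that])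
    qed
    then show ?case using bd d by (auto simp: unif_Ck_Suc)
  qed
  from this[of 0 0 0 0] show ?thesis by (simp add: wirt_multi_def)
qed

section \<open>Anisotropic dilations\<close>

definition dilation :: "real \<Rightarrow> real \<Rightarrow> complex^2 \<Rightarrow> complex^2" where
  "dilation s t w = (\<chi> j. (if j = 1 then s else t) *\<^sub>R (w $ j))"

lemma dilation_nth [simp]: "dilation s t w $ 1 = s *\<^sub>R (w $ 1)" "dilation s t w $ 2 = t *\<^sub>R (w $ 2)"
  by (simp_all add: dilation_def)

lemma linear_dilation: "linear (dilation s t)"
  by (rule linearI) (simp_all add: dilation_def vec_eq_iff scaleR_add_right)

lemma dilation_axis: "dilation s t (axis j a) = (if j = 1 then s else t) *\<^sub>R axis j a"
  by (simp add: dilation_def vec_eq_iff axis_def)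

lemma continuous_on_dilation: "continuous_on S (dilation s t)"
  using linear_dilation linear_continuous_on linear_conv_bounded_linear by blast

lemma open_dilation_vimage:
  assumes "open S" shows "open {w. dilation s t w \<in> S}"
  using open_vimage[OF assms continuous_on_dilation] by (simp add: vimage_def)

lemma wirt_dilation:
  assumes "G differentiable (at (dilation s t w))"
  shows "wirt c j (\<lambda>x. k * G (dilation s t x)) w =
    k * (of_real (if j = 1 then s else t) * wirt c j G (dilation s t w))"
proof -
  have "bounded_linear (dilation s t)"
    using linear_dilation linear_conv_bounded_linear by blast
  then have "(dilation s t has_derivative dilation s t) (at w)"
    by (rule bounded_linear_imp_has_derivative)
  from diff_chain_at[OF this has_derivative_dir_deriv[OF assms]]
  have "((\<lambda>x. k * G (dilation s t x)) has_derivative (\<lambda>u. k * dir_deriv (dilation s t u) G (dilation s t w))) (at w)"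
    by (simp add: o_def has_derivative_mult_right)
  from dir_derivI[OF this]
  show ?thesis
    by (simp add: wirt_def dilation_axis linear_scale[OF linear_frechet_derivative[OF assms]])
      (simp add: algebra_simps scaleR_conv_of_real)
qed

text \<open>The constant \<open>k\<close>, and an equation demanded only where the dilated point
  lies in \<open>S\<close>, allow chaining through the four blocks of \<open>wirt_multi\<close>,
  each of which contributes its own factor.\<close>

lemma wirt_funpow_dilation:
  assumes "smooth_on G S" "open S" "dilation s t w \<in> S"
    "\<And>x. dilation s t x \<in> S \<Longrightarrow> H x = k * G (dilation s t x)"
  shows "(wirt c j ^^ n) H w = k * of_real (if j = 1 then s else t) ^ n * (wirt c j ^^ n) G (dilation s t w)"
  using assms(3)
proof (induction n arbitrary: w)
  case (Suc n)
  let ?s = "of_real (if j = 1 then s else t) :: complex"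
  have "(wirt c j ^^ Suc n) H w = wirt c j (\<lambda>x. (k * ?s ^ n) * (wirt c j ^^ n) G (dilation s t x)) w"
    using wirt_cong_open[OF open_dilation_vimage[OF assms(2)], of w s t "(wirt c j ^^ n) H"
      "\<lambda>x. (k * ?s ^ n) * (wirt c j ^^ n) G (dilation s t x)"] Suc by simp
  also have "\<dots> = (k * ?s ^ n) * (?s * wirt c j ((wirt c j ^^ n) G) (dilation s t w))"
    by (rule wirt_dilation[OF smooth_onD(2)[OF smooth_on_wirt_funpow[OF assms(1,2)] Suc.prems]])
  finally show ?case by (simp add: mult_ac)
qed (use assms(4) in simp)

text \<open>With \<open>s = \<bar>\<rho> z\<bar>\<close> and
  \<open>t = sqrt \<bar>\<rho> z\<bar>\<close> the factor becomes the weight of (b) and (iii), in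
  which tangential derivatives count half.\<close>

lemma wirt_multi_dilation:
  assumes F: "smooth_on F S" and S: "open S" and w: "dilation s t w \<in> S"
  shows "wirt_multi a b a' b' (\<lambda>x. F (dilation s t x)) w =
    of_real s ^ (a + a') * of_real t ^ (b + b') * wirt_multi a b a' b' F (dilation s t w)"
proof -
  let ?G1 = "(wirt \<i> 2 ^^ b') F" let ?G2 = "(wirt \<i> 1 ^^ a') ?G1" let ?G3 = "(wirt (- \<i>) 2 ^^ b) ?G2"
  let ?H1 = "(wirt \<i> 2 ^^ b') (\<lambda>x. F (dilation s t x))" let ?H2 = "(wirt \<i> 1 ^^ a') ?H1"
  let ?H3 = "(wirt (- \<i>) 2 ^^ b) ?H2"
  have s1: "smooth_on ?G1 S" and s2: "smooth_on ?G2 S" and s3: "smooth_on ?G3 S"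
    by (intro smooth_on_wirt_funpow F S)+
  have 1: "?H1 x = of_real t ^ b' * ?G1 (dilation s t x)" if "dilation s t x \<in> S" for x
    using wirt_funpow_dilation[OF F S that, of "\<lambda>x. F (dilation s t x)" 1] by simp
  have 2: "?H2 x = of_real t ^ b' * of_real s ^ a' * ?G2 (dilation s t x)" if "dilation s t x \<in> S" for x
    using wirt_funpow_dilation[OF s1 S that 1] by simp
  have 3: "?H3 x = of_real t ^ b' * of_real s ^ a' * of_real t ^ b * ?G3 (dilation s t x)" if "dilation s t x \<in> S" for x
    using wirt_funpow_dilation[OF s2 S that 2] by simp
  show ?thesis
    using wirt_funpow_dilation[OF s3 S w 3] by (simp add: wirt_multi_def power_add mult_ac)
qed

section \<open>Slowly varying frames\<close>

text \<open>Total boundedness: finitely many balls of radius \<open>e/2\<close> cover the big ball,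
  and two points of \<open>A\<close> never share one of them, so choosing such a ball for each point
  is injective.\<close>

lemma card_separated_bounded:
  fixes B e :: real
  assumes "0 < e"
  obtains N where "\<And>A :: 'a::euclidean_space set. A \<subseteq> cball 0 B \<Longrightarrow>
      (\<And>x y. x \<in> A \<Longrightarrow> y \<in> A \<Longrightarrow> x \<noteq> y \<Longrightarrow> e \<le> dist x y) \<Longrightarrow> finite A \<and> card A \<le> N"
proof -
  obtain K :: "'a set" where K: "finite K" "cball 0 B \<subseteq> (\<Union>k\<in>K. ball k (e/2))"
    using compact_cball[of 0 B] assms unfolding compact_eq_totally_bounded by (metis half_gt_zero)
  have "finite A \<and> card A \<le> card K"
    if A: "A \<subseteq> cball 0 B" and sep: "\<And>x y. x \<in> A \<Longrightarrow> y \<in> A \<Longrightarrow> x \<noteq> y \<Longrightarrow> e \<le> dist x y" for A :: "'a set"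
  proof -
    have "\<forall>x\<in>A. \<exists>k\<in>K. dist k x < e/2"
      using A K(2) by fastforce
    then obtain h where h: "\<And>x. x \<in> A \<Longrightarrow> h x \<in> K" "\<And>x. x \<in> A \<Longrightarrow> dist (h x) x < e/2"
      by metis
    have inj: "inj_on h A"
    proof (rule inj_onI, rule ccontr)
      fix x y assume xy: "x \<in> A" "y \<in> A" "h x = h y" "x \<noteq> y"
      have "dist x y < e/2 + e/2"
        by (rule dist_triangle_less_add[of _ "h x"]) (use h xy in \<open>metis dist_commute\<close>)+
      then show False using sep[OF xy(1,2,4)] by simp
    qed
    have "h ` A \<subseteq> K" using h(1) by blast
    then show ?thesis
      using inj K(1) by (meson card_inj_on_le finite_imageD finite_subset)
  qed
  then show thesis by (rule that)
qed

text \<open>The frames at nearby points are tied together only by two-sided bounds on the transition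
  maps. They may be discontinuous in \<open>z\<close>, as the Koranyi frames can be away from the
  boundary.\<close>

locale slowly_varying =
  fixes D :: "'a::euclidean_space set" and L Li :: "'a \<Rightarrow> 'a \<Rightarrow> 'a" and c C :: real
  assumes linear_L: "z \<in> D \<Longrightarrow> linear (L z)" and linear_Li: "z \<in> D \<Longrightarrow> linear (Li z)"
    and Li_L: "z \<in> D \<Longrightarrow> Li z (L z w) = w" and L_Li: "z \<in> D \<Longrightarrow> L z (Li z w) = w"
    and c_pos: "0 < c" and C_ge_1: "1 \<le> C"
    and near_in: "z \<in> D \<Longrightarrow> norm (Li z (x - z)) < c \<Longrightarrow> x \<in> D"
    and near_Li_L: "z \<in> D \<Longrightarrow> norm (Li z (x - z)) < c \<Longrightarrow> norm (Li z (L x w)) \<le> C * norm w"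
    and near_L_Li: "z \<in> D \<Longrightarrow> norm (Li z (x - z)) < c \<Longrightarrow> norm (Li x (L z w)) \<le> C * norm w"
begin

lemma Li_diff: "z \<in> D \<Longrightarrow> Li z (x - y) = Li z x - Li z y"
  by (simp add: linear_Li linear_diff)

lemma Li_0: "z \<in> D \<Longrightarrow> Li z 0 = 0"
  by (simp add: linear_Li linear_0)

lemma Li_minus: "z \<in> D \<Longrightarrow> Li z (- x) = - Li z x"
  by (simp add: linear_Li linear_neg)

text \<open>Partition of unity for the slowly varying metric \<open>x \<mapsto> norm (Li z x)\<close>.  Separation of the
  centres bounds the overlap: seen in the frame at a common point, they are separated points of a
  fixed ball.\<close>

lemma partition_weights:
  assumes "0 < \<kappa>"
  obtains \<delta> :: real and p :: "'a \<Rightarrow> 'a \<Rightarrow> complex" where "0 < \<delta>" "\<delta> \<le> c"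
    "\<And>x. x \<in> D \<Longrightarrow> finite {z. p x z \<noteq> 0}"
    "\<And>x z. x \<in> D \<Longrightarrow> p x z \<noteq> 0 \<Longrightarrow> z \<in> D \<and> norm (Li z (x - z)) < \<kappa>"
    "\<And>x. x \<in> D \<Longrightarrow> (\<Sum>z | p x z \<noteq> 0. p x z) = 1"
    "\<forall>F. (\<forall>k. unif_Ck (\<lambda>z. {w. z \<in> D \<and> norm w < \<kappa>}) k (\<lambda>z w. F z (z + L z w))) \<longrightarrow>
        (\<forall>k. unif_Ck (\<lambda>\<zeta>. {w. \<zeta> \<in> D \<and> norm w < \<delta>}) k
          (\<lambda>\<zeta> w. \<Sum>z | p (\<zeta> + L \<zeta> w) z \<noteq> 0. p (\<zeta> + L \<zeta> w) z * F z (\<zeta> + L \<zeta> w)))"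
proof -
  \<comment> \<open>The radii, measured in the frame of a centre: centres are
    \<open>r\<close>-separated, radius \<open>C * r\<close> covers, the cutoffs reach to
    \<open>2 * (C * r)\<close>, and passing to the centre of a chart of radius
    \<open>\<delta>\<close> enlarges this to \<open>3 * (C * r)\<close>. Moving once more within
    that chart stays within \<open>4 * (C * r) = min c \<kappa>\<close>.\<close>
  define r where "r = min c \<kappa> / (4 * C)"
  define \<delta> where "\<delta> = r / C"
  have C: "0 < C" using C_ge_1 by simp
  have r: "0 < r" using assms c_pos C by (simp add: r_def)
  have \<delta>: "0 < \<delta>" using r C by (simp add: \<delta>_def)
  have \<delta>_r: "C * \<delta> = r" using C by (simp add: \<delta>_def)
  have r_Cr: "r \<le> C * r" using r C_ge_1 by simp
  have \<delta>_le: "\<delta> \<le> r" using \<delta> C_ge_1 \<delta>_r by (metis mult_le_cancel_right1 order_less_imp_le not_less)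
  have rC: "4 * (C * r) = min c \<kappa>" using C by (simp add: r_def)
  then have r4: "4 * (C * r) \<le> c" "4 * (C * r) \<le> \<kappa>" by simp_all
  have rc: "r < c" "2 * (C * r) < c" "3 * (C * r) < c" "\<delta> < c" "2 * (C * r) < \<kappa>"
    using r r_Cr r4 \<delta>_le by linarith+
  define q where "q z x = norm (Li z (x - z))" for z x
  have q_sym: "q x z \<le> C * q z x" if "z \<in> D" "q z x < c" for x z
  proof -
    have "x \<in> D" using near_in that by (simp add: q_def)
    have "Li x (z - x) = - Li x (L z (Li z (x - z)))"
      using that \<open>x \<in> D\<close> by (simp add: L_Li Li_minus flip: Li_minus)
    then show ?thesis
      using near_L_Li[of z x "Li z (x - z)"] that by (simp add: q_def)
  qed
  define sep where "sep = (\<lambda>Z. Z \<subseteq> D \<and> (\<forall>z\<in>Z. \<forall>z'\<in>Z. z \<noteq> z' \<longrightarrow> r \<le> q z z'))"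
  \<comment> \<open>Zorn's lemma gives a maximal set of separated centres: two points in the union
    of a chain already lie in one member.\<close>
  have "\<exists>Z\<in>Collect sep. \<forall>X\<in>Collect sep. Z \<subseteq> X \<longrightarrow> X = Z"
  proof (rule subset_Zorn)
    fix \<C> assume "subset.chain (Collect sep) \<C>"
    then have ch: "\<C> \<subseteq> Collect sep" "\<And>X Y. X \<in> \<C> \<Longrightarrow> Y \<in> \<C> \<Longrightarrow> X \<subseteq> Y \<or> Y \<subseteq> X"
      by (auto simp: subset_chain_def)
    have "sep (\<Union>\<C>)"
      unfolding sep_def
    proof (intro conjI ballI impI)
      show "\<Union>\<C> \<subseteq> D" using ch(1) by (auto simp: sep_def)
      fix z z' assume zz: "z \<in> \<Union>\<C>" "z' \<in> \<Union>\<C>" "z \<noteq> z'"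
      then obtain X Y where "X \<in> \<C>" "Y \<in> \<C>" "z \<in> X" "z' \<in> Y" by blast
      then obtain Y where "Y \<in> \<C>" "z \<in> Y" "z' \<in> Y" using ch(2) by blast
      then show "r \<le> q z z'" using ch(1) zz(3) by (auto simp: sep_def)
    qed
    then show "\<exists>U\<in>Collect sep. \<forall>X\<in>\<C>. X \<subseteq> U" by blast
  qed
  then obtain Z where Z: "sep Z" and max: "\<And>X. sep X \<Longrightarrow> Z \<subseteq> X \<Longrightarrow> X = Z"
    by auto
  have ZD: "Z \<subseteq> D" using Z by (simp add: sep_def)
  \<comment> \<open>Otherwise \<open>x\<close> could be added to \<open>Z\<close>. Separation has to
    be checked in both orders, and since \<open>q\<close> is symmetric only up to the factor
    \<open>C\<close>, the case \<open>q x z < r\<close> merely gives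
    \<open>q z x \<le> C * r\<close>; hence the covering radius.\<close>
  have cover: "\<exists>z\<in>Z. q z x \<le> C * r" if x: "x \<in> D" for x
  proof (rule ccontr)
    assume H: "\<not> (\<exists>z\<in>Z. q z x \<le> C * r)"
    have "q x x = 0" using x by (simp add: q_def Li_0)
    then have "x \<notin> Z" using H r C by force
    have 1: "r \<le> q z x" if "z \<in> Z" for z
      using H that r_Cr by fastforce
    have 2: "r \<le> q x z" if "z \<in> Z" for z
    proof (rule ccontr)
      assume "\<not> r \<le> q x z"
      then have "q x z < r" by simp
      then have "q z x \<le> C * q x z" using q_sym[OF x] rc(1) by auto
      also have "\<dots> \<le> C * r" using \<open>q x z < r\<close> C by simp
      finally show False using H that by blast
    qed
    have "sep (insert x Z)"
      using Z x 1 2 by (auto simp: sep_def)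
    then show False using max[of "insert x Z"] \<open>x \<notin> Z\<close> by blast
  qed
  \<comment> \<open>The set of centres with nonzero weight varies from point to point.
    \<open>J \<zeta>\<close> contains it for all points of the chart at \<open>\<zeta>\<close>, so
    that sums have a fixed index set while differentiating.\<close>
  define J where "J \<zeta> = (if \<zeta> \<in> D then {z \<in> Z. q z \<zeta> < 3 * (C * r)} else {})" for \<zeta>
  have J: "z \<in> D" "\<zeta> \<in> D" "q z \<zeta> < 3 * (C * r)" if "z \<in> J \<zeta>" for z \<zeta>
    using that ZD by (auto simp: J_def split: if_splits)
  have J_near: "norm (Li z (L \<zeta> w)) \<le> C * norm w" "norm (Li \<zeta> (L z w)) \<le> C * norm w"
    if "z \<in> J \<zeta>" for z \<zeta> w
    using J[OF that] near_Li_L near_L_Li rc(3) by (auto simp: q_def)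
  \<comment> \<open>\<open>\<delta> = r / C\<close> also serves as the separation seen in the frame
    at \<open>\<zeta>\<close>: leaving the frame at \<open>z\<close> costs a factor
    \<open>C\<close>, and for the same reason the radius \<open>3 * (C * r)\<close> gains
    one.\<close>
  obtain N where N: "\<And>A :: 'a set. A \<subseteq> cball 0 (C * (3 * (C * r))) \<Longrightarrow>
      (\<And>x y. x \<in> A \<Longrightarrow> y \<in> A \<Longrightarrow> x \<noteq> y \<Longrightarrow> \<delta> \<le> dist x y) \<Longrightarrow> finite A \<and> card A \<le> N"
    using card_separated_bounded[OF \<delta>] by blast
  have cardJ: "finite (J \<zeta>) \<and> card (J \<zeta>) \<le> N" for \<zeta>
  proof (cases "\<zeta> \<in> D")
    case True
    let ?p = "\<lambda>z. Li \<zeta> (z - \<zeta>)"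
    have d: "\<delta> \<le> dist (?p z) (?p z')" if "z \<in> J \<zeta>" "z' \<in> J \<zeta>" "z \<noteq> z'" for z z'
    proof -
      have "r \<le> q z z'" using that Z by (auto simp: J_def True sep_def)
      also have "q z z' = norm (Li z (L \<zeta> (Li \<zeta> (z' - z))))"
        using True by (simp add: q_def L_Li)
      also have "\<dots> \<le> C * norm (Li \<zeta> (z' - z))"
        by (rule J_near(1)[OF that(1)])
      also have "Li \<zeta> (z' - z) = ?p z' - ?p z"
        using True by (simp add: Li_diff)
      finally have "C * \<delta> \<le> C * dist (?p z) (?p z')"
        by (simp add: \<delta>_r dist_norm norm_minus_commute)
      then show ?thesis using C by simp
    qed
    have "?p ` J \<zeta> \<subseteq> cball 0 (C * (3 * (C * r)))"
    proof (safe, simp)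
      fix z assume z: "z \<in> J \<zeta>"
      have "q \<zeta> z \<le> C * q z \<zeta>" using q_sym J[OF z] rc(3) by auto
      also have "\<dots> \<le> C * (3 * (C * r))" using J(3)[OF z] C by simp
      finally show "norm (Li \<zeta> (z - \<zeta>)) \<le> C * (3 * (C * r))" by (simp add: q_def)
    qed
    moreover have "\<delta> \<le> dist a b" if "a \<in> ?p ` J \<zeta>" "b \<in> ?p ` J \<zeta>" "a \<noteq> b" for a b
      using that d by fastforce
    ultimately have "finite (?p ` J \<zeta>) \<and> card (?p ` J \<zeta>) \<le> N"
      by (rule N)
    moreover have "inj_on ?p (J \<zeta>)"
    proof (rule inj_onI, rule ccontr)
      fix z z' assume "z \<in> J \<zeta>" "z' \<in> J \<zeta>" "?p z = ?p z'" "z \<noteq> z'"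
      then show False using d[of z z'] \<delta> by simp
    qed
    ultimately show ?thesis
      by (metis card_image finite_imageD)
  qed (simp add: J_def)
  obtain \<phi> :: "'a \<Rightarrow> real" where \<phi>: "smooth_on \<phi> UNIV" "\<And>x. 0 \<le> \<phi> x"
    "\<And>x. 2 * (C * r) \<le> norm x \<Longrightarrow> \<phi> x = 0" "\<And>x. norm x \<le> C * r \<Longrightarrow> 1 \<le> \<phi> x"
    using smooth_cutoff_exists[of "C * r" "2 * (C * r)"] r C by auto
  define T where "T \<zeta> = {w::'a. \<zeta> \<in> D \<and> norm w < \<delta>}" for \<zeta> :: 'a
  have openT: "open (T \<zeta>)" for \<zeta>
  proof -
    have "T \<zeta> = (if \<zeta> \<in> D then ball 0 \<delta> else {})"
      by (auto simp: T_def)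
    then show ?thesis by simp
  qed
  have x_in: "\<zeta> + L \<zeta> w \<in> D" and w_bound: "norm (Li (\<zeta> + L \<zeta> w) (L \<zeta> w)) \<le> C * \<delta>" if "w \<in> T \<zeta>" for \<zeta> w
  proof -
    have "\<zeta> \<in> D" "norm (Li \<zeta> (\<zeta> + L \<zeta> w - \<zeta>)) < c"
      using that rc(4) by (auto simp: T_def Li_L)
    from near_in[OF this] near_L_Li[OF this, of w]
    show "\<zeta> + L \<zeta> w \<in> D" "norm (Li (\<zeta> + L \<zeta> w) (L \<zeta> w)) \<le> C * \<delta>"
      using that C order_trans[OF _ mult_left_mono[of "norm w" \<delta> C]] by (auto simp: T_def)
  qed
  define m where "m x z = (if z \<in> Z then \<phi> (Li z (x - z)) else 0)" for x z
  have m_supp: "z \<in> Z \<and> q z x < 2 * (C * r)" if "m x z \<noteq> 0" for x z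
    using that \<phi>(3)[of "Li z (x - z)"] by (force simp: m_def q_def split: if_splits)
  have m_J: "{z. m (\<zeta> + L \<zeta> w) z \<noteq> 0} \<subseteq> J \<zeta>" if w: "w \<in> T \<zeta>" for \<zeta> w
  proof safe
    fix z assume "m (\<zeta> + L \<zeta> w) z \<noteq> 0"
    from m_supp[OF this] have z: "z \<in> Z" "z \<in> D" "q z (\<zeta> + L \<zeta> w) < 2 * (C * r)" using ZD by auto
    let ?x = "\<zeta> + L \<zeta> w"
    have \<zeta>: "\<zeta> \<in> D" using w by (simp add: T_def)
    \<comment> \<open>\<open>z\<close> is known to be close to \<open>?x\<close>, not yet to
      \<open>\<zeta>\<close>, so the shift \<open>L \<zeta> w\<close> is read first in the frame at
      \<open>?x\<close> and only then in the frame at \<open>z\<close>.\<close>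
    have "Li z (\<zeta> - z) = Li z (?x - z) - Li z (L ?x (Li ?x (L \<zeta> w)))"
      using z x_in[OF w] by (simp add: L_Li flip: Li_diff)
    then have "q z \<zeta> \<le> q z ?x + norm (Li z (L ?x (Li ?x (L \<zeta> w))))"
      unfolding q_def by (metis norm_triangle_ineq4)
    also have "norm (Li z (L ?x (Li ?x (L \<zeta> w)))) \<le> C * norm (Li ?x (L \<zeta> w))"
      using near_Li_L[OF z(2)] z(3) rc(2) by (simp add: q_def)
    also have "\<dots> \<le> C * (C * \<delta>)"
      using w_bound[OF w] C by simp
    finally have "q z \<zeta> < 3 * (C * r)"
      using z(3) \<delta>_r by simp
    then show "z \<in> J \<zeta>" using z \<zeta> by (simp add: J_def)
  qed
  have T0: "0 \<in> T x" "x + L x 0 = x" if "x \<in> D" for x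
    using that \<delta> linear_0[OF linear_L] by (auto simp: T_def)
  have fin: "finite {z. m x z \<noteq> 0}" if "x \<in> D" for x
    using m_J[OF T0(1)[OF that]] T0(2)[OF that] cardJ by (metis finite_subset)
  define S where "S x = (\<Sum>z | m x z \<noteq> 0. m x z)" for x
  have m_nonneg: "0 \<le> m x z" for x z by (simp add: m_def \<phi>(2))
  have S_ge: "1 \<le> S x" if x: "x \<in> D" for x
  proof -
    obtain z where z: "z \<in> Z" "q z x \<le> C * r" using cover[OF x] by blast
    then have "1 \<le> m x z" using \<phi>(4) by (simp add: m_def q_def)
    also have "m x z \<le> S x"
      unfolding S_def by (rule member_le_sum) (use \<open>1 \<le> m x z\<close> m_nonneg fin[OF x] in auto)
    finally show ?thesis .
  qed
  define p where "p x z = complex_of_real (m x z / S x)" for x z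
  have p0: "p x z \<noteq> 0 \<longleftrightarrow> m x z \<noteq> 0" if "x \<in> D" for x z
    using S_ge[OF that] by (simp add: p_def)
  show thesis
  proof
    show "0 < \<delta>" "\<delta> \<le> c" using \<delta> rc by simp_all
    show "finite {z. p x z \<noteq> 0}" if "x \<in> D" for x
      using fin[OF that] by (simp add: p0[OF that])
    show "z \<in> D \<and> norm (Li z (x - z)) < \<kappa>" if "x \<in> D" "p x z \<noteq> 0" for x z
      using m_supp[of x z] that p0[OF that(1)] rc(5) ZD by (auto simp: q_def)
    show "(\<Sum>z | p x z \<noteq> 0. p x z) = 1" if "x \<in> D" for x
    proof -
      have "(\<Sum>z | p x z \<noteq> 0. p x z) = (\<Sum>z | m x z \<noteq> 0. complex_of_real (m x z / S x))"
        by (simp add: p0[OF that]) (simp add: p_def)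
      also have "\<dots> = complex_of_real (S x / S x)"
        by (simp only: S_def sum_divide_distrib of_real_sum)
      also have "\<dots> = 1" using S_ge[OF that] by simp
      finally show ?thesis .
    qed
  next
    have "unif_Ck (\<lambda>\<zeta>. {w. \<zeta> \<in> D \<and> norm w < \<delta>}) k
        (\<lambda>\<zeta> w. \<Sum>z | p (\<zeta> + L \<zeta> w) z \<noteq> 0. p (\<zeta> + L \<zeta> w) z * F z (\<zeta> + L \<zeta> w))"
      if F: "\<And>k. unif_Ck (\<lambda>z. {w. z \<in> D \<and> norm w < \<kappa>}) k (\<lambda>z w. F z (z + L z w))"
      for F :: "'a \<Rightarrow> 'a \<Rightarrow> complex" and k
    proof -
      define V where "V = (\<lambda>z::'a. {w::'a. z \<in> D \<and> norm w < \<kappa>})"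
      have openV: "open (V z)" for z
      proof -
        have "V z = (if z \<in> D then ball 0 \<kappa> else {})"
          by (auto simp: V_def)
        then show ?thesis by simp
      qed
      define W where "W = (\<lambda>(\<zeta>, z). if z \<in> J \<zeta> then T \<zeta> else {})"
      have openW: "open (W j)" for j
        by (auto simp: W_def openT split: prod.splits)
      \<comment> \<open>Moves a family from the charts at \<open>z\<close> to the charts at
        \<open>\<zeta>\<close>. The linear part is \<open>Li z\<close> after
        \<open>L \<zeta>\<close>, bounded by \<open>C\<close> independently of the pair.\<close>
      have trans: "unif_Ck W k (\<lambda>j w. f (snd j) (Li (snd j) (fst j - snd j) + Li (snd j) (L (fst j) w)))"
        if "unif_Ck V k f" for f :: "'a \<Rightarrow> 'a \<Rightarrow> complex" and k
      proof (rule unif_Ck_affine[OF that openV openW])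
        fix j w assume w: "w \<in> W j"
        obtain \<zeta> z where j: "j = (\<zeta>, z)" by force
        have z: "z \<in> J \<zeta>" "w \<in> T \<zeta>" using w by (auto simp: W_def j split: if_splits)
        have "norm (Li z (\<zeta> - z) + Li z (L \<zeta> w)) \<le> q z \<zeta> + C * norm w"
          unfolding q_def by (intro norm_triangle_mono J_near z order_refl)
        also have "\<dots> < 3 * (C * r) + C * \<delta>"
          using J(3)[OF z(1)] z(2) C by (intro add_strict_mono) (simp_all add: T_def)
        also have "\<dots> \<le> \<kappa>" using r4 r_Cr \<delta>_r by linarith
        finally show "Li (snd j) (fst j - snd j) + Li (snd j) (L (fst j) w) \<in> V (snd j)"
          using J(1)[OF z(1)] by (simp add: j V_def)
      next
        fix j assume "W j \<noteq> {}"
        then have z: "snd j \<in> J (fst j)" by (auto simp: W_def split: if_splits prod.splits)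
        show "linear (\<lambda>w. Li (snd j) (L (fst j) w))"
          using linear_compose[OF linear_L linear_Li, OF J(2,1), OF z z] by (simp add: o_def)
        show "norm (Li (snd j) (L (fst j) w)) \<le> C * norm w" for w
          by (rule J_near(1)[OF z])
      qed
      have V\<phi>: "unif_Ck V k (\<lambda>z y. complex_of_real (\<phi> y))"
        by (rule unif_Ck_compact[OF smooth_on_bounded_linear[OF bounded_linear_of_real \<phi>(1)], of "cball 0 \<kappa>"])
          (auto simp: V_def)
      have conv: "Li z (\<zeta> - z) + Li z (L \<zeta> w) = Li z (\<zeta> + L \<zeta> w - z)" if "z \<in> J \<zeta>" for z \<zeta> w
        using J[OF that] linear_add[OF linear_Li] by (metis add_diff_eq add.commute diff_add_eq)
      have W\<phi>: "unif_Ck W k (\<lambda>(\<zeta>, z) w. complex_of_real (m (\<zeta> + L \<zeta> w) z))"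
        by (rule Ck_bdd_cong[OF trans[OF V\<phi>] openW])
          (auto simp: W_def m_def conv J_def split: if_splits)
      have WF: "unif_Ck W k (\<lambda>(\<zeta>, z) w. F z (\<zeta> + L \<zeta> w))"
      proof (rule Ck_bdd_cong[OF trans[of _ "\<lambda>z w. F z (z + L z w)"] openW])
        show "unif_Ck V k (\<lambda>z w. F z (z + L z w))" using F by (simp add: V_def)
        fix j w assume "w \<in> W j"
        then have z: "snd j \<in> J (fst j)" by (auto simp: W_def split: if_splits prod.splits)
        show "F (snd j) (snd j + L (snd j) (Li (snd j) (fst j - snd j) + Li (snd j) (L (fst j) w))) =
            (case j of (\<zeta>, z) \<Rightarrow> \<lambda>w. F z (\<zeta> + L \<zeta> w)) w"
          using z by (simp add: conv[OF z] L_Li[OF J(1)[OF z]] split: prod.splits)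
      qed
      \<comment> \<open>Over the fixed set \<open>J \<zeta>\<close>, numerator and denominator of
        the glued function are sums of at most \<open>N\<close> uniformly bounded terms. The
        denominator is the total weight, hence at least 1.\<close>
      have num: "unif_Ck T k (\<lambda>\<zeta> w. \<Sum>z\<in>J \<zeta>. complex_of_real (m (\<zeta> + L \<zeta> w) z) * F z (\<zeta> + L \<zeta> w))"
        using unif_Ck_mult[OF W\<phi> WF openW] cardJ
        by (intro unif_Ck_sum_bounded_card[OF _ _ _ openT, where N = N]) (auto simp: W_def case_prod_unfold)
      have den: "unif_Ck T k (\<lambda>\<zeta> w. \<Sum>z\<in>J \<zeta>. complex_of_real (m (\<zeta> + L \<zeta> w) z))"
        using W\<phi> cardJ
        by (intro unif_Ck_sum_bounded_card[OF _ _ _ openT, where N = N]) (auto simp: W_def case_prod_unfold)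
      have den_S: "(\<Sum>z\<in>J \<zeta>. complex_of_real (m (\<zeta> + L \<zeta> w) z)) = complex_of_real (S (\<zeta> + L \<zeta> w))"
        if w: "w \<in> T \<zeta>" for \<zeta> w
        unfolding S_def of_real_sum
        by (rule sum.mono_neutral_right) (use cardJ m_J[OF w] in auto)
      have "unif_Ck T k (\<lambda>\<zeta> w. (\<Sum>z\<in>J \<zeta>. complex_of_real (m (\<zeta> + L \<zeta> w) z) * F z (\<zeta> + L \<zeta> w)) /
          (\<Sum>z\<in>J \<zeta>. complex_of_real (m (\<zeta> + L \<zeta> w) z)))"
      proof (rule unif_Ck_divide[OF num den openT])
        fix \<zeta> w assume w: "w \<in> T \<zeta>"
        show "1 \<le> norm (\<Sum>z\<in>J \<zeta>. complex_of_real (m (\<zeta> + L \<zeta> w) z))"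
          using S_ge[OF x_in[OF w]] by (simp only: den_S[OF w] norm_of_real)
      qed
      then have "unif_Ck T k (\<lambda>\<zeta> w. \<Sum>z | p (\<zeta> + L \<zeta> w) z \<noteq> 0. p (\<zeta> + L \<zeta> w) z * F z (\<zeta> + L \<zeta> w))"
      proof (rule Ck_bdd_cong[OF _ openT])
        fix \<zeta> w assume w: "w \<in> T \<zeta>"
        let ?x = "\<zeta> + L \<zeta> w"
        have "(\<Sum>z | p ?x z \<noteq> 0. p ?x z * F z ?x) = (\<Sum>z\<in>J \<zeta>. p ?x z * F z ?x)"
          by (rule sum.mono_neutral_left) (use cardJ m_J[OF w] p0[OF x_in[OF w]] in auto)
        also have "\<dots> = (\<Sum>z\<in>J \<zeta>. complex_of_real (m ?x z) * F z ?x) / complex_of_real (S ?x)"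
          by (simp add: p_def sum_divide_distrib)
        finally show "(\<Sum>z\<in>J \<zeta>. complex_of_real (m ?x z) * F z ?x) / (\<Sum>z\<in>J \<zeta>. complex_of_real (m ?x z)) =
            (\<Sum>z | p ?x z \<noteq> 0. p ?x z * F z ?x)"
          by (simp only: den_S[OF w])
      qed
      then show ?thesis
        by (simp add: T_def[abs_def])
    qed
    then show "\<forall>F. (\<forall>k. unif_Ck (\<lambda>z. {w. z \<in> D \<and> norm w < \<kappa>}) k (\<lambda>z w. F z (z + L z w))) \<longrightarrow>
        (\<forall>k. unif_Ck (\<lambda>\<zeta>. {w. \<zeta> \<in> D \<and> norm w < \<delta>}) k
          (\<lambda>\<zeta> w. \<Sum>z | p (\<zeta> + L \<zeta> w) z \<noteq> 0. p (\<zeta> + L \<zeta> w) z * F z (\<zeta> + L \<zeta> w)))"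
      by blast
  qed
qed

end

section \<open>Bounds for derivatives on compact sets\<close>

lemma dir_deriv_bound_compact:
  fixes f :: "'a::euclidean_space \<Rightarrow> 'b::real_normed_vector"
  assumes "smooth_on f W" "compact K" "K \<subseteq> W"
  obtains B where "0 \<le> B" "\<And>x u. x \<in> K \<Longrightarrow> norm (dir_deriv u f x) \<le> B * norm u"
proof -
  have "\<exists>C. \<forall>x\<in>K. norm (dir_deriv b f x) \<le> C" for b
    using unif_Ck_bound[OF unif_Ck_compact[OF smooth_onD(3)[OF assms(1)] assms(2,3), of "\<lambda>_::unit. K"]]
    by blast
  then obtain C where C: "\<And>b x. x \<in> K \<Longrightarrow> norm (dir_deriv b f x) \<le> C b"
    by metis
  define B where "B = (\<Sum>b\<in>Basis. \<bar>C b\<bar>)"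
  show thesis
  proof
    show "0 \<le> B" by (simp add: B_def sum_nonneg)
    fix x u assume x: "x \<in> K"
    have "norm (dir_deriv u f x) = norm (\<Sum>b\<in>Basis. (u \<bullet> b) *\<^sub>R dir_deriv b f x)"
      using dir_deriv_basis[OF smooth_onD(2)[OF assms(1)]] x assms(3) by auto
    also have "\<dots> \<le> (\<Sum>b\<in>Basis. norm u * \<bar>C b\<bar>)"
    proof (rule sum_norm_le)
      fix b :: 'a assume "b \<in> Basis"
      then show "norm ((u \<bullet> b) *\<^sub>R dir_deriv b f x) \<le> norm u * \<bar>C b\<bar>"
        using Basis_le_norm[of b u] C[OF x, of b] by (auto intro!: mult_mono)
    qed
    finally show "norm (dir_deriv u f x) \<le> B * norm u"
      by (simp add: B_def sum_distrib_left mult.commute)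
  qed
qed

lemma dir_deriv_imp_lipschitz:
  fixes f :: "'a::euclidean_space \<Rightarrow> 'b::real_normed_vector"
  assumes "convex S" "\<And>x. x \<in> S \<Longrightarrow> f differentiable (at x)"
    "\<And>x u. x \<in> S \<Longrightarrow> norm (dir_deriv u f x) \<le> B * norm u" "x \<in> S" "y \<in> S"
  shows "norm (f x - f y) \<le> B * norm (x - y)"
proof (rule differentiable_bound[OF assms(1) _ _ assms(4,5)])
  show "(f has_derivative (\<lambda>u. dir_deriv u f x)) (at x within S)" if "x \<in> S" for x
    using has_derivative_dir_deriv[OF assms(2)[OF that]] by (rule has_derivative_at_withinI)
  show "onorm (\<lambda>u. dir_deriv u f x) \<le> B" if "x \<in> S" for x
    by (intro onorm_le) (rule assms(3)[OF that])
qed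

text \<open>The mean value inequality is applied to \<open>f\<close> minus its linear part at
  \<open>z\<close>. On the segment from \<open>z\<close> to \<open>x\<close> the derivative of this
  difference is at most a constant times \<open>norm (x - z)\<close>, because the first derivatives
  of \<open>f\<close> are Lipschitz on \<open>K\<close>.\<close>

lemma second_order_taylor_bound:
  fixes f :: "'a::euclidean_space \<Rightarrow> 'b::real_normed_vector"
  assumes "smooth_on f UNIV" "compact K" "convex K"
  obtains B where "0 \<le> B"
    "\<And>x z. x \<in> K \<Longrightarrow> z \<in> K \<Longrightarrow> norm (f x - f z - dir_deriv (x - z) f z) \<le> B * (norm (x - z))\<^sup>2"
proof -
  have "\<exists>B\<ge>0. \<forall>x\<in>K. \<forall>u. norm (dir_deriv u (dir_deriv b f) x) \<le> B * norm u" for b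
    using dir_deriv_bound_compact[OF smooth_onD(3)[OF assms(1)] assms(2)] by (metis subset_UNIV)
  then obtain C where C0: "\<And>b. 0 \<le> C b"
    and C: "\<And>b x u. x \<in> K \<Longrightarrow> norm (dir_deriv u (dir_deriv b f) x) \<le> C b * norm u"
    by metis
  have lip: "norm (dir_deriv b f x - dir_deriv b f z) \<le> C b * norm (x - z)" if "x \<in> K" "z \<in> K" for x z b
    by (rule dir_deriv_imp_lipschitz[OF assms(3) _ C that])
      (use smooth_onD(2)[OF smooth_onD(3)[OF assms(1)]] in auto)
  define B where "B = (\<Sum>b\<in>Basis. C b)"
  have B0: "0 \<le> B" by (simp add: B_def sum_nonneg C0)
  have df: "f differentiable (at x)" for x
    using smooth_onD(2)[OF assms(1)] by simp
  show thesis
  proof (rule that[OF B0])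
    fix x z assume x: "x \<in> K" and z: "z \<in> K"
    define S where "S = closed_segment z x"
    have SK: "S \<subseteq> K" using assms(3) x z by (simp add: S_def closed_segment_subset)
    let ?g = "\<lambda>y. f y - dir_deriv y f z"
    have "bounded_linear (\<lambda>y. dir_deriv y f z)"
      using has_derivative_dir_deriv[OF df] has_derivative_bounded_linear by blast
    then have dg: "(?g has_derivative (\<lambda>u. dir_deriv u f y - dir_deriv u f z)) (at y)" for y
      by (intro has_derivative_diff has_derivative_dir_deriv df bounded_linear_imp_has_derivative)
    have "norm (?g x - ?g z) \<le> (B * norm (x - z)) * norm (x - z)"
    proof (rule dir_deriv_imp_lipschitz[where S = S])
      fix y u assume "y \<in> S"
      then have y: "y \<in> K" "norm (y - z) \<le> norm (x - z)"
        using SK segment_bound1[of y z x] by (auto simp: S_def norm_minus_commute)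
      have "dir_deriv u ?g y = dir_deriv u f y - dir_deriv u f z"
        by (rule dir_derivI[OF dg])
      also have "\<dots> = (\<Sum>b\<in>Basis. (u \<bullet> b) *\<^sub>R (dir_deriv b f y - dir_deriv b f z))"
        by (simp only: dir_deriv_basis[OF df, where u = u] scaleR_diff_right sum_subtractf)
      finally have "norm (dir_deriv u ?g y) \<le> (\<Sum>b\<in>Basis. norm u * (C b * norm (x - z)))"
      proof (simp only:, intro sum_norm_le)
        fix b :: 'a assume "b \<in> Basis"
        then show "norm ((u \<bullet> b) *\<^sub>R (dir_deriv b f y - dir_deriv b f z)) \<le> norm u * (C b * norm (x - z))"
          using Basis_le_norm[of b u] lip[OF y(1) z, of b] mult_left_mono[OF y(2) C0[of b]]
          by (auto intro!: mult_mono)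
      qed
      then show "norm (dir_deriv u ?g y) \<le> B * norm (x - z) * norm u"
        by (simp add: B_def sum_distrib_left sum_distrib_right mult_ac)
    qed (use dg in \<open>auto simp: S_def differentiable_def\<close>)
    moreover have "?g x - ?g z = f x - f z - dir_deriv (x - z) f z"
      using linear_frechet_derivative[OF df] by (simp add: linear_diff)
    ultimately show "norm (f x - f z - dir_deriv (x - z) f z) \<le> B * (norm (x - z))\<^sup>2"
      by (simp add: power2_eq_square mult.assoc)
  qed
qed

section \<open>The Hermitian product\<close>

lemma norm_vector_scalar: "norm (c *s x) = norm c * norm x" for x :: "complex^2"
  by (simp add: norm_vec_def L2_set_def norm_mult power_mult_distrib sum_distrib_left[symmetric] real_sqrt_mult)

lemma norm_le_components: "norm x \<le> norm (x $ 1) + norm (x $ 2)" for x :: "complex^2"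
  using L2_set_le_sum[of UNIV "\<lambda>i. norm (x $ i)"] by (simp add: norm_vec_def sum_2)

lemma Re_herm: "Re (herm x y) = x \<bullet> y"
  by (simp add: herm_def inner_vec_def inner_complex_def)

lemma herm_cnj: "cnj (herm x y) = herm y x"
  by (simp add: herm_def mult.commute)

lemma herm_self: "herm x x = of_real ((norm x)\<^sup>2)"
proof -
  have "Im (herm x x) = 0" using herm_cnj[of x x] by (metis Reals_cnj_iff complex_is_Real_iff)
  then show ?thesis by (simp add: complex_eq_iff Re_herm power2_norm_eq_inner)
qed

lemma herm_simps [simp]:
  "herm (x + y) z = herm x z + herm y z" "herm (c *s x) z = c * herm x z"
  "herm (x - y) z = herm x z - herm y z" "herm z (x + y) = herm z x + herm z y"
  "herm z (x - y) = herm z x - herm z y" "herm (r *\<^sub>R x) z = of_real r * herm x z"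
  "herm z (r *\<^sub>R x) = of_real r * herm z x"
  by (simp_all add: herm_def sum_2 algebra_simps scaleR_conv_of_real[where 'a = complex])

text \<open>A unimodular factor makes the product real and nonnegative, and the real Cauchy-Schwarz
  inequality applies. If the product is 0 so is the factor, hence its norm is only said to be at
  most 1.\<close>

lemma norm_herm_le: "norm (herm x y) \<le> norm x * norm y"
proof -
  let ?c = "cnj (sgn (herm x y))"
  have "?c * herm x y = (herm x y * cnj (herm x y)) / of_real (norm (herm x y))"
    by (simp add: sgn_eq)
  also have "\<dots> = of_real (norm (herm x y))"
    by (simp add: power2_eq_square flip: complex_norm_square)
  finally have "norm (herm x y) = Re (?c * herm x y)"
    by simp
  also have "\<dots> = (?c *s x) \<bullet> y"
    by (simp flip: Re_herm)
  also have "\<dots> \<le> norm (?c *s x) * norm y"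
    by (rule norm_cauchy_schwarz)
  also have "\<dots> \<le> 1 * norm x * norm y"
    unfolding norm_vector_scalar by (intro mult_right_mono) (auto simp: norm_sgn)
  finally show ?thesis by simp
qed

definition frame_map :: "complex^2 \<Rightarrow> complex^2 \<Rightarrow> complex^2 \<Rightarrow> complex^2" where
  "frame_map e1 e2 w = (w $ 1) *s e1 + (w $ 2) *s e2"

definition frame_coords :: "complex^2 \<Rightarrow> complex^2 \<Rightarrow> complex^2 \<Rightarrow> complex^2" where
  "frame_coords e1 e2 h = (\<chi> j. if j = 1 then herm h e1 else herm h e2)"

lemma frame_coords_nth [simp]:
  "frame_coords e1 e2 h $ 1 = herm h e1" "frame_coords e1 e2 h $ 2 = herm h e2"
  by (simp_all add: frame_coords_def)

lemma linear_frame_map: "linear (frame_map e1 e2)"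
  by (rule linearI) (simp_all add: frame_map_def vec_eq_iff algebra_simps scaleR_conv_of_real[where 'a = complex])

lemma linear_frame_coords: "linear (frame_coords e1 e2)"
  by (rule linearI) (simp_all add: vec_eq_iff forall_2 scaleR_conv_of_real[where 'a = complex])

lemma frame_coords_map:
  assumes "norm e1 = 1" "norm e2 = 1" "herm e1 e2 = 0"
  shows "frame_coords e1 e2 (frame_map e1 e2 w) = w"
proof -
  have "herm e2 e1 = 0" using herm_cnj[of e1 e2] assms by simp
  then show ?thesis
    using assms by (simp add: vec_eq_iff forall_2 frame_map_def herm_self)
qed

text \<open>A left inverse is also a right inverse here, since an injective linear map of a
  finite-dimensional space into itself is onto.\<close>

lemma frame_map_coords:
  assumes "norm e1 = 1" "norm e2 = 1" "herm e1 e2 = 0"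
  shows "frame_map e1 e2 (frame_coords e1 e2 h) = h"
proof -
  have "inj (frame_map e1 e2)"
    using frame_coords_map[OF assms] by (metis injI)
  then have "surj (frame_map e1 e2)"
    by (rule linear_inj_imp_surj[OF linear_frame_map])
  then obtain w where "h = frame_map e1 e2 w" by (metis surjD)
  then show ?thesis by (simp add: frame_coords_map[OF assms])
qed

lemma koranyi_point_eq: "koranyi_point \<eta> v z w = z + frame_map (\<eta> z) (v z) w"
  by (simp add: koranyi_point_def frame_map_def)

section \<open>The Koranyi frames vary slowly\<close>

locale koranyi_domain =
  fixes \<rho> :: "complex^2 \<Rightarrow> real" and U D :: "(complex^2) set" and \<eta> v :: "complex^2 \<Rightarrow> complex^2"
  assumes domain: "strictly_convex_domain \<rho> U D" and frame: "koranyi_frame \<rho> U D \<eta> v"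
begin

lemma smooth_rho: "smooth_on \<rho> UNIV"
  using domain by (simp add: strictly_convex_domain_def)

lemma rho_differentiable: "\<rho> differentiable (at x)"
  using smooth_onD(2)[OF smooth_rho] by simp

lemma continuous_rho: "continuous_on S \<rho>"
  using smooth_onD(1)[OF smooth_rho] continuous_on_subset by blast

lemma D_iff: "z \<in> D \<longleftrightarrow> \<rho> z < 0"
  using domain by (simp add: strictly_convex_domain_def)

lemma open_D: "open D"
proof -
  have "D = {z. \<rho> z < 0}" using D_iff by blast
  then show ?thesis using open_Collect_less[OF continuous_rho continuous_on_const] by simp
qed

lemma rho_closure_le: "z \<in> closure D \<Longrightarrow> \<rho> z \<le> 0"
proof -
  assume "z \<in> closure D"
  moreover have "closed {z. \<rho> z \<le> 0}"
    by (rule closed_Collect_le[OF continuous_rho continuous_on_const])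
  moreover have "D \<subseteq> {z. \<rho> z \<le> 0}" using D_iff by auto
  ultimately show ?thesis using closure_minimal by blast
qed

lemma open_U: "open U" and frontier_U: "frontier D \<subseteq> U" and bounded_D: "bounded D"
  using domain unfolding strictly_convex_domain_def by blast+

lemma smooth_v: "smooth_on v U"
  using frame by (simp add: koranyi_frame_def)

lemma compact_closure_D: "compact (closure D)"
  by (simp add: compact_closure bounded_D)

lemma dir_deriv_rho: "dir_deriv h \<rho> z = grad \<rho> z \<bullet> h"
  by (subst dir_deriv_basis[OF rho_differentiable])
    (simp add: grad_def inner_sum_left inner_commute[of h] mult.commute)

lemma dir_deriv_rho_v: "z \<in> U \<Longrightarrow> dir_deriv (c *s v z) \<rho> z = 0"
  using frame by (auto simp: koranyi_frame_def tangent_space_def)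

lemma grad_nz: "z \<in> U \<Longrightarrow> grad \<rho> z \<noteq> 0"
  using domain by (simp add: strictly_convex_domain_def)

lemma eta_U: "z \<in> U \<Longrightarrow> \<eta> z = grad \<rho> z /\<^sub>R norm (grad \<rho> z)"
  using frame by (simp add: koranyi_frame_def outer_unit_normal_def)

lemma orthonormal_frame:
  assumes "z \<in> D"
  shows "norm (\<eta> z) = 1" "norm (v z) = 1" "herm (\<eta> z) (v z) = 0"
proof -
  have "norm (\<eta> z) = 1 \<and> norm (v z) = 1 \<and> herm (\<eta> z) (v z) = 0"
  proof (cases "z \<in> U")
    case True
    let ?h = "herm (grad \<rho> z) (v z)"
    \<comment> \<open>Tangency holds for every complex multiple of \<open>v z\<close>; the multiple
      by \<open>?h\<close> turns the real inner product into the squared modulus of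
      \<open>?h\<close>.\<close>
    have "0 = grad \<rho> z \<bullet> (?h *s v z)"
      using dir_deriv_rho_v[OF True] dir_deriv_rho by simp
    also have "\<dots> = Re (herm (?h *s v z) (grad \<rho> z))"
      by (simp only: Re_herm inner_commute[of "grad \<rho> z"])
    also have "\<dots> = Re (?h * cnj ?h)"
      by (simp only: herm_simps herm_cnj)
    also have "\<dots> = (norm ?h)\<^sup>2"
      by (simp add: cmod_power2) (simp add: power2_eq_square)
    finally have "?h = 0" by simp
    then show ?thesis
      using frame True grad_nz[OF True] by (simp add: koranyi_frame_def outer_unit_normal_def)
  next
    case False
    then show ?thesis using frame assms by (simp add: koranyi_frame_def)
  qed
  then show "norm (\<eta> z) = 1" "norm (v z) = 1" "herm (\<eta> z) (v z) = 0" by simp_all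
qed

definition L :: "complex^2 \<Rightarrow> complex^2 \<Rightarrow> complex^2" where
  "L z w = frame_map (\<eta> z) (v z) (dilation \<bar>\<rho> z\<bar> (sqrt \<bar>\<rho> z\<bar>) w)"

definition Li :: "complex^2 \<Rightarrow> complex^2 \<Rightarrow> complex^2" where
  "Li z h = dilation (inverse \<bar>\<rho> z\<bar>) (inverse (sqrt \<bar>\<rho> z\<bar>)) (frame_coords (\<eta> z) (v z) h)"

lemma linear_L: "linear (L z)"
  using linear_compose[OF linear_dilation linear_frame_map] by (simp add: L_def[abs_def] o_def)

lemma linear_Li: "linear (Li z)"
  using linear_compose[OF linear_frame_coords linear_dilation] by (simp add: Li_def[abs_def] o_def)

lemma Li_L: "z \<in> D \<Longrightarrow> Li z (L z w) = w"
  using D_iff[of z]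
  by (simp add: L_def Li_def frame_coords_map[OF orthonormal_frame] vec_eq_iff forall_2)

lemma L_Li: "z \<in> D \<Longrightarrow> L z (Li z h) = h"
proof -
  assume z: "z \<in> D"
  have "dilation \<bar>\<rho> z\<bar> (sqrt \<bar>\<rho> z\<bar>) (Li z h) = frame_coords (\<eta> z) (v z) h"
    using z D_iff[of z] by (simp add: Li_def vec_eq_iff forall_2)
  then show ?thesis
    by (simp add: L_def frame_map_coords[OF orthonormal_frame[OF z]])
qed

text \<open>One entry of the transition matrix is dangerous: the component of \<open>v x\<close>
  along \<open>\<eta> z\<close> is scaled by
  \<open>sqrt \<bar>\<rho> x\<bar> / \<bar>\<rho> z\<bar>\<close>, for which only a bound of order
  \<open>1 / sqrt \<bar>\<rho> z\<bar>\<close> is available. As \<open>v z\<close> is orthogonal to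
  \<open>\<eta> z\<close>, only \<open>v x - v z\<close> contributes to this component, and its
  assumed size makes up for the missing factor. The opposite entry is scaled by
  \<open>\<bar>\<rho> x\<bar> / sqrt \<bar>\<rho> z\<bar>\<close>, which is bounded through
  \<open>m\<close>.\<close>

lemma transition_bound:
  assumes x: "x \<in> D" and z: "z \<in> D" and \<rho>: "\<bar>\<rho> x\<bar> \<le> 2 * \<bar>\<rho> z\<bar>" "sqrt \<bar>\<rho> z\<bar> \<le> m"
    and v: "norm (v x - v z) \<le> A * sqrt \<bar>\<rho> z\<bar>" "0 \<le> A"
  shows "norm (Li z (L x w)) \<le> (4 + 2 * A + 2 * m) * norm w"
proof -
  define s t s' t' where "s = \<bar>\<rho> z\<bar>" and "t = sqrt \<bar>\<rho> z\<bar>" and "s' = \<bar>\<rho> x\<bar>" and "t' = sqrt \<bar>\<rho> x\<bar>"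
  have st: "0 < t" "s = t * t" "0 < s" using z D_iff[of z] by (simp_all add: s_def t_def)
  have st': "0 \<le> t'" "s' = t' * t'" "0 \<le> s'" by (simp_all add: s'_def t'_def)
  have "t' \<le> 2 * t"
  proof -
    have "t' \<le> sqrt (2\<^sup>2 * \<bar>\<rho> z\<bar>)" unfolding t'_def using \<rho>(1) by simp
    then show ?thesis by (simp add: real_sqrt_mult t_def)
  qed
  have s': "s' \<le> 2 * s" using \<rho>(1) by (simp add: s_def s'_def)
  have w: "norm (w $ 1) \<le> norm w" "norm (w $ 2) \<le> norm w"
    by (rule Finite_Cartesian_Product.norm_nth_le)+
  note ox = orthonormal_frame[OF x] and oz = orthonormal_frame[OF z]
  have h1: "norm (herm (\<eta> x) (\<eta> z)) \<le> 1" "norm (herm (\<eta> x) (v z)) \<le> 1" "norm (herm (v x) (v z)) \<le> 1"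
    using norm_herm_le[of "\<eta> x" "\<eta> z"] norm_herm_le[of "\<eta> x" "v z"] norm_herm_le[of "v x" "v z"] ox oz
    by simp_all
  have "herm (v z) (\<eta> z) = 0" using herm_cnj[of "\<eta> z" "v z"] oz by simp
  then have h2: "norm (herm (v x) (\<eta> z)) \<le> A * t"
    using norm_herm_le[of "v x - v z" "\<eta> z"] oz v by (simp add: t_def)
  have "norm (Li z (L x w) $ 1) = norm (inverse s *\<^sub>R (s' *\<^sub>R (w $ 1 * herm (\<eta> x) (\<eta> z)) + t' *\<^sub>R (w $ 2 * herm (v x) (\<eta> z))))"
    by (simp add: Li_def L_def frame_map_def s_def s'_def t'_def scaleR_conv_of_real mult_ac)
  also have "\<dots> = norm (s' *\<^sub>R (w $ 1 * herm (\<eta> x) (\<eta> z)) + t' *\<^sub>R (w $ 2 * herm (v x) (\<eta> z))) / s"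
    using st(1,3) by (simp add: divide_inverse mult.commute)
  also have "\<dots> \<le> (s' * norm w + t' * (norm w * (A * t))) / s"
  proof (rule divide_right_mono)
    have "norm (s' *\<^sub>R (w $ 1 * herm (\<eta> x) (\<eta> z))) \<le> s' * norm w"
      using mult_mono[OF w(1) h1(1)] st' by (simp add: norm_mult mult_left_mono)
    moreover have "norm (t' *\<^sub>R (w $ 2 * herm (v x) (\<eta> z))) \<le> t' * (norm w * (A * t))"
      using mult_mono[OF w(2) h2] st' by (simp add: norm_mult mult_left_mono)
    ultimately show "norm (s' *\<^sub>R (w $ 1 * herm (\<eta> x) (\<eta> z)) + t' *\<^sub>R (w $ 2 * herm (v x) (\<eta> z))) \<le>
        s' * norm w + t' * (norm w * (A * t))"
      by (rule norm_triangle_mono)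
  qed (use st in simp)
  also have "\<dots> \<le> (2 * s * norm w + 2 * t * (norm w * (A * t))) / s"
    using st st' s' \<open>t' \<le> 2 * t\<close> v(2) by (intro divide_right_mono add_mono mult_right_mono) auto
  also have "\<dots> = (2 + 2 * A) * norm w"
    using st by (simp add: field_simps)
  finally have c1: "norm (Li z (L x w) $ 1) \<le> (2 + 2 * A) * norm w" .
  have "norm (Li z (L x w) $ 2) = norm (inverse t *\<^sub>R (s' *\<^sub>R (w $ 1 * herm (\<eta> x) (v z)) + t' *\<^sub>R (w $ 2 * herm (v x) (v z))))"
    by (simp add: Li_def L_def frame_map_def t_def s'_def t'_def scaleR_conv_of_real mult_ac)
  also have "\<dots> = norm (s' *\<^sub>R (w $ 1 * herm (\<eta> x) (v z)) + t' *\<^sub>R (w $ 2 * herm (v x) (v z))) / t"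
    using st(1,3) by (simp add: divide_inverse mult.commute)
  also have "\<dots> \<le> (s' * norm w + t' * norm w) / t"
  proof (rule divide_right_mono)
    have "norm (s' *\<^sub>R (w $ 1 * herm (\<eta> x) (v z))) \<le> s' * norm w"
      using mult_mono[OF w(1) h1(2)] st' by (simp add: norm_mult mult_left_mono)
    moreover have "norm (t' *\<^sub>R (w $ 2 * herm (v x) (v z))) \<le> t' * norm w"
      using mult_mono[OF w(2) h1(3)] st' by (simp add: norm_mult mult_left_mono)
    ultimately show "norm (s' *\<^sub>R (w $ 1 * herm (\<eta> x) (v z)) + t' *\<^sub>R (w $ 2 * herm (v x) (v z))) \<le>
        s' * norm w + t' * norm w"
      by (rule norm_triangle_mono)
  qed (use st in simp)
  also have "\<dots> \<le> (2 * s * norm w + 2 * t * norm w) / t"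
    using st st' s' \<open>t' \<le> 2 * t\<close> by (intro divide_right_mono add_mono mult_right_mono) auto
  also have "\<dots> = (2 * t + 2) * norm w"
    using st by (simp add: field_simps)
  also have "\<dots> \<le> (2 * m + 2) * norm w"
    using \<rho>(2) by (intro mult_right_mono) (auto simp: t_def)
  finally have c2: "norm (Li z (L x w) $ 2) \<le> (2 * m + 2) * norm w" .
  show ?thesis
    using norm_le_components[of "Li z (L x w)"] c1 c2 by (simp add: algebra_simps)
qed

text \<open>The tangential scale dominates: \<open>\<bar>\<rho> z\<bar>\<close> is at most
  \<open>m * sqrt \<bar>\<rho> z\<bar>\<close>, so charts have Euclidean size of order
  \<open>sqrt \<bar>\<rho> z\<bar>\<close>.\<close>

lemma L_norm_le:
  assumes z: "z \<in> D" and m: "sqrt \<bar>\<rho> z\<bar> \<le> m"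
  shows "norm (L z w) \<le> (m + 1) * sqrt \<bar>\<rho> z\<bar> * norm w"
proof -
  let ?t = "sqrt \<bar>\<rho> z\<bar>"
  have t: "\<bar>\<rho> z\<bar> = ?t * ?t" by simp
  have "norm (L z w) \<le> \<bar>\<rho> z\<bar> * norm (w $ 1) + ?t * norm (w $ 2)"
    using norm_triangle_ineq[of "(\<bar>\<rho> z\<bar> *\<^sub>R (w $ 1)) *s \<eta> z" "(?t *\<^sub>R (w $ 2)) *s v z"] orthonormal_frame[OF z]
    by (simp add: L_def frame_map_def norm_vector_scalar)
  also have "\<dots> \<le> \<bar>\<rho> z\<bar> * norm w + ?t * norm w"
    by (intro add_mono mult_left_mono Finite_Cartesian_Product.norm_nth_le) auto
  also have "\<dots> = (?t + 1) * ?t * norm w"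
    by (subst t) (simp only: algebra_simps)
  also have "\<dots> \<le> (m + 1) * ?t * norm w"
    using m by (intro mult_right_mono) auto
  finally show ?thesis .
qed

lemma rho_bounded: obtains M where "0 < M" "\<And>z. z \<in> D \<Longrightarrow> \<bar>\<rho> z\<bar> \<le> M"
proof -
  have "compact (\<rho> ` closure D)"
    using compact_closure_D continuous_rho by (rule compact_continuous_image[rotated])
  then obtain B where B: "0 < B" "\<And>y. y \<in> \<rho> ` closure D \<Longrightarrow> norm y \<le> B"
    using compact_imp_bounded bounded_pos by metis
  show thesis
    by (rule that[OF B(1)]) (use B(2) closure_subset in force)
qed

text \<open>Two regimes. If \<open>- \<epsilon> \<le> \<rho> z\<close>, then \<open>z\<close> lies
  in a compact part of \<open>U\<close>: to first order \<open>\<rho>\<close> changes only through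
  the normal displacement, of size \<open>c * \<bar>\<rho> z\<bar>\<close>, and the quadratic error
  is comparable since \<open>norm (x - z)\<close> is of order
  \<open>c * sqrt \<bar>\<rho> z\<bar>\<close>. If \<open>\<rho> z < - \<epsilon>\<close>, the frame
  may be arbitrary, but \<open>\<bar>\<rho> z\<bar>\<close> is bounded below, and a Lipschitz bound
  for \<open>\<rho>\<close> together with the unit length of \<open>v\<close> suffices.\<close>

lemma nearby_points:
  obtains c A m where "0 < c" "c \<le> 1" "0 \<le> A" "0 \<le> m"
    "\<And>z. z \<in> D \<Longrightarrow> sqrt \<bar>\<rho> z\<bar> \<le> m"
    "\<And>z x. z \<in> D \<Longrightarrow> norm (Li z (x - z)) < c \<Longrightarrow>
      x \<in> D \<and> \<bar>\<rho> x\<bar> \<le> 2 * \<bar>\<rho> z\<bar> \<and> \<bar>\<rho> z\<bar> \<le> 2 * \<bar>\<rho> x\<bar> \<and> norm (v x - v z) \<le> A * sqrt \<bar>\<rho> z\<bar>"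
proof -
  obtain M where M: "0 < M" "\<And>z. z \<in> D \<Longrightarrow> \<bar>\<rho> z\<bar> \<le> M" using rho_bounded by blast
  define m where "m = sqrt M"
  have m0: "0 < m" using M by (simp add: m_def)
  have m: "sqrt \<bar>\<rho> z\<bar> \<le> m" if "z \<in> D" for z
    using M(2)[OF that] by (simp add: m_def)
  have closure_DU: "z \<in> U \<or> z \<in> D" if "z \<in> closure D" for z
    using that frontier_U open_D by (auto simp: frontier_def interior_open)
  have "compact (closure D - U)"
    using compact_closure_D open_U by (simp add: compact_diff)
  \<comment> \<open>\<open>closure D - U\<close> misses the frontier, so it is a compact subset of
    \<open>D\<close>, on which the maximum of \<open>\<rho>\<close> is negative. If it is empty, any
    \<open>\<epsilon>\<close> does.\<close>
  obtain \<epsilon> where \<epsilon>: "0 < \<epsilon>" "\<And>z. z \<in> closure D - U \<Longrightarrow> \<rho> z < - \<epsilon>"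
  proof (cases "closure D - U = {}")
    case True
    then show thesis by (intro that[of 1]) auto
  next
    case False
    then obtain z0 where z0: "z0 \<in> closure D - U" "\<And>z. z \<in> closure D - U \<Longrightarrow> \<rho> z \<le> \<rho> z0"
      using continuous_attains_sup[OF \<open>compact (closure D - U)\<close> False continuous_rho] by blast
    have "\<rho> z0 < 0" using z0(1) closure_DU[of z0] D_iff by auto
    then show thesis using that[of "- \<rho> z0 / 2"] z0(2) by fastforce
  qed
  define K where "K = closure D \<inter> {z. - \<epsilon> \<le> \<rho> z}"
  have "closed {z. - \<epsilon> \<le> \<rho> z}"
    by (rule closed_Collect_le[OF continuous_on_const continuous_rho])
  then have K: "compact K" unfolding K_def using compact_closure_D by (rule compact_Int_closed[rotated])
  have KU: "K \<subseteq> U" using \<epsilon>(2) by (force simp: K_def)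
  \<comment> \<open>A margin around \<open>K\<close> inside \<open>U\<close>: balls of radius
    \<open>d\<close> about points of \<open>K\<close> are convex sets on which the derivative of
    \<open>v\<close> is bounded.\<close>
  obtain d where d: "0 < d" "(\<Union>x\<in>K. cball x d) \<subseteq> U"
    using compact_subset_open_imp_cball_epsilon_subset[OF K open_U KU] by blast
  obtain Bv where Bv: "0 \<le> Bv" "\<And>x u. x \<in> (\<Union>x\<in>K. cball x d) \<Longrightarrow> norm (dir_deriv u v x) \<le> Bv * norm u"
    using dir_deriv_bound_compact[OF smooth_v compact_minkowski_sum_cball[OF K] d(2)] by blast
  obtain R where R: "0 < R" "\<And>z. z \<in> closure D \<Longrightarrow> norm z \<le> R"
    using compact_imp_bounded[OF compact_closure_D] bounded_pos by blast
  define Q where "Q = cball (0::complex^2) (R + 1)"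
  have Q: "compact Q" "convex Q" by (simp_all add: Q_def)
  obtain B1 where B1: "0 \<le> B1" "\<And>x u. x \<in> Q \<Longrightarrow> norm (dir_deriv u \<rho> x) \<le> B1 * norm u"
    using dir_deriv_bound_compact[OF smooth_rho Q(1)] by blast
  obtain B2 where B2: "0 \<le> B2" "\<And>x z. x \<in> Q \<Longrightarrow> z \<in> Q \<Longrightarrow>
      norm (\<rho> x - \<rho> z - dir_deriv (x - z) \<rho> z) \<le> B2 * (norm (x - z))\<^sup>2"
    using second_order_taylor_bound[OF smooth_rho Q] by blast
  define H where "H = m + 1"
  have H: "0 < H" using m0 by (simp add: H_def)
  \<comment> \<open>In order, the entries ensure that terms quadratic in \<open>c\<close> are at
    most linear, that \<open>x\<close> is within 1 of \<open>z\<close> and so in \<open>Q\<close>,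
    that \<open>x\<close> is within \<open>d\<close> of \<open>z\<close>, and, in the interior and
    the boundary regime respectively, that \<open>\<rho>\<close> changes by at most half of
    \<open>\<bar>\<rho> z\<bar>\<close>. The summands 1 keep the denominators positive.\<close>
  define c where "c = Min {1, 1 / (H * m), d / (H * m), \<epsilon> / (2 * (B1 + 1) * H * m), 1 / (2 * (B1 + B2 * H\<^sup>2 + 1))}"
  have pos: "0 < H * m" "0 < 2 * (B1 + 1) * H * m" "0 < 2 * (B1 + B2 * H\<^sup>2 + 1)"
    using H m0 B1(1) B2(1) by (auto intro!: mult_pos_pos add_nonneg_pos)
  have c0: "0 < c"
    using pos d(1) \<epsilon>(1) by (simp add: c_def)
  have "c \<le> 1" "c \<le> 1 / (H * m)" "c \<le> d / (H * m)" "c \<le> \<epsilon> / (2 * (B1 + 1) * H * m)" "c \<le> 1 / (2 * (B1 + B2 * H\<^sup>2 + 1))"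
    by (simp_all add: c_def)
  then have c: "c \<le> 1" "H * m * c \<le> 1" "H * m * c \<le> d" "2 * (B1 + 1) * H * m * c \<le> \<epsilon>" "2 * (B1 + B2 * H\<^sup>2 + 1) * c \<le> 1"
    using pos by (simp_all add: pos_le_divide_eq mult.commute)
  \<comment> \<open>\<open>Bv * H\<close> serves the boundary regime; in the interior
    \<open>2 / sqrt \<epsilon>\<close> brings the trivial bound 2 for a difference of unit vectors
    into the required form.\<close>
  define A where "A = max (Bv * H) (2 / sqrt \<epsilon>)"
  have A: "0 \<le> A" using Bv(1) H by (simp add: A_def le_max_iff_disj)
  have main: "x \<in> D \<and> \<bar>\<rho> x\<bar> \<le> 2 * \<bar>\<rho> z\<bar> \<and> \<bar>\<rho> z\<bar> \<le> 2 * \<bar>\<rho> x\<bar> \<and> norm (v x - v z) \<le> A * sqrt \<bar>\<rho> z\<bar>"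
    if z: "z \<in> D" and near: "norm (Li z (x - z)) < c" for z x
  proof -
    define w where "w = Li z (x - z)"
    define t where "t = sqrt \<bar>\<rho> z\<bar>"
    have t: "0 < t" "\<bar>\<rho> z\<bar> = t * t" "t \<le> m" using z D_iff m by (auto simp: t_def)
    have w: "norm w < c" "x - z = L z w"
      using near z by (simp_all add: w_def L_Li)
    have dist1: "norm (x - z) \<le> H * t * norm w"
      using L_norm_le[OF z m[OF z], of w] by (simp add: w(2) H_def t_def)
    also have dist2: "\<dots> \<le> H * t * c"
      using w(1) H t by (intro mult_left_mono) auto
    also have "\<dots> \<le> H * m * c"
      using t H c0 by (intro mult_right_mono mult_left_mono) auto
    finally have dist3: "norm (x - z) \<le> H * m * c" .
    have "norm z \<le> R" using R(2) z closure_subset by blast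
    then have zQ: "z \<in> Q" and xQ: "x \<in> Q"
      using norm_triangle_sub[of x z] dist3 c(2) by (auto simp: Q_def)
    \<comment> \<open>A change of at most half fixes the sign of \<open>\<rho> x\<close> and gives
      both factors 2. The bound for \<open>v\<close> is conditional on \<open>x \<in> D\<close>
      because in the interior regime \<open>v x\<close> is known to be a unit vector only
      there.\<close>
    have res: "\<bar>\<rho> x - \<rho> z\<bar> \<le> \<bar>\<rho> z\<bar> / 2 \<and> (x \<in> D \<longrightarrow> norm (v x - v z) \<le> A * t)"
    proof (cases "- \<epsilon> \<le> \<rho> z")
      case True
      then have zK: "z \<in> K" using z closure_subset by (auto simp: K_def)
      then have zU: "z \<in> U" using KU by blast
      have lin: "linear (frechet_derivative \<rho> (at z))"
        by (rule linear_frechet_derivative[OF rho_differentiable])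
      have "dir_deriv (x - z) \<rho> z = dir_deriv ((\<bar>\<rho> z\<bar> *\<^sub>R (w $ 1)) *s \<eta> z) \<rho> z"
        by (simp add: w(2) L_def frame_map_def linear_add[OF lin] dir_deriv_rho_v[OF zU])
      then have "\<bar>dir_deriv (x - z) \<rho> z\<bar> \<le> B1 * (\<bar>\<rho> z\<bar> * norm (w $ 1))"
        using B1(2)[OF zQ, of "(\<bar>\<rho> z\<bar> *\<^sub>R (w $ 1)) *s \<eta> z"] orthonormal_frame[OF z]
        by (simp add: norm_vector_scalar)
      also have "\<dots> \<le> B1 * (\<bar>\<rho> z\<bar> * c)"
        using Finite_Cartesian_Product.norm_nth_le[of w 1] w(1) B1(1) by (intro mult_left_mono) auto
      finally have 1: "\<bar>dir_deriv (x - z) \<rho> z\<bar> \<le> B1 * (\<bar>\<rho> z\<bar> * c)" .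
      have "(norm (x - z))\<^sup>2 \<le> (H * t * c)\<^sup>2"
        using dist1 dist2 by (intro power_mono) auto
      also have "\<dots> = H\<^sup>2 * \<bar>\<rho> z\<bar> * (c * c)"
        by (simp add: t(2) power2_eq_square)
      also have "\<dots> \<le> H\<^sup>2 * \<bar>\<rho> z\<bar> * c"
        using c(1) c0 by (intro mult_left_mono) auto
      finally have "B2 * (norm (x - z))\<^sup>2 \<le> B2 * (H\<^sup>2 * \<bar>\<rho> z\<bar> * c)"
        using B2(1) by (rule mult_left_mono)
      then have "\<bar>\<rho> x - \<rho> z\<bar> \<le> B1 * (\<bar>\<rho> z\<bar> * c) + B2 * (H\<^sup>2 * \<bar>\<rho> z\<bar> * c)"
        using B2(2)[OF xQ zQ] 1 by simp
      also have "\<dots> \<le> (2 * (B1 + B2 * H\<^sup>2 + 1) * c) * (\<bar>\<rho> z\<bar> / 2)"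
        using c0 by (simp add: algebra_simps)
      also have "\<dots> \<le> 1 * (\<bar>\<rho> z\<bar> / 2)"
        using c(5) by (intro mult_right_mono) auto
      finally have \<rho>: "\<bar>\<rho> x - \<rho> z\<bar> \<le> \<bar>\<rho> z\<bar> / 2" by simp
      have sub: "cball z d \<subseteq> (\<Union>x\<in>K. cball x d)" using zK by blast
      have "norm (v x - v z) \<le> Bv * norm (x - z)"
      proof (rule dir_deriv_imp_lipschitz[where S = "cball z d"])
        show "v differentiable (at y)" if "y \<in> cball z d" for y
          using smooth_onD(2)[OF smooth_v] that sub d(2) by blast
        show "norm (dir_deriv u v y) \<le> Bv * norm u" if "y \<in> cball z d" for y u
          using Bv(2) that sub by blast
        show "x \<in> cball z d"
          using dist3 c(3) by (simp add: dist_norm norm_minus_commute)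
      qed (use d(1) in auto)
      also have "\<dots> \<le> Bv * (H * t)"
      proof (rule mult_left_mono[OF _ Bv(1)])
        have "H * t * c \<le> H * t * 1" using c(1) H t by (intro mult_left_mono) auto
        then show "norm (x - z) \<le> H * t" using dist1 dist2 by simp
      qed
      also have "\<dots> \<le> A * t"
        using t by (simp add: A_def mult_right_mono flip: mult.assoc)
      finally show ?thesis using \<rho> by simp
    next
      case False
      then have \<epsilon>z: "\<epsilon> < \<bar>\<rho> z\<bar>" by simp
      have "norm (\<rho> x - \<rho> z) \<le> B1 * norm (x - z)"
        by (rule dir_deriv_imp_lipschitz[OF Q(2) rho_differentiable B1(2) xQ zQ])
      also have "\<dots> \<le> (B1 + 1) * (H * m * c)"
        using dist3 B1(1) by (intro mult_mono) auto
      also have "\<dots> \<le> \<epsilon> / 2" using c(4) by (simp add: algebra_simps)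
      finally have \<rho>: "\<bar>\<rho> x - \<rho> z\<bar> \<le> \<bar>\<rho> z\<bar> / 2" using \<epsilon>z by simp
      have "norm (v x - v z) \<le> A * t" if "x \<in> D"
      proof -
        have "norm (v x - v z) \<le> 2"
          using norm_triangle_ineq4[of "v x" "v z"] orthonormal_frame[OF that] orthonormal_frame[OF z] by simp
        also have "\<dots> = (2 / sqrt \<epsilon>) * sqrt \<epsilon>" using \<epsilon>(1) by simp
        also have "\<dots> \<le> A * t"
          using \<epsilon>(1) \<epsilon>z A by (intro mult_mono) (auto simp: A_def t_def)
        finally show ?thesis .
      qed
      then show ?thesis using \<rho> by simp
    qed
    have "\<rho> z < 0" using z D_iff by simp
    then have "x \<in> D" "\<bar>\<rho> x\<bar> \<le> 2 * \<bar>\<rho> z\<bar>" "\<bar>\<rho> z\<bar> \<le> 2 * \<bar>\<rho> x\<bar>"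
      using res D_iff[of x] by linarith+
    then show ?thesis using res by (simp add: t_def)
  qed
  show thesis
    by (rule that[OF c0 c(1) A less_imp_le[OF m0] m main])
qed

lemma slowly_varying_frames: obtains c C where "slowly_varying D L Li c C"
proof -
  obtain c A m where c: "0 < c" and A: "0 \<le> A" and m: "0 \<le> m" "\<And>z. z \<in> D \<Longrightarrow> sqrt \<bar>\<rho> z\<bar> \<le> m"
    and near: "\<And>z x. z \<in> D \<Longrightarrow> norm (Li z (x - z)) < c \<Longrightarrow>
      x \<in> D \<and> \<bar>\<rho> x\<bar> \<le> 2 * \<bar>\<rho> z\<bar> \<and> \<bar>\<rho> z\<bar> \<le> 2 * \<bar>\<rho> x\<bar> \<and> norm (v x - v z) \<le> A * sqrt \<bar>\<rho> z\<bar>"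
    using nearby_points by metis
  \<comment> \<open>\<open>2 * A\<close> instead of \<open>A\<close>: with the roles of
    \<open>x\<close> and \<open>z\<close> exchanged, the bound on \<open>v x - v z\<close> has to be
    expressed by \<open>sqrt \<bar>\<rho> x\<bar>\<close>.\<close>
  define C where "C = 4 + 2 * (2 * A) + 2 * m"
  have bound: "norm (Li z (L x w)) \<le> C * norm w \<and> norm (Li x (L z w)) \<le> C * norm w"
    if z: "z \<in> D" and "norm (Li z (x - z)) < c" for z x w
  proof -
    note n = near[OF that]
    have "sqrt \<bar>\<rho> z\<bar> \<le> sqrt (2\<^sup>2 * \<bar>\<rho> x\<bar>)" using n by simp
    then have "sqrt \<bar>\<rho> z\<bar> \<le> 2 * sqrt \<bar>\<rho> x\<bar>" by (simp add: real_sqrt_mult)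
    from mult_left_mono[OF this A] have "A * sqrt \<bar>\<rho> z\<bar> \<le> 2 * A * sqrt \<bar>\<rho> x\<bar>"
      by (simp add: mult_ac)
    moreover have "norm (v x - v z) \<le> 2 * A * sqrt \<bar>\<rho> z\<bar>"
      using A n by (intro order_trans[OF _ mult_right_mono[of A "2 * A"]]) auto
    ultimately show ?thesis
      using n transition_bound[OF _ z _ m(2)[OF z], of x "2 * A" w] transition_bound[OF z _ _ m(2), of x "2 * A" w] A
      by (simp add: C_def norm_minus_commute)
  qed
  have "1 \<le> C" using A m(1) by (simp add: C_def)
  then have "slowly_varying D L Li c C"
    by (intro slowly_varying.intro linear_L linear_Li Li_L L_Li c)
      (assumption | (rule near[THEN conjunct1] bound[THEN conjunct1] bound[THEN conjunct2], assumption+))+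
  then show thesis by (rule that)
qed

end

section \<open>Moving-frame derivatives\<close>

text \<open>The derivative of \<open>f (x + \<lambda> *s u)\<close> with respect to the conjugate of
  \<open>\<lambda>\<close> at 0. It is conjugate-linear in \<open>u\<close>, so a merely continuous
  moving direction enters only through continuous coefficients.\<close>

definition dbar :: "complex^2 \<Rightarrow> (complex^2 \<Rightarrow> complex) \<Rightarrow> complex^2 \<Rightarrow> complex" where
  "dbar u f x = cnj (u $ 1) * wirt \<i> 1 f x + cnj (u $ 2) * wirt \<i> 2 f x"

lemma smooth_on_cmult:
  fixes f :: "'a::real_normed_vector \<Rightarrow> complex"
  shows "smooth_on f S \<Longrightarrow> open S \<Longrightarrow> smooth_on (\<lambda>x. c * f x) S"
  by (rule smooth_on_bounded_linear[OF bounded_linear_mult_right])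

lemma smooth_on_dbar: "smooth_on f S \<Longrightarrow> open S \<Longrightarrow> smooth_on (dbar u f) S"
  unfolding dbar_def[abs_def] by (intro smooth_on_add smooth_on_cmult smooth_on_wirt)

lemma smooth_on_dbar_funpow: "smooth_on f S \<Longrightarrow> open S \<Longrightarrow> smooth_on ((dbar u ^^ n) f) S"
  by (induction n) (auto intro: smooth_on_dbar)

lemma dbar_cong_open:
  assumes "open S" "x \<in> S" "\<And>y. y \<in> S \<Longrightarrow> f y = g y"
  shows "dbar u f x = dbar u g x"
  using wirt_cong_open[OF assms] by (simp add: dbar_def)

lemma dbar_funpow_cong_open:
  assumes "open S" "x \<in> S" "\<And>y. y \<in> S \<Longrightarrow> f y = g y"
  shows "(dbar u ^^ n) f x = (dbar u ^^ n) g x"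
  using assms(2)
proof (induction n arbitrary: x)
  case (Suc n)
  then show ?case using dbar_cong_open[OF assms(1) Suc.prems, of "(dbar u ^^ n) f"] by simp
qed (use assms(3) in simp)

lemma dbar_linear:
  assumes "f differentiable (at x)" "g differentiable (at x)"
  shows "dbar u (\<lambda>x. a * f x + b * g x) x = a * dbar u f x + b * dbar u g x"
proof -
  have "dir_deriv h (\<lambda>x. a * f x + b * g x) x = a * dir_deriv h f x + b * dir_deriv h g x" for h
    by (rule dir_derivI)
      (intro has_derivative_add has_derivative_mult_right has_derivative_dir_deriv assms)
  then show ?thesis
    by (simp add: dbar_def wirt_def algebra_simps add_divide_distrib)
qed

lemma dbar_funpow_linear:
  assumes "smooth_on f S" "smooth_on g S" "open S" "x \<in> S"
  shows "(dbar u ^^ n) (\<lambda>x. a * f x + b * g x) x = a * (dbar u ^^ n) f x + b * (dbar u ^^ n) g x"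
  using assms(4)
proof (induction n arbitrary: x)
  case (Suc n)
  have "(dbar u ^^ Suc n) (\<lambda>x. a * f x + b * g x) x = dbar u (\<lambda>x. a * (dbar u ^^ n) f x + b * (dbar u ^^ n) g x) x"
    using dbar_cong_open[OF assms(3) Suc.prems, of "(dbar u ^^ n) (\<lambda>x. a * f x + b * g x)"] Suc.IH by simp
  also have "\<dots> = a * dbar u ((dbar u ^^ n) f) x + b * dbar u ((dbar u ^^ n) g) x"
    by (rule dbar_linear[OF smooth_onD(2)[OF smooth_on_dbar_funpow[OF assms(1,3)] Suc.prems]
          smooth_onD(2)[OF smooth_on_dbar_funpow[OF assms(2,3)] Suc.prems]])
  finally show ?case by simp
qed simp

lemma open_frame_vimage: "open S \<Longrightarrow> open {w. z + frame_map e1 e2 w \<in> S}"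
proof -
  assume "open S"
  moreover have "continuous_on UNIV (\<lambda>w. z + frame_map e1 e2 w)"
    using linear_continuous_on linear_frame_map linear_conv_bounded_linear
    by (intro continuous_intros) blast
  ultimately show ?thesis
    using open_vimage by (fastforce simp: vimage_def)
qed

lemma wirt_frame:
  assumes "f differentiable (at (z + frame_map e1 e2 w))"
  shows "wirt \<i> j (\<lambda>w. f (z + frame_map e1 e2 w)) w = dbar (if j = 1 then e1 else e2) f (z + frame_map e1 e2 w)"
proof -
  let ?x = "z + frame_map e1 e2 w"
  have "bounded_linear (frame_map e1 e2)"
    using linear_frame_map linear_conv_bounded_linear by blast
  then have "((\<lambda>w. z + frame_map e1 e2 w) has_derivative frame_map e1 e2) (at w)"
    by (auto intro!: derivative_eq_intros dest: bounded_linear_imp_has_derivative)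
  from diff_chain_at[OF this has_derivative_dir_deriv[OF assms]]
  have "((\<lambda>w. f (z + frame_map e1 e2 w)) has_derivative (\<lambda>u. dir_deriv (frame_map e1 e2 u) f ?x)) (at w)"
    by (simp add: o_def)
  note d = dir_derivI[OF this]
  have ax: "frame_map e1 e2 (axis j a) = a *s (if j = 1 then e1 else e2)" for a
    using exhaust_2[of j] by (auto simp: frame_map_def axis_def)
  show ?thesis
    unfolding wirt_def[of _ _ "\<lambda>w. f (z + frame_map e1 e2 w)"] d ax dir_deriv_eq_wirt[OF assms] dbar_def
    by (simp add: algebra_simps)
qed

lemma wirt_funpow_frame:
  assumes "smooth_on f S" "open S" "z + frame_map e1 e2 w \<in> S"
    "\<And>w. z + frame_map e1 e2 w \<in> S \<Longrightarrow> H w = f (z + frame_map e1 e2 w)"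
  shows "(wirt \<i> j ^^ n) H w = (dbar (if j = 1 then e1 else e2) ^^ n) f (z + frame_map e1 e2 w)"
  using assms(3)
proof (induction n arbitrary: w)
  case (Suc n)
  let ?u = "if j = 1 then e1 else e2"
  have "(wirt \<i> j ^^ Suc n) H w = wirt \<i> j (\<lambda>w. (dbar ?u ^^ n) f (z + frame_map e1 e2 w)) w"
    using wirt_cong_open[OF open_frame_vimage[OF assms(2)], of w z e1 e2 "(wirt \<i> j ^^ n) H"] Suc by simp
  also have "\<dots> = dbar ?u ((dbar ?u ^^ n) f) (z + frame_map e1 e2 w)"
    by (rule wirt_frame[OF smooth_onD(2)[OF smooth_on_dbar_funpow[OF assms(1,2)] Suc.prems]])
  finally show ?case by simp
qed (use assms(4) in simp)

text \<open>In \<open>koranyi_deriv\<close> the frame is frozen at the base point, so the operators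
  on the right have constant coefficients: \<open>\<eta> z\<close> and \<open>v z\<close> are not
  differentiated.\<close>

lemma koranyi_deriv_eq_dbar:
  assumes "smooth_on h S" "open S" "z \<in> S"
  shows "koranyi_deriv \<eta> v 0 0 a b h z 0 = (dbar (\<eta> z) ^^ a) ((dbar (v z) ^^ b) h) z"
proof -
  let ?P = "\<lambda>w. z + frame_map (\<eta> z) (v z) w"
  have 0: "?P 0 = z" by (simp add: frame_map_def)
  have "(wirt \<i> 2 ^^ b) (\<lambda>w. h (?P w)) w = (dbar (v z) ^^ b) h (?P w)" if "?P w \<in> S" for w
    using wirt_funpow_frame[OF assms(1,2) that, where H = "\<lambda>w. h (?P w)" and j = 2] by simp
  from wirt_funpow_frame[OF smooth_on_dbar_funpow[OF assms(1,2)] assms(2) _ this, where w = 0 and j = 1] assms(3)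
  show ?thesis
    by (simp add: koranyi_deriv_eq_wirt_multi koranyi_point_eq wirt_multi_def 0)
qed

text \<open>The direction \<open>e z\<close> is constant while differentiating. Expanding the
  innermost operator leaves the same expression for \<open>wirt \<i> 1 f\<close> and
  \<open>wirt \<i> 2 f\<close>, with coefficients continuous in \<open>z\<close>.\<close>

lemma continuous_dbar_funpow:
  assumes "continuous_on T e" "T \<subseteq> S" "open S" "smooth_on f S"
  shows "continuous_on T (\<lambda>z. (dbar (e z) ^^ n) f z)"
  using assms(4)
proof (induction n arbitrary: f)
  case 0
  then show ?case using smooth_onD(1)[OF 0] assms(2) continuous_on_subset by simp blast
next
  case (Suc n)
  have "continuous_on T (\<lambda>z. cnj (e z $ 1) * (dbar (e z) ^^ n) (wirt \<i> 1 f) z + cnj (e z $ 2) * (dbar (e z) ^^ n) (wirt \<i> 2 f) z)"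
    by (intro continuous_intros Suc.IH smooth_on_wirt Suc.prems assms)
  then show ?case
  proof (rule continuous_on_eq)
    fix z assume "z \<in> T"
    then have z: "z \<in> S" using assms(2) by blast
    have "(dbar (e z) ^^ Suc n) f z = (dbar (e z) ^^ n) (\<lambda>x. cnj (e z $ 1) * wirt \<i> 1 f x + cnj (e z $ 2) * wirt \<i> 2 f x) z"
    proof -
      have d: "dbar (e z) f = (\<lambda>x. cnj (e z $ 1) * wirt \<i> 1 f x + cnj (e z $ 2) * wirt \<i> 2 f x)"
        by (simp add: fun_eq_iff dbar_def)
      show ?thesis by (simp only: funpow_Suc_right o_apply d)
    qed
    then show "cnj (e z $ 1) * (dbar (e z) ^^ n) (wirt \<i> 1 f) z + cnj (e z $ 2) * (dbar (e z) ^^ n) (wirt \<i> 2 f) z = (dbar (e z) ^^ Suc n) f z"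
      using dbar_funpow_linear[OF smooth_on_wirt smooth_on_wirt, OF Suc.prems assms(3) Suc.prems assms(3) assms(3) z] by simp
  qed
qed

text \<open>Not an instance of the one-direction case, because the function
  \<open>(dbar (e' z) ^^ k) f\<close> itself depends on \<open>z\<close>. The inner block is
  expanded until only the outer one is left.\<close>

lemma continuous_dbar_funpow2:
  assumes "continuous_on T e" "continuous_on T e'" "T \<subseteq> S" "open S" "smooth_on f S"
  shows "continuous_on T (\<lambda>z. (dbar (e z) ^^ n) ((dbar (e' z) ^^ k) f) z)"
  using assms(5)
proof (induction k arbitrary: f)
  case 0
  then show ?case using continuous_dbar_funpow[OF assms(1,3,4)] by simp
next
  case (Suc k)
  let ?g = "\<lambda>z j. (dbar (e z) ^^ n) ((dbar (e' z) ^^ k) (wirt \<i> j f)) z"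
  have "continuous_on T (\<lambda>z. cnj (e' z $ 1) * ?g z 1 + cnj (e' z $ 2) * ?g z 2)"
    by (intro continuous_intros Suc.IH smooth_on_wirt Suc.prems assms)
  then show ?case
  proof (rule continuous_on_eq)
    fix z assume "z \<in> T"
    then have z: "z \<in> S" using assms(3) by blast
    note sw = smooth_on_wirt[OF Suc.prems assms(4)]
    note sd = smooth_on_dbar_funpow[OF sw assms(4)]
    have "(dbar (e' z) ^^ Suc k) f x = cnj (e' z $ 1) * (dbar (e' z) ^^ k) (wirt \<i> 1 f) x + cnj (e' z $ 2) * (dbar (e' z) ^^ k) (wirt \<i> 2 f) x"
      if "x \<in> S" for x
    proof -
      have "(dbar (e' z) ^^ Suc k) f x = (dbar (e' z) ^^ k) (\<lambda>x. cnj (e' z $ 1) * wirt \<i> 1 f x + cnj (e' z $ 2) * wirt \<i> 2 f x) x"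
      proof -
        have d: "dbar (e' z) f = (\<lambda>x. cnj (e' z $ 1) * wirt \<i> 1 f x + cnj (e' z $ 2) * wirt \<i> 2 f x)"
          by (simp add: fun_eq_iff dbar_def)
        show ?thesis by (simp only: funpow_Suc_right o_apply d)
      qed
      then show ?thesis using dbar_funpow_linear[OF sw sw assms(4) that] by simp
    qed
    note expand = this
    have "(dbar (e z) ^^ n) ((dbar (e' z) ^^ Suc k) f) z =
        (dbar (e z) ^^ n) (\<lambda>x. cnj (e' z $ 1) * (dbar (e' z) ^^ k) (wirt \<i> 1 f) x + cnj (e' z $ 2) * (dbar (e' z) ^^ k) (wirt \<i> 2 f) x) z"
      by (rule dbar_funpow_cong_open[OF assms(4) z expand])
    then show "cnj (e' z $ 1) * ?g z 1 + cnj (e' z $ 2) * ?g z 2 = (dbar (e z) ^^ n) ((dbar (e' z) ^^ Suc k) f) z"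
      using dbar_funpow_linear[OF sd sd assms(4) z] by simp
  qed
qed

section \<open>Boundary behaviour\<close>

lemma Ck_bdd_compact:
  fixes f :: "'a::real_normed_vector \<Rightarrow> 'b::real_normed_vector"
  assumes "smooth_on f W" "compact K" "K \<subseteq> W" "\<And>i. S i \<subseteq> K" "\<And>i x. x \<in> S i \<Longrightarrow> 0 \<le> \<omega> x \<and> \<omega> x \<le> M"
  shows "Ck_bdd \<omega> S k m (\<lambda>i. f)"
  using assms(1)
proof (induction k arbitrary: f m)
  case 0
  have "unif_Ck S 0 (\<lambda>i. f)"
    by (rule unif_Ck_compact[OF 0 assms(2,3)]) (rule assms(4))
  then obtain C where C: "0 < C" "\<And>i x. x \<in> S i \<Longrightarrow> norm (f x) \<le> C"
    using unif_Ck_bound[of S 0 "\<lambda>i. f"] by blast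
  have "norm (f x) * \<omega> x ^ m \<le> C * M ^ m" if "x \<in> S i" for i x
    using C(1) C(2)[OF that] assms(5)[OF that] by (intro mult_mono power_mono) auto
  then show ?case by auto
next
  case (Suc k)
  have "f differentiable (at x)" if "x \<in> S i" for i x
    using smooth_onD(2)[OF Suc.prems] that assms(3,4) by blast
  then show ?case
    using Suc.IH[OF Suc.prems, THEN Ck_bdd_0] Suc.IH[OF smooth_onD(3)[OF Suc.prems]]
    by (simp add: Ck_bdd_Suc)
qed

lemma foldr_dir_deriv_cong_open:
  assumes "open S" "x \<in> S" "\<And>y. y \<in> S \<Longrightarrow> f y = g y"
  shows "foldr dir_deriv us f x = foldr dir_deriv us g x"
  using assms(2)
proof (induction us arbitrary: x)
  case (Cons u us)
  then show ?case using dir_deriv_cong_open[OF assms(1) Cons.prems, of "foldr dir_deriv us f"] by simp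
qed (use assms(3) in simp)

lemma powr_half_integer:
  assumes "0 < s"
  shows "s powr (real n + real m / 2) = s ^ n * sqrt s ^ m"
proof -
  have "sqrt s ^ m = (s powr (1 / 2)) powr real m"
    using assms by (simp add: powr_half_sqrt powr_realpow)
  also have "\<dots> = s powr (real m / 2)" by (simp add: powr_powr)
  finally show ?thesis using assms by (simp add: powr_add powr_realpow)
qed

context koranyi_domain
begin

lemma rho_frontier: "z \<in> frontier D \<Longrightarrow> \<rho> z = 0"
  using rho_closure_le[of z] D_iff[of z] open_D by (auto simp: frontier_def interior_open)

text \<open>In the chart a Euclidean vector has length of order at most
  \<open>1 / \<bar>\<rho> z\<bar>\<close>, the normal direction being the worst. Hence each
  Euclidean derivative costs a full power of \<open>\<bar>\<rho>\<bar>\<close>.\<close>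

lemma Li_norm_le:
  assumes z: "z \<in> D" and m: "sqrt \<bar>\<rho> z\<bar> \<le> m"
  shows "\<bar>\<rho> z\<bar> * norm (Li z u) \<le> (m + 1) * norm u"
proof -
  define t where "t = sqrt \<bar>\<rho> z\<bar>"
  have t: "0 < t" "\<bar>\<rho> z\<bar> = t * t" "t \<le> m" using z D_iff[of z] m by (simp_all add: t_def)
  have h: "norm (herm u (\<eta> z)) \<le> norm u" "norm (herm u (v z)) \<le> norm u"
    using norm_herm_le[of u "\<eta> z"] norm_herm_le[of u "v z"] orthonormal_frame[OF z] by simp_all
  have "norm (Li z u) \<le> norm (herm u (\<eta> z)) / (t * t) + norm (herm u (v z)) / t"
    using norm_le_components[of "Li z u"] t(1)
    by (simp add: Li_def t(2) divide_inverse mult.commute flip: t_def)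
  also have "\<dots> \<le> norm u / (t * t) + norm u / t"
    using h t(1) by (intro add_mono divide_right_mono) auto
  finally have "\<bar>\<rho> z\<bar> * norm (Li z u) \<le> (t * t) * (norm u / (t * t) + norm u / t)"
    unfolding t(2) using t(1) by (intro mult_left_mono) auto
  also have "\<dots> = (t + 1) * norm u" using t(1) by (simp add: field_simps)
  also have "\<dots> \<le> (m + 1) * norm u" using t(3) by (intro mult_right_mono) auto
  finally show ?thesis .
qed

text \<open>Empty for centres outside \<open>D\<close>, so that families can be indexed by all
  points of the space.\<close>

definition chart :: "real \<Rightarrow> complex^2 \<Rightarrow> (complex^2) set" where
  "chart \<delta> \<zeta> = {w. \<zeta> \<in> D \<and> norm w < \<delta>}"

lemma open_chart: "open (chart \<delta> \<zeta>)"
proof -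
  have "chart \<delta> \<zeta> = (if \<zeta> \<in> D then ball 0 \<delta> else {})"
    by (auto simp: chart_def)
  then show ?thesis by simp
qed

lemma smooth_on_from_charts:
  assumes "0 < \<delta>" "\<And>k. unif_Ck (chart \<delta>) k (\<lambda>\<zeta> w. h (\<zeta> + L \<zeta> w))"
  shows "smooth_on (h :: complex^2 \<Rightarrow> complex) D"
proof (rule smooth_on_cover)
  fix \<zeta> assume \<zeta>: "\<zeta> \<in> D"
  have "smooth_on (\<lambda>w. h (\<zeta> + L \<zeta> w)) (chart \<delta> \<zeta>)"
    using Ck_bdd_imp_smooth_on[of "\<lambda>_. 1" "chart \<delta>" 0 "\<lambda>\<zeta> w. h (\<zeta> + L \<zeta> w)" \<zeta>] assms(2) by blast
  from smooth_on_affine[OF this linear_Li open_chart, of "- Li \<zeta> \<zeta>" \<zeta>]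
  have "smooth_on h {x. - Li \<zeta> \<zeta> + Li \<zeta> x \<in> chart \<delta> \<zeta>}"
    using \<zeta> by (simp add: L_Li flip: linear_diff[OF linear_Li])
  moreover have "open {x. - Li \<zeta> \<zeta> + Li \<zeta> x \<in> chart \<delta> \<zeta>}"
  proof -
    have "continuous_on UNIV (\<lambda>x. - Li \<zeta> \<zeta> + Li \<zeta> x)"
      using linear_continuous_on linear_Li linear_conv_bounded_linear by (intro continuous_intros) blast
    from open_vimage[OF open_chart this] show ?thesis by (simp add: vimage_def)
  qed
  moreover have "- Li \<zeta> \<zeta> + Li \<zeta> \<zeta> \<in> chart \<delta> \<zeta>"
    using \<zeta> assms(1) by (simp add: chart_def)
  ultimately show "\<exists>T. open T \<and> \<zeta> \<in> T \<and> smooth_on h T" by blast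
qed

text \<open>The weight is frozen at the centre, hence constant in \<open>w\<close>. A Euclidean
  derivative along \<open>u\<close> is the chart derivative along \<open>Li \<zeta> u\<close>, and
  the additional factor \<open>\<bar>\<rho> \<zeta>\<bar>\<close> absorbs the length of this vector.
  The bound at order 0 is read off at \<open>w = 0\<close>.\<close>

lemma weighted_bounds_from_charts:
  fixes h :: "complex^2 \<Rightarrow> complex"
  assumes "0 < \<delta>" "\<And>\<zeta> w. w \<in> chart \<delta> \<zeta> \<Longrightarrow> \<zeta> + L \<zeta> w \<in> D"
    "smooth_on h D" "unif_Ck (chart \<delta>) k (\<lambda>\<zeta> w. \<bar>\<rho> \<zeta>\<bar> ^ n *\<^sub>R h (\<zeta> + L \<zeta> w))"
  shows "Ck_bdd (\<lambda>x. \<bar>\<rho> x\<bar>) (\<lambda>_::unit. D) k n (\<lambda>_. h)"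
  using assms(3,4)
proof (induction k arbitrary: n h)
  case 0
  obtain B where B: "\<And>\<zeta> w. w \<in> chart \<delta> \<zeta> \<Longrightarrow> norm (\<bar>\<rho> \<zeta>\<bar> ^ n *\<^sub>R h (\<zeta> + L \<zeta> w)) \<le> B"
    using unif_CkE[OF 0(2)] by blast
  have "norm (h \<zeta>) * \<bar>\<rho> \<zeta>\<bar> ^ n \<le> B" if "\<zeta> \<in> D" for \<zeta>
    using B[of 0 \<zeta>] that assms(1) linear_0[OF linear_L] by (simp add: chart_def mult.commute)
  then show ?case by auto
next
  case (Suc k)
  obtain m where m: "\<And>z. z \<in> D \<Longrightarrow> sqrt \<bar>\<rho> z\<bar> \<le> m"
    using nearby_points by metis
  define K where "K \<zeta> w = \<bar>\<rho> \<zeta>\<bar> ^ n *\<^sub>R h (\<zeta> + L \<zeta> w)" for \<zeta> w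
  have K: "unif_Ck (chart \<delta>) (Suc k) K"
    using Suc.prems(2) by (simp add: K_def[abs_def])
  have dK: "(K \<zeta> has_derivative (\<lambda>u. \<bar>\<rho> \<zeta>\<bar> ^ n *\<^sub>R dir_deriv (L \<zeta> u) h (\<zeta> + L \<zeta> w))) (at w)"
    if "w \<in> chart \<delta> \<zeta>" for \<zeta> w
  proof -
    have dh: "h differentiable (at (\<zeta> + L \<zeta> w))"
      by (rule smooth_onD(2)[OF Suc.prems(1) assms(2)[OF that]])
    have "bounded_linear (L \<zeta>)"
      using linear_L linear_conv_bounded_linear by blast
    then have "((\<lambda>w. \<zeta> + L \<zeta> w) has_derivative L \<zeta>) (at w)"
      by (auto intro!: derivative_eq_intros dest: bounded_linear_imp_has_derivative)
    from diff_chain_at[OF this has_derivative_dir_deriv[OF dh]]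
    show ?thesis unfolding K_def[abs_def] by (intro has_derivative_scaleR_right) (simp add: o_def)
  qed
  have "Ck_bdd (\<lambda>x. \<bar>\<rho> x\<bar>) (\<lambda>_::unit. D) k (Suc n) (\<lambda>_. dir_deriv u h)" for u
  proof (rule Suc.IH[OF smooth_onD(3)[OF Suc.prems(1)] Ck_bdd_cong[OF unif_Ck_sum[OF finite_Basis] open_chart]])
    fix b :: "complex^2" assume b: "b \<in> Basis"
    show "unif_Ck (chart \<delta>) k (\<lambda>\<zeta> w. (\<bar>\<rho> \<zeta>\<bar> * (Li \<zeta> u \<bullet> b)) *\<^sub>R dir_deriv b (K \<zeta>) w)"
    proof (rule unif_Ck_scaleR[OF _ _ open_chart])
      show "unif_Ck (chart \<delta>) k (\<lambda>\<zeta>. dir_deriv b (K \<zeta>))"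
        using K by (simp add: unif_Ck_Suc)
      show "\<bar>\<bar>\<rho> \<zeta>\<bar> * (Li \<zeta> u \<bullet> b)\<bar> \<le> (m + 1) * norm u" if "chart \<delta> \<zeta> \<noteq> {}" for \<zeta>
      proof -
        have \<zeta>: "\<zeta> \<in> D" using that by (auto simp: chart_def)
        have "\<bar>\<bar>\<rho> \<zeta>\<bar> * (Li \<zeta> u \<bullet> b)\<bar> \<le> \<bar>\<rho> \<zeta>\<bar> * norm (Li \<zeta> u)"
          unfolding abs_mult using Basis_le_norm[OF b] by (intro mult_mono) auto
        then show ?thesis using Li_norm_le[OF \<zeta> m[OF \<zeta>], of u] by linarith
      qed
    qed
  next
    fix \<zeta> w assume w: "w \<in> chart \<delta> \<zeta>"
    then have \<zeta>: "\<zeta> \<in> D" by (simp add: chart_def)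
    have "K \<zeta> differentiable (at w)" using dK[OF w] by (auto simp: differentiable_def)
    from dir_deriv_basis[OF this, of "Li \<zeta> u"] dir_derivI[OF dK[OF w], of "Li \<zeta> u"]
    show "(\<Sum>b\<in>Basis. (\<bar>\<rho> \<zeta>\<bar> * (Li \<zeta> u \<bullet> b)) *\<^sub>R dir_deriv b (K \<zeta>) w) =
        \<bar>\<rho> \<zeta>\<bar> ^ Suc n *\<^sub>R dir_deriv u h (\<zeta> + L \<zeta> w)"
      by (simp add: L_Li[OF \<zeta>] flip: scaleR_scaleR scaleR_sum_right)
  qed (rule open_chart)
  moreover have "Ck_bdd (\<lambda>x. \<bar>\<rho> x\<bar>) (\<lambda>_::unit. D) 0 n (\<lambda>_. h)"
    using Suc.IH[OF Suc.prems(1) Ck_bdd_SucD[OF Suc.prems(2)]] by (rule Ck_bdd_0)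
  ultimately show ?case
    using smooth_onD(2)[OF Suc.prems(1)] by (simp add: Ck_bdd_Suc)
qed

text \<open>Each derivative of \<open>\<bar>\<rho>\<bar> ^ N *\<^sub>R h\<close> lowers the exponent by one and raises the order of
  growth of \<open>h\<close> by one.\<close>

lemma tendsto_0_at_frontier:
  fixes h :: "complex^2 \<Rightarrow> complex"
  assumes "\<And>k. Ck_bdd (\<lambda>x. \<bar>\<rho> x\<bar>) (\<lambda>_::unit. D) k n (\<lambda>_. h)" "n + 2 * length us < N" "p \<in> frontier D"
  shows "(foldr dir_deriv us (\<lambda>z. \<bar>\<rho> z\<bar> ^ N *\<^sub>R h z) \<longlongrightarrow> 0) (at p within D)"
  using assms(1,2)
\<comment> \<open>\<open>foldr\<close> applies the last direction first, so induction from the right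
  end peels off the innermost derivative.\<close>
proof (induction us arbitrary: h n N rule: rev_induct)
  case Nil
  obtain B where B: "0 < B" "\<And>z. z \<in> D \<Longrightarrow> norm (h z) * \<bar>\<rho> z\<bar> ^ n \<le> B"
    using Ck_bddE[OF Nil(1)[of 0]] by metis
  have "isCont \<rho> p" using continuous_rho[of UNIV] by (simp add: continuous_on_eq_continuous_at)
  then have "(\<rho> \<longlongrightarrow> 0) (at p within D)"
    using rho_frontier[OF assms(3)] by (metis continuous_at_imp_continuous_within continuous_within)
  then have "((\<lambda>z. B * \<bar>\<rho> z\<bar> ^ (N - n)) \<longlongrightarrow> B * \<bar>0\<bar> ^ (N - n)) (at p within D)"
    by (intro tendsto_intros)
  then have lim: "((\<lambda>z. B * \<bar>\<rho> z\<bar> ^ (N - n)) \<longlongrightarrow> 0) (at p within D)"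
    using Nil(2) by (simp add: power_0_left)
  have le: "norm (\<bar>\<rho> z\<bar> ^ N *\<^sub>R h z) \<le> B * \<bar>\<rho> z\<bar> ^ (N - n)" if "z \<in> D" for z
  proof -
    have "norm (\<bar>\<rho> z\<bar> ^ N *\<^sub>R h z) = (norm (h z) * \<bar>\<rho> z\<bar> ^ n) * \<bar>\<rho> z\<bar> ^ (N - n)"
    proof -
      have "\<bar>\<rho> z\<bar> ^ N = \<bar>\<rho> z\<bar> ^ n * \<bar>\<rho> z\<bar> ^ (N - n)"
        using Nil(2) by (simp flip: power_add)
      then show ?thesis by simp
    qed
    also have "\<dots> \<le> B * \<bar>\<rho> z\<bar> ^ (N - n)"
      by (intro mult_right_mono B(2)[OF that]) simp
    finally show ?thesis .
  qed
  show ?case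
    unfolding foldr.simps id_apply
    by (rule Lim_null_comparison[OF _ lim]) (use le in \<open>auto simp: eventually_at_filter\<close>)
next
  case (snoc u us)
  note h = snoc.prems(1)
  obtain M where M: "0 < M" "\<And>z. z \<in> D \<Longrightarrow> \<bar>\<rho> z\<bar> \<le> M" using rho_bounded by blast
  obtain N' where N: "N = Suc N'" using snoc.prems(2) by (cases N) auto
  \<comment> \<open>The derivative of \<open>(- \<rho>) ^ N *\<^sub>R h\<close> along
    \<open>u\<close>, with the power \<open>N'\<close> pulled out. The inequality for
    \<open>N\<close> is preserved: \<open>n\<close> grows by one, the length drops by one, and
    \<open>N\<close> drops by one.\<close>
  define h' where "h' z = of_real (- real N * dir_deriv u \<rho> z) * h z + of_real (- 1 * \<rho> z) * dir_deriv u h z" for z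
  have smooth_bdd: "Ck_bdd (\<lambda>x. \<bar>\<rho> x\<bar>) (\<lambda>_::unit. D) k m (\<lambda>_ z. complex_of_real (c * f z))"
    if "smooth_on f UNIV" for f k m c
    using closure_subset M(2)
    by (intro Ck_bdd_compact[OF smooth_on_bounded_linear[OF bounded_linear_of_real
          smooth_on_bounded_linear[OF bounded_linear_mult_right that]] compact_closure_D]) auto
  have "Ck_bdd (\<lambda>x. \<bar>\<rho> x\<bar>) (\<lambda>_::unit. D) k (Suc n) (\<lambda>_. h')" for k
  proof -
    \<comment> \<open>The exponent 1 given to the bounded coefficient brings this term to the same
      exponent \<open>Suc n\<close> as the other one.\<close>
    have "Ck_bdd (\<lambda>x. \<bar>\<rho> x\<bar>) (\<lambda>_::unit. D) k (1 + n) (\<lambda>_ z. of_real (- real N * dir_deriv u \<rho> z) * h z)"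
      by (intro Ck_bdd_mult smooth_bdd smooth_onD(3) smooth_rho h open_D) simp
    moreover have "Ck_bdd (\<lambda>x. \<bar>\<rho> x\<bar>) (\<lambda>_::unit. D) k (0 + Suc n) (\<lambda>_ z. of_real (- 1 * \<rho> z) * dir_deriv u h z)"
      using h[of "Suc k"] by (intro Ck_bdd_mult smooth_bdd smooth_rho open_D) (simp_all add: Ck_bdd_Suc)
    ultimately show ?thesis
      unfolding h'_def[abs_def] plus_1_eq_Suc add_0 by (rule Ck_bdd_add[OF _ _ open_D abs_ge_zero])
  qed
  from snoc.IH[OF this, of N'] snoc.prems(2)
  have lim: "(foldr dir_deriv us (\<lambda>z. \<bar>\<rho> z\<bar> ^ N' *\<^sub>R h' z) \<longlongrightarrow> 0) (at p within D)"
    by (simp add: N)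
  have "dir_deriv u (\<lambda>z. \<bar>\<rho> z\<bar> ^ N *\<^sub>R h z) z = \<bar>\<rho> z\<bar> ^ N' *\<^sub>R h' z" if z: "z \<in> D" for z
  proof -
    have "h differentiable (at z)" using h[of "Suc 0"] z by (simp add: Ck_bdd_Suc)
    note d = has_derivative_dir_deriv[OF this] has_derivative_dir_deriv[OF rho_differentiable[of z]]
    \<comment> \<open>On \<open>D\<close> the absolute value is \<open>- \<rho>\<close>, which is
      smooth.\<close>
    have "((\<lambda>z. (- \<rho> z) ^ N *\<^sub>R h z) has_derivative (\<lambda>u. (- \<rho> z) ^ N' *\<^sub>R
        (of_real (- real N * dir_deriv u \<rho> z) * h z + of_real (- \<rho> z) * dir_deriv u h z))) (at z)"
      by (rule derivative_eq_intros d refl)+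
        (simp add: fun_eq_iff N scaleR_conv_of_real algebra_simps)
    from dir_derivI[OF this, of u]
    have "dir_deriv u (\<lambda>z. (- \<rho> z) ^ N *\<^sub>R h z) z = \<bar>\<rho> z\<bar> ^ N' *\<^sub>R h' z"
      using z D_iff by (simp add: h'_def)
    moreover have "dir_deriv u (\<lambda>z. \<bar>\<rho> z\<bar> ^ N *\<^sub>R h z) z = dir_deriv u (\<lambda>z. (- \<rho> z) ^ N *\<^sub>R h z) z"
      by (rule dir_deriv_cong_open[OF open_D z]) (use D_iff in auto)
    ultimately show ?thesis by simp
  qed
  from foldr_dir_deriv_cong_open[OF open_D _ this]
  have "foldr dir_deriv (us @ [u]) (\<lambda>z. \<bar>\<rho> z\<bar> ^ N *\<^sub>R h z) z = foldr dir_deriv us (\<lambda>z. \<bar>\<rho> z\<bar> ^ N' *\<^sub>R h' z) z"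
    if "z \<in> D" for z
    using that by simp
  then show ?case
    by (intro Lim_transform_eventually[OF lim]) (auto simp: eventually_at_filter)
qed

lemma continuous_eta: "continuous_on U \<eta>"
proof -
  have g: "continuous_on U (grad \<rho>)"
    unfolding grad_def[abs_def]
    by (intro continuous_intros continuous_on_subset[OF smooth_onD(1)[OF smooth_onD(3)[OF smooth_rho]]]) auto
  have "continuous_on U (\<lambda>z. grad \<rho> z /\<^sub>R norm (grad \<rho> z))"
    using grad_nz by (intro continuous_intros g) auto
  then show ?thesis
    by (rule continuous_on_eq) (simp add: eta_U)
qed

text \<open>Measurability comes from continuity in the moving frame on \<open>D \<inter> U\<close>.
  For the bound, the weighted derivative at \<open>\<zeta>\<close> is the modulus of the derivative
  at the origin of the chart at \<open>\<zeta>\<close>, the dilation factors being exactly the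
  weight.\<close>

lemma weighted_dbar_bounded:
  fixes h :: "complex^2 \<Rightarrow> complex"
  assumes "0 < \<delta>" "smooth_on h D" "\<And>k. unif_Ck (chart \<delta>) k (\<lambda>\<zeta> w. h (\<zeta> + L \<zeta> w))"
  shows "in_Lq (lebesgue_on (D \<inter> U)) \<infinity> (weighted_dbar \<rho> \<eta> v a b h)"
proof -
  have "continuous_on (D \<inter> U) (\<lambda>z. (dbar (\<eta> z) ^^ a) ((dbar (v z) ^^ b) h) z)"
    by (rule continuous_dbar_funpow2[OF _ _ _ open_D assms(2)])
      (use continuous_eta smooth_onD(1)[OF smooth_v] in \<open>auto intro: continuous_on_subset\<close>)
  then have "continuous_on (D \<inter> U) (\<lambda>z. koranyi_deriv \<eta> v 0 0 a b h z 0)"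
    by (rule continuous_on_eq) (use koranyi_deriv_eq_dbar[OF assms(2) open_D] in auto)
  moreover have "\<rho> z \<noteq> 0" if "z \<in> D" for z using that D_iff by auto
  ultimately have "continuous_on (D \<inter> U) (weighted_dbar \<rho> \<eta> v a b h)"
    unfolding weighted_dbar_def[abs_def]
    by (intro continuous_intros continuous_rho) auto
  moreover have "D \<inter> U \<in> sets lebesgue"
    using open_D open_U by (intro sets_completionI_sets) auto
  ultimately have meas: "weighted_dbar \<rho> \<eta> v a b h \<in> borel_measurable (lebesgue_on (D \<inter> U))"
    by (rule continuous_imp_measurable_on_sets_lebesgue)
  obtain C where C: "\<And>\<zeta> w. w \<in> chart \<delta> \<zeta> \<Longrightarrow> norm (wirt_multi 0 0 a b (\<lambda>w. h (\<zeta> + L \<zeta> w)) w) \<le> C"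
    using unif_Ck_bound[OF unif_Ck_wirt_multi[OF assms(3) open_chart, where k = 0 and a = 0 and b = 0 and a' = a and b' = b]]
    by blast
  have "weighted_dbar \<rho> \<eta> v a b h \<zeta> \<le> C" if \<zeta>: "\<zeta> \<in> D" for \<zeta>
  proof -
    let ?s = "\<bar>\<rho> \<zeta>\<bar>"
    let ?F = "\<lambda>w. h (\<zeta> + frame_map (\<eta> \<zeta>) (v \<zeta>) w)"
    have s: "0 < ?s" using \<zeta> D_iff by auto
    have 0: "dilation ?s (sqrt ?s) 0 = 0" using linear_0[OF linear_dilation] .
    have "wirt_multi 0 0 a b (\<lambda>w. h (\<zeta> + L \<zeta> w)) 0 =
        of_real ?s ^ (0 + a) * of_real (sqrt ?s) ^ (0 + b) * wirt_multi 0 0 a b ?F (dilation ?s (sqrt ?s) 0)"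
      unfolding L_def
      by (rule wirt_multi_dilation[OF smooth_on_affine[OF assms(2) linear_frame_map open_D] open_frame_vimage[OF open_D]])
        (use \<zeta> 0 linear_0[OF linear_frame_map] in simp)
    then have "weighted_dbar \<rho> \<eta> v a b h \<zeta> = norm (wirt_multi 0 0 a b (\<lambda>w. h (\<zeta> + L \<zeta> w)) 0)"
      using powr_half_integer[OF s, of a b] s
      by (simp add: weighted_dbar_def koranyi_deriv_eq_wirt_multi koranyi_point_eq 0 norm_mult norm_power mult_ac)
    also have "\<dots> \<le> C" using C \<zeta> assms(1) by (simp add: chart_def)
    finally show ?thesis .
  qed
  moreover have "0 \<le> weighted_dbar \<rho> \<eta> v a b h \<zeta>" for \<zeta>
    by (simp add: weighted_dbar_def)
  ultimately have "AE x in lebesgue_on (D \<inter> U). norm (weighted_dbar \<rho> \<eta> v a b h x) \<le> C"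
    by (intro AE_I2) (auto simp: space_restrict_space)
  then show ?thesis using meas by (auto simp: in_Lq_def)
qed

section \<open>Koranyi balls and the local solutions in charts\<close>

lemma open_koranyi_bidisc: "open (koranyi_bidisc r)"
  unfolding koranyi_bidisc_def by (intro open_Collect_conj open_Collect_less continuous_intros)

text \<open>In the chart the bidisc of parameter \<open>\<kappa> * \<bar>\<rho> z\<bar>\<close> has
  radii \<open>\<kappa>\<close> and \<open>sqrt \<kappa>\<close>; a round ball of the smaller radius
  fits into it.\<close>

lemma dilation_bidisc:
  assumes "z \<in> D" "norm w < min \<kappa> (sqrt \<kappa>)"
  shows "dilation \<bar>\<rho> z\<bar> (sqrt \<bar>\<rho> z\<bar>) w \<in> koranyi_bidisc (\<kappa> * \<bar>\<rho> z\<bar>)"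
proof -
  have "0 < \<bar>\<rho> z\<bar>" using assms(1) D_iff by auto
  moreover have "norm (w $ 1) < \<kappa>" "norm (w $ 2) < sqrt \<kappa>"
    using assms(2) Finite_Cartesian_Product.norm_nth_le[of w] by (metis min_less_iff_conj order_le_less_trans)+
  ultimately show ?thesis
    by (simp add: koranyi_bidisc_def real_sqrt_mult mult.commute)
qed

lemma koranyi_ball_eq:
  assumes "z \<in> D"
  shows "koranyi_ball \<eta> v z r = {x. frame_coords (\<eta> z) (v z) (x - z) \<in> koranyi_bidisc r}"
proof safe
  show "frame_coords (\<eta> z) (v z) (x - z) \<in> koranyi_bidisc r" if "x \<in> koranyi_ball \<eta> v z r" for x
    using that by (auto simp: koranyi_ball_def koranyi_point_eq frame_coords_map[OF orthonormal_frame[OF assms]])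
  show "x \<in> koranyi_ball \<eta> v z r" if "frame_coords (\<eta> z) (v z) (x - z) \<in> koranyi_bidisc r" for x
    unfolding koranyi_ball_def
    by (rule image_eqI[OF _ that]) (simp add: koranyi_point_eq frame_map_coords[OF orthonormal_frame[OF assms]])
qed

lemma open_koranyi_ball:
  assumes "z \<in> D" shows "open (koranyi_ball \<eta> v z r)"
proof -
  have "continuous_on UNIV (\<lambda>x. frame_coords (\<eta> z) (v z) (x - z))"
    by (rule continuous_on_compose2[OF linear_continuous_on[of "frame_coords (\<eta> z) (v z)"]])
      (auto intro!: continuous_intros simp: linear_frame_coords linear_conv_bounded_linear[symmetric])
  from open_vimage[OF open_koranyi_bidisc this] show ?thesis
    by (simp add: koranyi_ball_eq[OF assms] vimage_def)
qed

text \<open>Hypothesis (b) speaks of undilated Koranyi coordinates. The dilation multiplies each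
  derivative by its weight, so in the chart the same constant bounds it.\<close>

lemma unif_Ck_from_koranyi_derivs:
  fixes gh :: "complex^2 \<Rightarrow> complex^2 \<Rightarrow> complex"
  assumes sm: "\<And>z. z \<in> D \<Longrightarrow> smooth_on (gh z) (koranyi_ball \<eta> v z (\<kappa> * \<bar>\<rho> z\<bar>))"
    and bd: "\<And>a b a' b'. \<exists>c. \<forall>z\<in>D. \<forall>w \<in> koranyi_bidisc (\<kappa> * \<bar>\<rho> z\<bar>).
      norm (koranyi_deriv \<eta> v a b a' b' (gh z) z w) * \<bar>\<rho> z\<bar> powr (real (a + a') + real (b + b') / 2) \<le> c"
  shows "unif_Ck (chart (min \<kappa> (sqrt \<kappa>))) k (\<lambda>z w. gh z (z + L z w))"
proof (rule unif_Ck_from_wirt_multi[OF _ open_chart])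
  define F where "F z w = gh z (z + frame_map (\<eta> z) (v z) w)" for z w
  have smF: "smooth_on (F z) (koranyi_bidisc (\<kappa> * \<bar>\<rho> z\<bar>))" if "z \<in> D" for z
    unfolding F_def[abs_def]
    by (rule smooth_on_subset[OF smooth_on_affine[OF sm[OF that] linear_frame_map open_koranyi_ball[OF that]]])
      (auto simp: koranyi_ball_def koranyi_point_eq)
  have eq: "gh z (z + L z w) = F z (0 + dilation \<bar>\<rho> z\<bar> (sqrt \<bar>\<rho> z\<bar>) w)" for z w
    by (simp add: F_def L_def)
  show "smooth_on (\<lambda>w. gh z (z + L z w)) (chart (min \<kappa> (sqrt \<kappa>)) z)" for z
  proof (cases "z \<in> D")
    case True
    show ?thesis
      unfolding eq
      by (rule smooth_on_subset[OF smooth_on_affine[OF smF[OF True] linear_dilation open_koranyi_bidisc]])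
        (use dilation_bidisc in \<open>auto simp: chart_def\<close>)
  next
    case False
    then have "chart (min \<kappa> (sqrt \<kappa>)) z = {}" by (simp add: chart_def)
    then show ?thesis using smooth_on_cover[of "{}"] by simp
  qed
  fix a b a' b'
  obtain c where c: "\<And>z w. z \<in> D \<Longrightarrow> w \<in> koranyi_bidisc (\<kappa> * \<bar>\<rho> z\<bar>) \<Longrightarrow>
      norm (wirt_multi a b a' b' (F z) w) * \<bar>\<rho> z\<bar> powr (real (a + a') + real (b + b') / 2) \<le> c"
    using bd[of a b a' b'] unfolding koranyi_deriv_eq_wirt_multi koranyi_point_eq F_def[abs_def] by blast
  have "norm (wirt_multi a b a' b' (\<lambda>w. gh z (z + L z w)) w) \<le> c" if w: "w \<in> chart (min \<kappa> (sqrt \<kappa>)) z" for z w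
  proof -
    let ?s = "\<bar>\<rho> z\<bar>"
    have z: "z \<in> D" using w by (simp add: chart_def)
    have s: "0 < ?s" using z D_iff by auto
    have wb: "dilation ?s (sqrt ?s) w \<in> koranyi_bidisc (\<kappa> * ?s)"
      using dilation_bidisc[OF z] w by (simp add: chart_def)
    have "norm (wirt_multi a b a' b' (\<lambda>w. gh z (z + L z w)) w) =
        norm (wirt_multi a b a' b' (F z) (dilation ?s (sqrt ?s) w)) * (?s ^ (a + a') * sqrt ?s ^ (b + b'))"
      using wirt_multi_dilation[OF smF[OF z] open_koranyi_bidisc wb, of a b a' b'] s
      by (simp add: eq norm_mult norm_power)
    also have "\<dots> \<le> c"
      using c[OF z wb] by (simp only: powr_half_integer[OF s])
    finally show ?thesis .
  qed
  then show "\<exists>C. \<forall>z. \<forall>w\<in>chart (min \<kappa> (sqrt \<kappa>)) z. norm (wirt_multi a b a' b' (\<lambda>w. gh z (z + L z w)) w) \<le> C"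
    by blast
qed

end

text \<open>Every centre with nonzero weight at \<open>x\<close> has \<open>x\<close> in its ball,
  so its local solutions divide \<open>g\<close> at \<open>x\<close>. This relation survives
  averaging with weights of sum 1, provided that both components are averaged with the same
  weights.\<close>

lemma (in koranyi_domain) glue_local_divisions:
  fixes gh1 gh2 :: "complex^2 \<Rightarrow> complex^2 \<Rightarrow> complex"
  assumes \<kappa>: "0 < \<kappa>"
    and sm: "\<And>z. z \<in> D \<Longrightarrow> smooth_on (gh1 z) (koranyi_ball \<eta> v z (\<kappa> * \<bar>\<rho> z\<bar>))"
      "\<And>z. z \<in> D \<Longrightarrow> smooth_on (gh2 z) (koranyi_ball \<eta> v z (\<kappa> * \<bar>\<rho> z\<bar>))"
    and eq: "\<And>z x. z \<in> D \<Longrightarrow> x \<in> koranyi_ball \<eta> v z (\<kappa> * \<bar>\<rho> z\<bar>) \<inter> D \<Longrightarrow> g x = gh1 z x * f1 x + gh2 z x * f2 x"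
    and bd: "\<And>a b a' b'. \<exists>c. \<forall>z\<in>D. \<forall>w \<in> koranyi_bidisc (\<kappa> * \<bar>\<rho> z\<bar>).
      norm (koranyi_deriv \<eta> v a b a' b' (gh1 z) z w) * \<bar>\<rho> z\<bar> powr (real (a + a') + real (b + b') / 2) \<le> c"
      "\<And>a b a' b'. \<exists>c. \<forall>z\<in>D. \<forall>w \<in> koranyi_bidisc (\<kappa> * \<bar>\<rho> z\<bar>).
      norm (koranyi_deriv \<eta> v a b a' b' (gh2 z) z w) * \<bar>\<rho> z\<bar> powr (real (a + a') + real (b + b') / 2) \<le> c"
  obtains gt1 gt2 :: "complex^2 \<Rightarrow> complex" and \<delta> where "0 < \<delta>"
    "\<And>\<zeta> w. w \<in> chart \<delta> \<zeta> \<Longrightarrow> \<zeta> + L \<zeta> w \<in> D"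
    "\<And>k. unif_Ck (chart \<delta>) k (\<lambda>\<zeta> w. gt1 (\<zeta> + L \<zeta> w))"
    "\<And>k. unif_Ck (chart \<delta>) k (\<lambda>\<zeta> w. gt2 (\<zeta> + L \<zeta> w))"
    "\<And>x. x \<in> D \<Longrightarrow> g x = gt1 x * f1 x + gt2 x * f2 x"
proof -
  define \<kappa>' where "\<kappa>' = min \<kappa> (sqrt \<kappa>)"
  have \<kappa>': "0 < \<kappa>'" using \<kappa> by (simp add: \<kappa>'_def)
  have C1: "unif_Ck (\<lambda>z. {w. z \<in> D \<and> norm w < \<kappa>'}) k (\<lambda>z w. gh1 z (z + L z w))" for k
    using unif_Ck_from_koranyi_derivs[OF sm(1) bd(1)] by (simp add: \<kappa>'_def chart_def[abs_def])
  have C2: "unif_Ck (\<lambda>z. {w. z \<in> D \<and> norm w < \<kappa>'}) k (\<lambda>z w. gh2 z (z + L z w))" for k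
    using unif_Ck_from_koranyi_derivs[OF sm(2) bd(2)] by (simp add: \<kappa>'_def chart_def[abs_def])
  obtain c C where sv: "slowly_varying D L Li c C" by (rule slowly_varying_frames)
  obtain \<delta> :: real and p :: "complex^2 \<Rightarrow> complex^2 \<Rightarrow> complex" where \<delta>: "0 < \<delta>" "\<delta> \<le> c"
    and p: "\<And>x. x \<in> D \<Longrightarrow> finite {z. p x z \<noteq> 0}"
      "\<And>x z. x \<in> D \<Longrightarrow> p x z \<noteq> 0 \<Longrightarrow> z \<in> D \<and> norm (Li z (x - z)) < \<kappa>'"
      "\<And>x. x \<in> D \<Longrightarrow> (\<Sum>z | p x z \<noteq> 0. p x z) = 1"
    and glue: "\<forall>F. (\<forall>k. unif_Ck (\<lambda>z. {w. z \<in> D \<and> norm w < \<kappa>'}) k (\<lambda>z w. F z (z + L z w))) \<longrightarrow>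
        (\<forall>k. unif_Ck (\<lambda>\<zeta>. {w. \<zeta> \<in> D \<and> norm w < \<delta>}) k
          (\<lambda>\<zeta> w. \<Sum>z | p (\<zeta> + L \<zeta> w) z \<noteq> 0. p (\<zeta> + L \<zeta> w) z * F z (\<zeta> + L \<zeta> w)))"
    by (rule slowly_varying.partition_weights[OF sv \<kappa>']) (rule that)
  have in_ball: "x \<in> koranyi_ball \<eta> v z (\<kappa> * \<bar>\<rho> z\<bar>)" if "z \<in> D" "norm (Li z (x - z)) < \<kappa>'" for x z
  proof -
    have "x = koranyi_point \<eta> v z (dilation \<bar>\<rho> z\<bar> (sqrt \<bar>\<rho> z\<bar>) (Li z (x - z)))"
      using L_Li[OF that(1), of "x - z"] by (simp add: koranyi_point_eq L_def)
    then show ?thesis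
      unfolding koranyi_ball_def using dilation_bidisc[OF that(1)] that(2) by (auto simp: \<kappa>'_def)
  qed
  define gt where "gt gh x = (\<Sum>z | p x z \<noteq> 0. p x z * gh z x)" for gh :: "complex^2 \<Rightarrow> complex^2 \<Rightarrow> complex" and x
  show thesis
  proof (rule that[OF \<delta>(1)])
    show "\<zeta> + L \<zeta> w \<in> D" if "w \<in> chart \<delta> \<zeta>" for \<zeta> w
      using slowly_varying.near_in[OF sv, of \<zeta> "\<zeta> + L \<zeta> w"] that \<delta>(2) by (simp add: chart_def Li_L)
    show "unif_Ck (chart \<delta>) k (\<lambda>\<zeta> w. gt gh1 (\<zeta> + L \<zeta> w))" for k
      using glue[rule_format, OF C1] by (simp add: gt_def chart_def[abs_def])
    show "unif_Ck (chart \<delta>) k (\<lambda>\<zeta> w. gt gh2 (\<zeta> + L \<zeta> w))" for k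
      using glue[rule_format, OF C2] by (simp add: gt_def chart_def[abs_def])
    fix x assume x: "x \<in> D"
    have local_eq: "g x = gh1 z x * f1 x + gh2 z x * f2 x" if "p x z \<noteq> 0" for z
      using eq[of z x] in_ball[of z x] p(2)[OF x that] x by blast
    have "gt gh1 x * f1 x + gt gh2 x * f2 x = (\<Sum>z | p x z \<noteq> 0. p x z * (gh1 z x * f1 x + gh2 z x * f2 x))"
      by (simp add: gt_def sum_distrib_right distrib_left sum.distrib mult.assoc)
    also have "\<dots> = (\<Sum>z | p x z \<noteq> 0. p x z * g x)"
      by (rule sum.cong) (auto simp: local_eq)
    also have "\<dots> = g x"
      using p(3)[OF x] by (simp flip: sum_distrib_right)
    finally show "g x = gt gh1 x * f1 x + gt gh2 x * f2 x" ..
  qed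
qed

theorem theorem1p2:
  fixes \<rho> :: "complex^2 \<Rightarrow> real"
    and U D W :: "(complex^2) set"
    and \<eta> v :: "complex^2 \<Rightarrow> complex^2"
    and f1 f2 g :: "complex^2 \<Rightarrow> complex"
    and k1 k2 :: nat
  assumes "strictly_convex_domain \<rho> U D"
    and "koranyi_frame \<rho> U D \<eta> v"
    and "open W" and "closure D \<subseteq> W"
    and "holomorphic2_on f1 W" and "holomorphic2_on f2 W"
    and "transverse_to_boundary \<rho> D (zero_set f1 W)"
    and "transverse_to_boundary \<rho> D (zero_set f2 W)"
    and "complete_intersection (zero_set f1 W) (zero_set f2 W)"
    and "k1 \<ge> 1" and "k2 \<ge> 1"
    and "division_property \<rho> U D \<eta> v f1 f2 k1 k2"
    and "holomorphic2_on g D"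
    and "\<exists>\<kappa>>0. \<exists>(gh1 :: complex^2 \<Rightarrow> complex^2 \<Rightarrow> complex) (gh2 :: complex^2 \<Rightarrow> complex^2 \<Rightarrow> complex).
           (\<forall>z\<in>D.
              smooth_on (gh1 z) (koranyi_ball \<eta> v z (\<kappa> * \<bar>\<rho> z\<bar>)) \<and>
              smooth_on (gh2 z) (koranyi_ball \<eta> v z (\<kappa> * \<bar>\<rho> z\<bar>)) \<and>
              (\<forall>\<zeta> \<in> koranyi_ball \<eta> v z (\<kappa> * \<bar>\<rho> z\<bar>) \<inter> D.
                 g \<zeta> = gh1 z \<zeta> * f1 \<zeta> + gh2 z \<zeta> * f2 \<zeta>)) \<and>
           (\<forall>\<alpha> \<beta> \<alpha>' \<beta>' :: nat. \<exists>c>0. \<forall>z\<in>D. \<forall>w \<in> koranyi_bidisc (\<kappa> * \<bar>\<rho> z\<bar>).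
              norm (koranyi_deriv \<eta> v \<alpha> \<beta> \<alpha>' \<beta>' (gh1 z) z w)
                * \<bar>\<rho> z\<bar> powr (real (\<alpha> + \<alpha>') + real (\<beta> + \<beta>') / 2) \<le> c \<and>
              norm (koranyi_deriv \<eta> v \<alpha> \<beta> \<alpha>' \<beta>' (gh2 z) z w)
                * \<bar>\<rho> z\<bar> powr (real (\<alpha> + \<alpha>') + real (\<beta> + \<beta>') / 2) \<le> c)"
  shows "\<exists>gt1 gt2 :: complex^2 \<Rightarrow> complex.
           smooth_on gt1 D \<and> smooth_on gt2 D \<and>
           (\<forall>z\<in>D. g z = gt1 z * f1 z + gt2 z * f2 z) \<and>
           (\<exists>N::nat. vanishes_to_order k2 (\<lambda>z. \<bar>\<rho> z\<bar> ^ N *\<^sub>R gt1 z) D \<and>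
                     vanishes_to_order k2 (\<lambda>z. \<bar>\<rho> z\<bar> ^ N *\<^sub>R gt2 z) D) \<and>
           (\<forall>\<alpha> \<beta>. \<alpha> + \<beta> \<le> k1 \<longrightarrow>
              in_Lq (lebesgue_on (D \<inter> U)) \<infinity> (weighted_dbar \<rho> \<eta> v \<alpha> \<beta> gt1) \<and>
              in_Lq (lebesgue_on (D \<inter> U)) \<infinity> (weighted_dbar \<rho> \<eta> v \<alpha> \<beta> gt2))"
proof -
  interpret koranyi_domain \<rho> U D \<eta> v
    using assms(1,2) by unfold_locales
  obtain \<kappa> gh1 gh2 where \<kappa>: "0 < \<kappa>"
    and loc: "\<forall>z\<in>D.
              smooth_on (gh1 z) (koranyi_ball \<eta> v z (\<kappa> * \<bar>\<rho> z\<bar>)) \<and>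
              smooth_on (gh2 z) (koranyi_ball \<eta> v z (\<kappa> * \<bar>\<rho> z\<bar>)) \<and>
              (\<forall>\<zeta> \<in> koranyi_ball \<eta> v z (\<kappa> * \<bar>\<rho> z\<bar>) \<inter> D.
                 g \<zeta> = gh1 z \<zeta> * f1 \<zeta> + gh2 z \<zeta> * f2 \<zeta>)"
    and bd: "\<forall>\<alpha> \<beta> \<alpha>' \<beta>' :: nat. \<exists>c>0. \<forall>z\<in>D. \<forall>w \<in> koranyi_bidisc (\<kappa> * \<bar>\<rho> z\<bar>).
              norm (koranyi_deriv \<eta> v \<alpha> \<beta> \<alpha>' \<beta>' (gh1 z) z w)
                * \<bar>\<rho> z\<bar> powr (real (\<alpha> + \<alpha>') + real (\<beta> + \<beta>') / 2) \<le> c \<and>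
              norm (koranyi_deriv \<eta> v \<alpha> \<beta> \<alpha>' \<beta>' (gh2 z) z w)
                * \<bar>\<rho> z\<bar> powr (real (\<alpha> + \<alpha>') + real (\<beta> + \<beta>') / 2) \<le> c"
    using assms(14) by blast
  obtain gt1 gt2 \<delta> where \<delta>: "0 < \<delta>" and chart_D: "\<And>\<zeta> w. w \<in> chart \<delta> \<zeta> \<Longrightarrow> \<zeta> + L \<zeta> w \<in> D"
    and gt1: "\<And>k. unif_Ck (chart \<delta>) k (\<lambda>\<zeta> w. gt1 (\<zeta> + L \<zeta> w))"
    and gt2: "\<And>k. unif_Ck (chart \<delta>) k (\<lambda>\<zeta> w. gt2 (\<zeta> + L \<zeta> w))"
    and eq: "\<And>x. x \<in> D \<Longrightarrow> g x = gt1 x * f1 x + gt2 x * f2 x"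
  proof (rule glue_local_divisions[OF \<kappa>, of gh1 gh2 g f1 f2])
    fix a b a' b'
    show "\<exists>c. \<forall>z\<in>D. \<forall>w \<in> koranyi_bidisc (\<kappa> * \<bar>\<rho> z\<bar>).
      norm (koranyi_deriv \<eta> v a b a' b' (gh1 z) z w) * \<bar>\<rho> z\<bar> powr (real (a + a') + real (b + b') / 2) \<le> c"
      using bd by meson
    show "\<exists>c. \<forall>z\<in>D. \<forall>w \<in> koranyi_bidisc (\<kappa> * \<bar>\<rho> z\<bar>).
      norm (koranyi_deriv \<eta> v a b a' b' (gh2 z) z w) * \<bar>\<rho> z\<bar> powr (real (a + a') + real (b + b') / 2) \<le> c"
      using bd by meson
  qed (use loc in blast)+
  have smooth: "smooth_on h D" if "\<And>k. unif_Ck (chart \<delta>) k (\<lambda>\<zeta> w. h (\<zeta> + L \<zeta> w))" for h :: "complex^2 \<Rightarrow> complex"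
    using smooth_on_from_charts[OF \<delta> that] .
  \<comment> \<open>The functions themselves are bounded, so the growth exponent starts at 0. Each
    of at most \<open>k2\<close> derivatives then uses two units of the power of
    \<open>\<bar>\<rho>\<bar>\<close>, and the remaining unit forces the limit 0.\<close>
  have "vanishes_to_order k2 (\<lambda>z. \<bar>\<rho> z\<bar> ^ (2 * k2 + 1) *\<^sub>R h z) D"
    if h: "\<And>k. unif_Ck (chart \<delta>) k (\<lambda>\<zeta> w. h (\<zeta> + L \<zeta> w))" for h :: "complex^2 \<Rightarrow> complex"
  proof -
    have "Ck_bdd (\<lambda>x. \<bar>\<rho> x\<bar>) (\<lambda>_::unit. D) k 0 (\<lambda>_. h)" for k
      by (rule weighted_bounds_from_charts[OF \<delta> chart_D smooth[OF h]]) (use h in simp_all)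
    note lim = tendsto_0_at_frontier[OF this]
    show ?thesis
      unfolding vanishes_to_order_def by (intro allI impI ballI lim) simp_all
  qed
  then show ?thesis
    using smooth gt1 gt2 eq weighted_dbar_bounded[OF \<delta> smooth] by blast
qed

end
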